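(* Under the density hypothesis on $G$ and the integrability condition $\mathbb E[\sup_{t\in[0,T]}|L_t|+|\xi|]<\infty$ on the payoff, for every $t\in[0,T]$, $$\operatorname*{ess\,sup}_{\tau'\in\mathcal T_{t,T}(\mathbb G)}\mathbb E\left[R(\tau')\,|\,\mathcal F_t\right]=\int_{\mathbb R}\left(\operatorname*{ess\,sup}_{\tau(\cdot)\in\mathcal T_{t,T}(\widehat{\mathbb F})}\widehat{\mathbb E}\left[R(\cdot,\tau(\cdot))\,|\,\widehat{\mathcal F}_t\right]\right)_{u}dP^G(u)\qquad \mathbb P\text{-a.s.}$$
   Context: Let $T>0$ and let $(\Omega,\mathcal F,\mathbb F=(\mathcal F_t)_{t\in[0,T]},\mathbb P)$ be a filtered probability space with $\mathbb F$ right-continuous and complete and $\mathcal F_0$ trivial. Let $G:\Omega\to\mathbb R$ be a random variable with law $P^G$, and let $\mathbb G=(\mathcal G_t)_{t\in[0,T]}$, $\mathcal G_t=\mathcal F_t\vee\sigma(G)$. Density hypothesis: for every $t\in[0,T]$ the regular conditional law $P^G_t(\omega,\cdot)$ of $G$ given $\mathcal F_t$ is equivalent to $P^G$ for $\mathbb P$-a.e. $\omega$. For each $t\in[0,T]$, $\alpha_t(u)(\omega)=\frac{dP^G_t(\omega,\cdot)}{dP^G}(u)$ denotes an $\mathcal F\otimes\mathcal B(\mathbb R)$-measurable, strictly positive version of the density (which exists by a result of Jacod); for each $u\in\mathbb R$, $(\alpha_t(u))_{t\in[0,T]}$ is an $\mathbb F$-martingale. Product space: $\widehat\Omega=\Omega\times\mathbb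 R$, $\widehat{\mathcal F}=\mathcal F\otimes\mathcal B(\mathbb R)$, $\widehat{\mathcal F}_t=\bigcap_{s>t}(\mathcal F_s\otimes\mathcal B(\mathbb R))$, $\widehat{\mathbb F}=(\widehat{\mathcal F}_t)_{t\in[0,T]}$, $\widehat{\mathbb P}=\mathbb P\otimes P^G$, with expectation $\widehat{\mathbb E}$. It is assumed (without loss of generality) that $(\widehat\Omega,\widehat{\mathcal F},\widehat{\mathbb P})$ is complete and that $\widehat{\mathcal F}_0$ contains all $\widehat{\mathbb P}$-null sets of $\widehat{\mathcal F}$. For a function $X$ on $\widehat\Omega$, $X_u=X(u)=X(\cdot,u)$. Payoff: $R(t)=L_t1_{[0,T)}(t)+\xi1_{\{T\}}(t)$, where $L$ is a real-valued càdlàg $\mathbb F$-adapted process, $\xi$ is an $\mathcal F_T$-measurable random variable, and $0\le L_T\le\xi<\infty$. The payoff on the product space is $R(u,t)=L_t\alpha_t(u)1_{[0,T)}(t)+\xi\alpha_T(u)1_{\{T\}}(t)$. $R(\cdot,\tau(\cdot))$ is the map $(\omega,u)\mapsto R(u,\tau(\omega,u))(\omega)$. For a filtration $\mathbb H$, $\mathcal T_{t,T}(\mathbb H)$ is the set of $\mathbb H$-stopping times with values in $[t,T]$.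
   Formalization: The density process α(u) is additionally assumed càdlàg in t for every u; for an arbitrary martingale version, α can be changed at a stopping time with diffuse law and the identity fails. *)

theory Defs
  imports "HOL-Probability.Probability"
begin

text \<open>
  Families indexed by \<open>[0,T]\<close> are functions on \<open>real\<close> of which only the values on
  \<open>{0..T}\<close> matter. The constant extension beyond both ends makes the library's
  \<open>filtration\<close> and \<open>stopping_time\<close>, which quantify over the whole index type, speak
  about \<open>[0,T]\<close> only; it also fixes the convention \<open>F\<^sub>s = F\<^sub>T\<close> for \<open>s > T\<close>.
\<close>

definition index_ext :: "real \<Rightarrow> (real \<Rightarrow> 'b) \<Rightarrow> real \<Rightarrow> 'b" where
  "index_ext T H = (\<lambda>s. H (max 0 (min T s)))"

definition filtered_prob_space :: "'a measure \<Rightarrow> real \<Rightarrow> (real \<Rightarrow> 'a measure) \<Rightarrow> bool" where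
  "filtered_prob_space M T F \<longleftrightarrow>
     prob_space M \<and> filtration (space M) (index_ext T F) \<and> (\<forall>t\<in>{0..T}. subalgebra M (F t))"

definition right_continuous_filtration :: "real \<Rightarrow> (real \<Rightarrow> 'a measure) \<Rightarrow> bool" where
  "right_continuous_filtration T F \<longleftrightarrow>
     (\<forall>t\<in>{0..<T}. sets (F t) = (\<Inter>s\<in>{t<..T}. sets (F s)))"

definition complete_filtration :: "'a measure \<Rightarrow> (real \<Rightarrow> 'a measure) \<Rightarrow> bool" where
  "complete_filtration M F \<longleftrightarrow> complete_measure M \<and> null_sets M \<subseteq> sets (F 0)"

definition trivial_sigma_algebra :: "'a measure \<Rightarrow> 'a measure \<Rightarrow> bool" where
  "trivial_sigma_algebra M N \<longleftrightarrow> (\<forall>A\<in>sets N. measure M A = 0 \<or> measure M A = 1)"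

definition stopping_times ::
  "real \<Rightarrow> (real \<Rightarrow> 'a measure) \<Rightarrow> real \<Rightarrow> ('a \<Rightarrow> real) set" where
  "stopping_times T H t =
     {\<tau>. stopping_time (index_ext T H) \<tau> \<and> (\<forall>\<omega>\<in>space (H t). \<tau> \<omega> \<in> {t..T})}"

definition adapted :: "real \<Rightarrow> (real \<Rightarrow> 'a measure) \<Rightarrow> (real \<Rightarrow> 'a \<Rightarrow> real) \<Rightarrow> bool" where
  "adapted T F X \<longleftrightarrow> (\<forall>t\<in>{0..T}. X t \<in> borel_measurable (F t))"

definition cadlag :: "'a measure \<Rightarrow> real \<Rightarrow> (real \<Rightarrow> 'a \<Rightarrow> real) \<Rightarrow> bool" where
  "cadlag M T X \<longleftrightarrow> (\<forall>\<omega>\<in>space M.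
     (\<forall>t\<in>{0..<T}. continuous (at_right t) (\<lambda>s. X s \<omega>)) \<and>
     (\<forall>t\<in>{0<..T}. \<exists>l. ((\<lambda>s. X s \<omega>) \<longlongrightarrow> l) (at_left t)))"

definition martingale ::
  "'a measure \<Rightarrow> real \<Rightarrow> (real \<Rightarrow> 'a measure) \<Rightarrow> (real \<Rightarrow> 'a \<Rightarrow> real) \<Rightarrow> bool" where
  "martingale M T F X \<longleftrightarrow> adapted T F X \<and> (\<forall>t\<in>{0..T}. integrable M (X t)) \<and>
     (\<forall>t\<in>{0..T}. \<forall>s\<in>{0..t}. AE \<omega> in M. real_cond_exp M (F s) (X t) \<omega> = X s \<omega>)"

definition law :: "'a measure \<Rightarrow> ('a \<Rightarrow> real) \<Rightarrow> real measure" where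
  "law M G = distr M borel G"

definition regular_cond_law ::
  "'a measure \<Rightarrow> 'a measure \<Rightarrow> ('a \<Rightarrow> real) \<Rightarrow> ('a \<Rightarrow> real measure) \<Rightarrow> bool" where
  "regular_cond_law M N G \<kappa> \<longleftrightarrow> \<kappa> \<in> N \<rightarrow>\<^sub>M prob_algebra borel \<and>
     (\<forall>B\<in>sets borel. AE \<omega> in M.
        measure (\<kappa> \<omega>) B = real_cond_exp M N (\<lambda>\<omega>'. indicator B (G \<omega>')) \<omega>)"

definition equivalent_measures :: "'a measure \<Rightarrow> 'a measure \<Rightarrow> bool" where
  "equivalent_measures \<mu> \<nu> \<longleftrightarrow>
     sets \<mu> = sets \<nu> \<and> absolutely_continuous \<mu> \<nu> \<and> absolutely_continuous \<nu> \<mu>"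

definition enlarged_filtration ::
  "'a measure \<Rightarrow> (real \<Rightarrow> 'a measure) \<Rightarrow> ('a \<Rightarrow> real) \<Rightarrow> real \<Rightarrow> 'a measure" where
  "enlarged_filtration M F G t =
     sigma (space M) (sets (F t) \<union> sets (vimage_algebra (space M) G borel))"

text \<open>
  Passing to the completion (and adjoining all its null sets to the filtration) is what the
  assumption, made without loss of generality, that the product space is complete amounts to:
  the uncompleted \<open>M \<Otimes>\<^sub>M law M G\<close> is never complete, since some \<open>law M G\<close>-null Borel set
  has a non-Borel subset. Accordingly, sections \<open>u \<mapsto> X (\<omega>, u)\<close> of functions measurable for
  the completed product are, for a.e. \<open>\<omega>\<close>, measurable for \<open>completion (law M G)\<close> but possibly
  not Borel, so it is this measure they are to be integrated against.
\<close>

definition product_space :: "'a measure \<Rightarrow> ('a \<Rightarrow> real) \<Rightarrow> ('a \<times> real) measure" where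
  "product_space M G = completion (M \<Otimes>\<^sub>M law M G)"

definition product_filtration ::
  "'a measure \<Rightarrow> real \<Rightarrow> (real \<Rightarrow> 'a measure) \<Rightarrow> ('a \<Rightarrow> real) \<Rightarrow> real \<Rightarrow> ('a \<times> real) measure" where
  "product_filtration M T F G t =
     sigma (space (product_space M G))
       ((\<Inter>s\<in>{t<..}. sets (index_ext T F s \<Otimes>\<^sub>M (borel :: real measure)))
          \<union> null_sets (product_space M G))"

definition payoff ::
  "real \<Rightarrow> (real \<Rightarrow> 'a \<Rightarrow> real) \<Rightarrow> ('a \<Rightarrow> real) \<Rightarrow> real \<Rightarrow> 'a \<Rightarrow> real" where
  "payoff T L \<xi> t \<omega> = L t \<omega> * indicator {0..<T} t + \<xi> \<omega> * indicator {T} t"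

definition product_payoff ::
  "real \<Rightarrow> (real \<Rightarrow> 'a \<Rightarrow> real) \<Rightarrow> ('a \<Rightarrow> real) \<Rightarrow> (real \<Rightarrow> real \<Rightarrow> 'a \<Rightarrow> real)
     \<Rightarrow> real \<Rightarrow> real \<Rightarrow> 'a \<Rightarrow> real" where
  "product_payoff T L \<xi> \<alpha> u t \<omega> =
     L t \<omega> * \<alpha> t u \<omega> * indicator {0..<T} t + \<xi> \<omega> * \<alpha> T u \<omega> * indicator {T} t"

text \<open>
  The essential supremum of a family of random variables (the library's \<open>esssup\<close> is that of a
  single function): the a.s. smallest measurable function, with values in the extended reals,
  that a.s. dominates each member. It is unique up to a.s. equality; \<open>ess_sup\<close> picks a version.
\<close>

definition is_ess_sup ::
  "'a measure \<Rightarrow> 'i set \<Rightarrow> ('i \<Rightarrow> 'a \<Rightarrow> ereal) \<Rightarrow> ('a \<Rightarrow> ereal) \<Rightarrow> bool" where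
  "is_ess_sup M I X Y \<longleftrightarrow> Y \<in> borel_measurable M \<and> (\<forall>i\<in>I. AE \<omega> in M. X i \<omega> \<le> Y \<omega>) \<and>
     (\<forall>Z\<in>borel_measurable M. (\<forall>i\<in>I. AE \<omega> in M. X i \<omega> \<le> Z \<omega>) \<longrightarrow> (AE \<omega> in M. Y \<omega> \<le> Z \<omega>))"

definition ess_sup ::
  "'a measure \<Rightarrow> 'i set \<Rightarrow> ('i \<Rightarrow> 'a \<Rightarrow> ereal) \<Rightarrow> 'a \<Rightarrow> ereal" where
  "ess_sup M I X = (SOME Y. is_ess_sup M I X Y)"

definition value_enlarged ::
  "'a measure \<Rightarrow> real \<Rightarrow> (real \<Rightarrow> 'a measure) \<Rightarrow> ('a \<Rightarrow> real) \<Rightarrow> (real \<Rightarrow> 'a \<Rightarrow> real) \<Rightarrow> ('a \<Rightarrow> real)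
     \<Rightarrow> real \<Rightarrow> 'a \<Rightarrow> ereal" where
  "value_enlarged M T F G L \<xi> t =
     ess_sup M (stopping_times T (enlarged_filtration M F G) t)
       (\<lambda>\<tau> \<omega>. ereal (real_cond_exp M (F t) (\<lambda>\<omega>'. payoff T L \<xi> (\<tau> \<omega>') \<omega>') \<omega>))"

definition value_product ::
  "'a measure \<Rightarrow> real \<Rightarrow> (real \<Rightarrow> 'a measure) \<Rightarrow> ('a \<Rightarrow> real) \<Rightarrow> (real \<Rightarrow> real \<Rightarrow> 'a \<Rightarrow> real)
     \<Rightarrow> (real \<Rightarrow> 'a \<Rightarrow> real) \<Rightarrow> ('a \<Rightarrow> real) \<Rightarrow> real \<Rightarrow> 'a \<times> real \<Rightarrow> ereal" where
  "value_product M T F G \<alpha> L \<xi> t =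
     ess_sup (product_space M G) (stopping_times T (product_filtration M T F G) t)
       (\<lambda>\<tau> x. ereal (real_cond_exp (product_space M G) (product_filtration M T F G t)
          (\<lambda>(\<omega>, u). product_payoff T L \<xi> \<alpha> u (\<tau> (\<omega>, u)) \<omega>) x))"

end

theory Submission
  imports Defs
begin

text \<open>
  A stopping time \<open>\<tau>\<close> of the enlarged filtration has the form \<open>\<tau> \<omega> = \<sigma> (\<omega>, G \<omega>)\<close> for a stopping
  time \<open>\<sigma>\<close> of the product filtration. On \<open>F T \<Otimes>\<^sub>M borel\<close> the image of \<open>M\<close> under
  \<open>\<omega> \<mapsto> (\<omega>, G \<omega>)\<close> has density \<open>\<alpha> T\<close> with respect to the product measure, and optional sampling
  for the martingale \<open>\<alpha> _ u\<close>, with \<open>u\<close> fixed, replaces \<open>\<alpha> T\<close> by \<open>\<alpha>\<close> at time \<open>\<sigma>\<close>. Hence the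
  conditional expectation of the payoff at \<open>\<tau>\<close> given \<open>F t\<close> is the integral over \<open>u\<close> of the
  conditional expectation of the product payoff at \<open>\<sigma>\<close>. The latter family is directed upwards, so
  its essential supremum is an increasing limit along a sequence, and monotone convergence exchanges
  it with the integral over \<open>u\<close>. Conversely, for a product stopping time \<open>\<sigma>\<close> the times
  \<open>\<sigma> (\<omega>, G \<omega>) + 1 / n\<close> are stopping times of the enlarged filtration, and the payoff is
  right-continuous.
\<close>

section \<open>Approximation from above and essential suprema\<close>

text \<open>Integrability is assumed for the payoff \<open>R\<close> under \<open>M\<close>; no
  bound is given for the supremum over time of \<open>R\<close> times \<open>\<alpha>\<close> under
  the product measure. Integrability on the product is therefore transported, not estimated: the
  identity along the graph is proved for nonnegative integrands, where infinite values are allowed,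
  and then applied to the positive and negative parts of \<open>R\<close>, whose integrals under
  \<open>M\<close> are finite. This dictates the form of optional sampling: an equation between
  nonnegative integrals, reached from bounded weights by truncation, where the bounded case rests on
  uniform integrability of the sampled martingale. The other obstacle is the completed product
  space. Conditional expectations and the essential supremum live there up to null sets, whereas
  Fubini, sections and composition with the graph of \<open>G\<close> want sets of the uncompleted
  product. Every stopping time, conditional expectation and limit is hence exchanged for a version
  measurable without the completion before it is cut into sections.\<close>

lemma Inf_rational_upper_bounds:
  fixes y t T :: real
  assumes "t \<le> y" "y \<le> T"
  shows "Inf (insert T {q\<in>\<rat>. t \<le> q \<and> q < T \<and> y \<le> q}) = y" (is "Inf ?S = y")
proof (rule antisym)
  have bdd: "bdd_below ?S" using assms by (intro bdd_belowI[of _ y]) auto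
  show "Inf ?S \<le> y"
  proof (rule ccontr)
    assume "\<not> Inf ?S \<le> y"
    then obtain q where q: "q \<in> \<rat>" "y < q" "q < Inf ?S"
      using Rats_dense_in_real[of y "Inf ?S"] by auto
    have "Inf ?S \<le> T" using bdd by (intro cInf_lower) auto
    then have "q \<in> ?S" using q assms by auto
    then show False using bdd cInf_lower[of q ?S] q by auto
  qed
  show "y \<le> Inf ?S" using assms by (intro cInf_greatest) auto
qed

section \<open>Approximation of times from above by grids\<close>

definition grid :: "real \<Rightarrow> nat \<Rightarrow> int \<Rightarrow> real" where
  "grid T n i = max 0 (min T ((of_int i + 1) / (real n + 1)))"

text \<open>The floor picks the cell \<open>[i / (n + 1), (i + 1) / (n + 1))\<close> containing
  \<open>y\<close>, and \<open>grid\<close> returns its right end, clipped to \<open>[0,T]\<close>.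
  Half-open cells put the result strictly above every \<open>y < T\<close>, so that right limits
  apply and events given by strict inequalities are decided by that time.\<close>

definition upper_grid :: "real \<Rightarrow> nat \<Rightarrow> real \<Rightarrow> real" where
  "upper_grid T n y = grid T n \<lfloor>(real n + 1) * y\<rfloor>"

lemma grid_mem: "0 \<le> T \<Longrightarrow> grid T n i \<in> {0..T}"
  by (auto simp: grid_def)

lemma upper_grid_mem: "0 \<le> T \<Longrightarrow> upper_grid T n y \<in> {0..T}"
  by (simp add: upper_grid_def grid_mem del: atLeastAtMost_iff)

lemma tendsto_upper_grid:
  fixes f :: "real \<Rightarrow> 'b::topological_space"
  assumes y: "y \<in> {0..T}" and f: "y < T \<Longrightarrow> continuous (at_right y) f"
  shows "(\<lambda>n. f (upper_grid T n y)) \<longlonglongrightarrow> f y"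
proof -
  have lo: "y < (of_int \<lfloor>(real n + 1) * y\<rfloor> + 1) / (real n + 1)" for n
    by (simp add: pos_less_divide_eq) (metis add.commute floor_correct mult.commute of_int_1 of_int_add)
  have hi: "(of_int \<lfloor>(real n + 1) * y\<rfloor> + 1) / (real n + 1) \<le> y + 1 / (real n + 1)" for n
  proof -
    have "of_int \<lfloor>(real n + 1) * y\<rfloor> + 1 \<le> (real n + 1) * y + 1" by simp
    then have "(of_int \<lfloor>(real n + 1) * y\<rfloor> + 1) / (real n + 1) \<le> ((real n + 1) * y + 1) / (real n + 1)"
      by (intro divide_right_mono) auto
    also have "\<dots> = y + 1 / (real n + 1)" by (simp add: field_simps)
    finally show ?thesis .
  qed
  show ?thesis
  proof (cases "y = T")
    case True
    then have "upper_grid T n y = y" for n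
      using lo[of n] y by (simp add: upper_grid_def grid_def min_def)
    then show ?thesis by simp
  next
    case False
    then have yT: "y < T" using y by auto
    have gt: "y < upper_grid T n y" for n
      using lo[of n] yT y by (auto simp: upper_grid_def grid_def less_max_iff_disj)
    have le: "upper_grid T n y \<le> y + 1 / (real n + 1)" for n
      using hi[of n] y by (auto simp: upper_grid_def grid_def min_le_iff_disj)
    have "(\<lambda>n. y + 1 / (real n + 1)) \<longlonglongrightarrow> y + 0"
      by (intro tendsto_add tendsto_const LIMSEQ_Suc[OF lim_1_over_n, simplified] )
         (use LIMSEQ_inverse_real_of_nat in \<open>simp add: inverse_eq_divide add.commute\<close>)
    then have lim: "(\<lambda>n. y + 1 / (real n + 1)) \<longlonglongrightarrow> y" by simp
    have "(\<lambda>n. upper_grid T n y) \<longlonglongrightarrow> y"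
      by (rule tendsto_sandwich[OF _ _ tendsto_const lim]) (use gt le in \<open>auto simp: less_imp_le\<close>)
    then have "filterlim (\<lambda>n. upper_grid T n y) (at_right y) sequentially"
      by (auto simp: filterlim_at gt less_imp_neq[OF gt, symmetric])
    moreover have "(f \<longlongrightarrow> f y) (at_right y)"
      using f[OF yT] by (simp add: continuous_within)
    ultimately show ?thesis by (rule filterlim_compose[rotated])
  qed
qed

lemma measurable_upper_grid:
  fixes Y :: "real \<Rightarrow> 'a \<Rightarrow> real"
  assumes "0 \<le> T" and [measurable]: "\<sigma> \<in> borel_measurable Q"
    and Y: "\<And>s. s \<in> {0..T} \<Longrightarrow> Y s \<in> borel_measurable Q"
  shows "(\<lambda>x. Y (upper_grid T n (\<sigma> x)) x) \<in> borel_measurable Q"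
proof -
  have "(\<lambda>x. (\<lambda>i x. Y (grid T n i) x) \<lfloor>(real n + 1) * \<sigma> x\<rfloor> x) \<in> borel_measurable Q"
    by (rule measurable_compose_countable) (auto intro!: Y grid_mem assms(1) simp del: atLeastAtMost_iff)
  then show ?thesis by (simp add: upper_grid_def)
qed

text \<open>\<open>Y\<close> is not assumed jointly measurable in time and space. Right-continuity
  stands in for this: the value at \<open>\<sigma>\<close> is the limit of the values at
  countably-valued times above \<open>\<sigma>\<close>, and at \<open>T\<close> the clipped grid is
  already exact.\<close>

lemma measurable_stopped:
  fixes Y :: "real \<Rightarrow> 'a \<Rightarrow> real"
  assumes "0 \<le> T" and [measurable]: "\<sigma> \<in> borel_measurable Q"
    and \<sigma>: "\<And>x. x \<in> space Q \<Longrightarrow> \<sigma> x \<in> {0..T}"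
    and Y: "\<And>s. s \<in> {0..T} \<Longrightarrow> Y s \<in> borel_measurable Q"
    and rc: "\<And>x s. x \<in> space Q \<Longrightarrow> s \<in> {0..<T} \<Longrightarrow> continuous (at_right s) (\<lambda>s. Y s x)"
  shows "(\<lambda>x. Y (\<sigma> x) x) \<in> borel_measurable Q"
proof (rule borel_measurable_LIMSEQ_real)
  show "(\<lambda>n. Y (upper_grid T n (\<sigma> x)) x) \<longlonglongrightarrow> Y (\<sigma> x) x" if "x \<in> space Q" for x
    by (rule tendsto_upper_grid[OF \<sigma>[OF that], where f = "\<lambda>s. Y s x"]) (use \<sigma>[OF that] rc[OF that] in auto)
qed (rule measurable_upper_grid[OF assms(1,2) Y])

section \<open>Essential suprema and upward directed families\<close>

lemma is_ess_sup_unique: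
  assumes "is_ess_sup M I X Y" "is_ess_sup M I X Z"
  shows "AE x in M. Y x = Z x"
proof -
  have "AE x in M. Y x \<le> Z x" "AE x in M. Z x \<le> Y x"
    using assms unfolding is_ess_sup_def by blast+
  then show ?thesis by eventually_elim auto
qed

text \<open>\<open>ess_sup\<close> chooses a version with \<open>SOME\<close>, so one explicit
  candidate both shows that a version exists and identifies the chosen one almost
  everywhere.\<close>

lemma ess_sup_AE_eq:
  assumes "is_ess_sup M I X Y"
  shows "AE x in M. ess_sup M I X x = Y x"
proof (rule is_ess_sup_unique[OF _ assms])
  show "is_ess_sup M I X (ess_sup M I X)"
    unfolding ess_sup_def by (rule someI[where P = "is_ess_sup M I X"]) (rule assms)
qed

lemma directed_ess_sup:
  fixes X :: "'i \<Rightarrow> 'a \<Rightarrow> real"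
  assumes "I \<noteq> {}" and int: "\<And>i. i \<in> I \<Longrightarrow> integrable M (X i)"
    and C: "\<And>i. i \<in> I \<Longrightarrow> integral\<^sup>L M (X i) \<le> C"
    and dir: "\<And>i j. i \<in> I \<Longrightarrow> j \<in> I \<Longrightarrow> \<exists>k\<in>I. AE x in M. X i x \<le> X k x \<and> X j x \<le> X k x"
  obtains j :: "nat \<Rightarrow> 'i" and Y where "\<And>n. j n \<in> I" "integrable M Y"
    "AE x in M. incseq (\<lambda>n. X (j n) x)" "AE x in M. (\<lambda>n. X (j n) x) \<longlonglongrightarrow> Y x"
    "is_ess_sup M I (\<lambda>i x. ereal (X i x)) (\<lambda>x. ereal (Y x))"
proof -
  \<comment> \<open>The limit of an increasing sequence whose integrals tend to the supremum \<open>c\<close> dominates every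
    member: otherwise the maximum of the two would push the integral above \<open>c\<close>.\<close>
  define c where "c = (SUP i\<in>I. integral\<^sup>L M (X i))"
  have bdd: "bdd_above ((\<lambda>i. integral\<^sup>L M (X i)) ` I)" using C by (intro bdd_aboveI[of _ C]) auto
  have lec: "integral\<^sup>L M (X i) \<le> c" if "i \<in> I" for i
    unfolding c_def by (rule cSUP_upper[OF that bdd])
  have "\<exists>i\<in>I. c - 1 / (real n + 1) < integral\<^sup>L M (X i)" for n :: nat
  proof -
    have "c - 1 / (real n + 1) < (SUP i\<in>I. integral\<^sup>L M (X i))" by (simp add: c_def)
    then show ?thesis using less_cSUP_iff[OF \<open>I \<noteq> {}\<close> bdd] by auto
  qed
  then obtain i where i: "\<And>n. i n \<in> I" "\<And>n :: nat. c - 1 / (real n + 1) < integral\<^sup>L M (X (i n))"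
    by metis
  obtain k where k: "\<And>a b. a \<in> I \<Longrightarrow> b \<in> I \<Longrightarrow> k a b \<in> I"
    "\<And>a b. a \<in> I \<Longrightarrow> b \<in> I \<Longrightarrow> AE x in M. X a x \<le> X (k a b) x \<and> X b x \<le> X (k a b) x"
    using dir by metis
  \<comment> \<open>A maximising sequence need not increase. Each new member is an upper bound,
    supplied by directedness, of the previous one and of the next near-maximiser, so the sequence
    increases almost everywhere and its integrals still tend to \<open>c\<close>.\<close>
  define j where "j = rec_nat (i 0) (\<lambda>n a. k a (i (Suc n)))"
  have j0: "j 0 = i 0" and jS: "j (Suc n) = k (j n) (i (Suc n))" for n by (simp_all add: j_def)
  have jI: "j n \<in> I" for n by (induction n) (auto simp: j0 jS i k)
  note [measurable] = borel_measurable_integrable[OF int[OF jI]]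
  have "AE x in M. X (j n) x \<le> X (j (Suc n)) x" for n
    using k(2)[OF jI i(1), of n "Suc n"] by (simp add: jS)
  then have "AE x in M. \<forall>n. X (j n) x \<le> X (j (Suc n)) x" by (simp add: AE_all_countable)
  then have inc: "AE x in M. incseq (\<lambda>n. X (j n) x)" by eventually_elim (auto simp: incseq_SucI)
  have "integral\<^sup>L M (X (i n)) \<le> integral\<^sup>L M (X (j n))" for n
  proof (cases n)
    case (Suc m)
    have "AE x in M. X (i n) x \<le> X (j n) x" using k(2)[OF jI i(1), of m "Suc m"] by (simp add: jS Suc)
    then show ?thesis by (intro integral_mono_AE int i jI)
  qed (simp add: j0)
  then have lo: "c - 1 / (real n + 1) \<le> integral\<^sup>L M (X (j n))" for n
    using i(2)[of n] by (meson less_imp_le order.trans)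
  have lim_c: "(\<lambda>n. integral\<^sup>L M (X (j n))) \<longlonglongrightarrow> c"
  proof (rule tendsto_sandwich)
    have "(\<lambda>n. c - 1 / (real n + 1)) \<longlonglongrightarrow> c - 0"
      using LIMSEQ_inverse_real_of_nat by (intro tendsto_diff tendsto_const) (simp add: inverse_eq_divide add.commute)
    then show "(\<lambda>n. c - 1 / (real n + 1)) \<longlonglongrightarrow> c" by simp
    show "(\<lambda>n. c) \<longlonglongrightarrow> c" by simp
  qed (use lo lec jI in auto)
  \<comment> \<open>Increments over the first member are nonnegative almost everywhere, so monotone
    convergence applies before a finite limit is known; the bound by \<open>c\<close> then makes
    \<open>U\<close> finite almost everywhere. Where it is infinite, \<open>enn2real\<close> returns
    0, which affects \<open>Y\<close> on a null set only.\<close>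
  define U where "U x = (SUP n. ennreal (X (j n) x - X (j 0) x))" for x
  have Um[measurable]: "U \<in> borel_measurable M" unfolding U_def by measurable
  have "(\<integral>\<^sup>+x. U x \<partial>M) = (SUP n. \<integral>\<^sup>+x. ennreal (X (j n) x - X (j 0) x) \<partial>M)"
    unfolding U_def
  proof (rule nn_integral_monotone_convergence_SUP_AE)
    show "AE x in M. ennreal (X (j n) x - X (j 0) x) \<le> ennreal (X (j (Suc n)) x - X (j 0) x)" for n
      using inc by eventually_elim (auto intro!: ennreal_leI simp: incseq_Suc_iff)
  qed measurable
  also have "\<dots> \<le> ennreal (c - integral\<^sup>L M (X (j 0)))"
  proof (rule SUP_least)
    fix n
    have "AE x in M. 0 \<le> X (j n) x - X (j 0) x"
      using inc by eventually_elim (auto simp: incseq_def)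
    then have "(\<integral>\<^sup>+x. ennreal (X (j n) x - X (j 0) x) \<partial>M) = ennreal (\<integral>x. X (j n) x - X (j 0) x \<partial>M)"
      by (intro nn_integral_eq_integral) (auto intro!: int jI)
    also have "\<dots> \<le> ennreal (c - integral\<^sup>L M (X (j 0)))"
      using lec[OF jI, of n] by (intro ennreal_leI) (simp add: int jI)
    finally show "(\<integral>\<^sup>+x. ennreal (X (j n) x - X (j 0) x) \<partial>M) \<le> ennreal (c - integral\<^sup>L M (X (j 0)))" .
  qed
  finally have "(\<integral>\<^sup>+x. U x \<partial>M) \<noteq> \<infinity>" by (auto simp: top_unique)
  then have fin: "AE x in M. U x \<noteq> \<infinity>" by (intro nn_integral_noteq_infinite) auto
  define Y where "Y x = X (j 0) x + enn2real (U x)" for x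
  have Ym[measurable]: "Y \<in> borel_measurable M" unfolding Y_def by measurable
  have lim: "AE x in M. (\<lambda>n. X (j n) x) \<longlonglongrightarrow> Y x"
    using inc fin
  proof eventually_elim
    case (elim x)
    have "(\<lambda>n. ennreal (X (j n) x - X (j 0) x)) \<longlonglongrightarrow> U x"
      unfolding U_def using elim(1) by (intro LIMSEQ_SUP) (auto simp: incseq_def intro!: ennreal_leI)
    then have "(\<lambda>n. ennreal (X (j n) x - X (j 0) x)) \<longlonglongrightarrow> ennreal (enn2real (U x))"
      using elim(2) by (simp add: less_top)
    then have "(\<lambda>n. X (j n) x - X (j 0) x) \<longlonglongrightarrow> enn2real (U x)"
      using elim(1) by (subst (asm) tendsto_ennreal_iff) (auto simp: incseq_def)
    from tendsto_add[OF this tendsto_const[of "X (j 0) x"]] show ?case by (simp add: Y_def add.commute)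
  qed
  have mono: "AE x in M. mono (\<lambda>n. X (j n) x)" using inc by simp
  have intY: "integrable M Y" and Yc: "integral\<^sup>L M Y = c"
    using integrable_monotone_convergence[OF int[OF jI] mono lim lim_c Ym]
      integral_monotone_convergence[OF int[OF jI] mono lim lim_c Ym] by auto
  have dom: "AE x in M. X a x \<le> Y x" if a: "a \<in> I" for a
  proof -
    note [measurable] = borel_measurable_integrable[OF int[OF a]]
    have intm: "integrable M (\<lambda>x. max (X a x) (X (j n) x))" for n by (intro integrable_max int a jI)
    have "integral\<^sup>L M (\<lambda>x. max (X a x) (X (j n) x)) \<le> c" for n
    proof -
      have "AE x in M. max (X a x) (X (j n) x) \<le> X (k a (j n)) x" using k(2)[OF a jI, of n] by auto
      then have "integral\<^sup>L M (\<lambda>x. max (X a x) (X (j n) x)) \<le> integral\<^sup>L M (X (k a (j n)))"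
        by (intro integral_mono_AE intm int k a jI)
      also have "\<dots> \<le> c" by (intro lec k a jI)
      finally show ?thesis .
    qed
    moreover have "(\<lambda>n. integral\<^sup>L M (\<lambda>x. max (X a x) (X (j n) x))) \<longlonglongrightarrow> integral\<^sup>L M (\<lambda>x. max (X a x) (Y x))"
    proof (rule integral_dominated_convergence[where w = "\<lambda>x. \<bar>X a x\<bar> + (\<bar>X (j 0) x\<bar> + \<bar>Y x\<bar>)"])
      show "integrable M (\<lambda>x. \<bar>X a x\<bar> + (\<bar>X (j 0) x\<bar> + \<bar>Y x\<bar>))" by (intro Bochner_Integration.integrable_add integrable_abs int a jI intY)
      show "AE x in M. (\<lambda>n. max (X a x) (X (j n) x)) \<longlonglongrightarrow> max (X a x) (Y x)"
        using lim by eventually_elim (auto intro!: tendsto_max)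
      show "AE x in M. norm (max (X a x) (X (j n) x)) \<le> \<bar>X a x\<bar> + (\<bar>X (j 0) x\<bar> + \<bar>Y x\<bar>)" for n
        using inc lim
      proof eventually_elim
        case (elim x)
        have "X (j 0) x \<le> X (j n) x" using elim(1) by (auto simp: incseq_def)
        moreover have "X (j n) x \<le> Y x" using incseq_le[OF elim] .
        ultimately show ?case by auto
      qed
    qed measurable
    ultimately have "integral\<^sup>L M (\<lambda>x. max (X a x) (Y x)) \<le> integral\<^sup>L M Y"
      unfolding Yc by (intro LIMSEQ_le_const2) auto
    moreover have "integrable M (\<lambda>x. max (X a x) (Y x))" by (intro integrable_max int a intY)
    ultimately have "(\<integral>x. max (X a x) (Y x) - Y x \<partial>M) \<le> 0" "integrable M (\<lambda>x. max (X a x) (Y x) - Y x)"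
      using intY by auto
    moreover from this(1) have "(\<integral>x. max (X a x) (Y x) - Y x \<partial>M) = 0"
      by (intro antisym integral_nonneg_AE) auto
    ultimately have "AE x in M. max (X a x) (Y x) - Y x = 0"
      by (subst integral_nonneg_eq_0_iff_AE[symmetric]) auto
    then show ?thesis by eventually_elim auto
  qed
  have "is_ess_sup M I (\<lambda>i x. ereal (X i x)) (\<lambda>x. ereal (Y x))"
    unfolding is_ess_sup_def
  proof (intro conjI ballI impI)
    fix Z assume Z: "Z \<in> borel_measurable M" "\<forall>i\<in>I. AE x in M. ereal (X i x) \<le> Z x"
    then have "AE x in M. \<forall>n. ereal (X (j n) x) \<le> Z x" using jI by (simp add: AE_all_countable)
    with lim show "AE x in M. ereal (Y x) \<le> Z x"
    proof eventually_elim
      case (elim x)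
      then show ?case by (intro LIMSEQ_le_const2[of "\<lambda>n. ereal (X (j n) x)" ]) auto
    qed
  qed (use dom in auto)
  with jI intY inc lim show ?thesis by (rule that)
qed

section \<open>Functions and sets changed on null sets\<close>

lemma (in complete_measure) measurable_AE_eq:
  assumes f: "f \<in> M \<rightarrow>\<^sub>M N" and ae: "AE x in M. f x = g x" and sp: "\<And>x. x \<in> space M \<Longrightarrow> g x \<in> space N"
  shows "g \<in> M \<rightarrow>\<^sub>M N"
proof (rule measurableI)
  fix A assume A: "A \<in> sets N"
  show "g -` A \<inter> space M \<in> sets M"
  proof (rule in_sets_AE)
    show "f -` A \<inter> space M \<in> sets M" using f A by (rule measurable_sets)
    show "AE x in M. (x \<in> f -` A \<inter> space M) = (x \<in> g -` A \<inter> space M)"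
      using ae by eventually_elim auto
  qed auto
qed (rule sp)

text \<open>The measurable sets that agree almost everywhere with a member of \<open>K\<close>
  include \<open>K\<close> and the null sets and are closed under complements and countable unions.
  Adjoining null sets thus changes events by null sets only, which later allows each event of the
  product filtration to be replaced by one from before the completion.\<close>

lemma sigma_sets_Un_null_sets_AE_eq:
  assumes K: "subalgebra N K" and A: "A \<in> sigma_sets (space N) (sets K \<union> null_sets N)"
  shows "A \<in> sets N \<and> (\<exists>B\<in>sets K. AE x in N. x \<in> A \<longleftrightarrow> x \<in> B)"
  using A
proof induction
  case (Basic a)
  then show ?case
  proof
    assume "a \<in> sets K" then show ?thesis using K by (auto simp: subalgebra_def)
  next
    assume "a \<in> null_sets N"
    then have "AE x in N. x \<in> a \<longleftrightarrow> x \<in> {}" using AE_not_in by fastforce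
    then show ?thesis using \<open>a \<in> null_sets N\<close> by blast
  qed
next
  case Empty
  then show ?case by blast
next
  case (Compl a)
  then obtain B where B: "B \<in> sets K" "AE x in N. x \<in> a \<longleftrightarrow> x \<in> B" by auto
  have "AE x in N. x \<in> space N - a \<longleftrightarrow> x \<in> space K - B" using B(2) K by (auto simp: subalgebra_def)
  then show ?case using Compl B by blast
next
  case (Union a)
  then obtain B where B: "\<And>i. B i \<in> sets K" "\<And>i::nat. AE x in N. x \<in> a i \<longleftrightarrow> x \<in> B i" by metis
  have "AE x in N. \<forall>i. x \<in> a i \<longleftrightarrow> x \<in> B i" using B(2) by (simp add: AE_all_countable)
  then have "AE x in N. x \<in> (\<Union>i. a i) \<longleftrightarrow> x \<in> (\<Union>i. B i)" by eventually_elim auto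
  moreover have "(\<Union>i. B i) \<in> sets K" using B by auto
  ultimately show ?case using Union by blast
qed

section \<open>Optional sampling\<close>

locale filtered_space =
  fixes M :: "'a measure" and T :: real and F :: "real \<Rightarrow> 'a measure"
  assumes T_pos: "T > 0"
    and filtered: "filtered_prob_space M T F"
    and right_cont: "right_continuous_filtration T F"
begin

sublocale prob_space M
  using filtered by (simp add: filtered_prob_space_def)

lemma T_nonneg: "0 \<le> T"
  using T_pos by simp

lemma subalg_F: "t \<in> {0..T} \<Longrightarrow> subalgebra M (F t)"
  using filtered by (simp add: filtered_prob_space_def)

lemma space_F: "t \<in> {0..T} \<Longrightarrow> space (F t) = space M"
  using subalg_F by (auto simp: subalgebra_def)

lemma sets_F_subset: "t \<in> {0..T} \<Longrightarrow> A \<in> sets (F t) \<Longrightarrow> A \<in> sets M"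
  using subalg_F by (auto simp: subalgebra_def)

lemma measurable_F: "t \<in> {0..T} \<Longrightarrow> f \<in> F t \<rightarrow>\<^sub>M N \<Longrightarrow> f \<in> M \<rightarrow>\<^sub>M N"
  using measurable_from_subalg[OF subalg_F] .

lemma index_ext_eq: "t \<in> {0..T} \<Longrightarrow> index_ext T H t = H t"
  by (auto simp: index_ext_def)

lemma index_ext_ge: "T \<le> t \<Longrightarrow> index_ext T H t = H T"
  using T_pos by (simp add: index_ext_def)

lemma index_mem: "max 0 (min T t) \<in> {0..T}"
  using T_pos by auto

lemma space_index_ext: "space (index_ext T F t) = space M"
  using space_F[OF index_mem] by (simp add: index_ext_def)

lemma sets_F_mono: "0 \<le> s \<Longrightarrow> s \<le> t \<Longrightarrow> t \<le> T \<Longrightarrow> sets (F s) \<subseteq> sets (F t)"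
  using filtered filtration.sets_F_mono[of "space M" "index_ext T F" s t]
  by (simp add: filtered_prob_space_def index_ext_eq)

lemma measurable_F_mono: "0 \<le> s \<Longrightarrow> s \<le> t \<Longrightarrow> t \<le> T \<Longrightarrow> f \<in> F s \<rightarrow>\<^sub>M N \<Longrightarrow> f \<in> F t \<rightarrow>\<^sub>M N"
  using sets_F_mono[of s t] space_F[of s] space_F[of t] by (auto simp: measurable_def)

text \<open>At \<open>t = T\<close> no later time is left, so the second premise is vacuous and the
  third carries the claim.\<close>

lemma sets_F_Inter:
  assumes "t \<in> {0..T}" "\<And>s. s \<in> {t<..T} \<Longrightarrow> A \<in> sets (F s)" "t = T \<Longrightarrow> A \<in> sets (F T)"
  shows "A \<in> sets (F t)"
  using assms right_cont by (cases "t = T") (auto simp: right_continuous_filtration_def)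

lemma sigma_finite_F: "t \<in> {0..T} \<Longrightarrow> sigma_finite_subalgebra M (F t)"
  by (intro finite_measure_subalgebra_is_sigma_finite)
     (simp add: finite_measure_subalgebra_def finite_measure_subalgebra_axioms_def subalg_F finite_measure_axioms)

text \<open>Optional sampling at a deterministic time, with a weight: \<open>Z\<close> is known at
  \<open>s\<close> and so may be moved inside the conditional expectation, and its boundedness makes
  both products integrable.\<close>

lemma martingale_integral_eq:
  assumes X: "martingale M T F X" and s: "s \<in> {0..T}"
    and Z: "Z \<in> borel_measurable (F s)" and bd: "\<And>x. x \<in> space M \<Longrightarrow> \<bar>Z x\<bar> \<le> K"
  shows "integrable M (\<lambda>x. Z x * X s x)" "integrable M (\<lambda>x. Z x * X T x)"
    "(\<integral>x. Z x * X s x \<partial>M) = (\<integral>x. Z x * X T x \<partial>M)"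
proof -
  interpret s: sigma_finite_subalgebra M "F s" by (rule sigma_finite_F[OF s])
  have int: "integrable M (X r)" if "r \<in> {0..T}" for r using X that by (auto simp: martingale_def)
  have Zm[measurable]: "Z \<in> borel_measurable M" by (rule measurable_F[OF s Z])
  have int': "integrable M (\<lambda>x. Z x * X r x)" if "r \<in> {0..T}" for r
  proof (rule Bochner_Integration.integrable_bound[OF integrable_mult_right[OF int[OF that], of K]])
    show "(\<lambda>x. Z x * X r x) \<in> borel_measurable M"
      using borel_measurable_integrable[OF int[OF that]] by measurable
    show "AE x in M. norm (Z x * X r x) \<le> norm (K * X r x)"
      using AE_space by eventually_elim (use bd in \<open>force simp: abs_mult intro!: mult_right_mono\<close>)
  qed
  have T: "T \<in> {0..T}" using T_pos by auto
  show "integrable M (\<lambda>x. Z x * X s x)" "integrable M (\<lambda>x. Z x * X T x)" using int' s T by auto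
  have ae: "AE x in M. real_cond_exp M (F s) (X T) x = X s x" using X s T by (auto simp: martingale_def)
  have "(\<integral>x. Z x * X s x \<partial>M) = (\<integral>x. Z x * real_cond_exp M (F s) (X T) x \<partial>M)"
    using ae borel_measurable_integrable[OF int[OF s]] by (intro integral_cong_AE) (auto intro: measurable_F[OF s])
  also have "\<dots> = (\<integral>x. Z x * X T x \<partial>M)"
    by (intro s.real_cond_exp_intg(2) int' T Z borel_measurable_integrable int)
  finally show "(\<integral>x. Z x * X s x \<partial>M) = (\<integral>x. Z x * X T x \<partial>M)" .
qed

text \<open>The event says that \<open>\<sigma>\<close> lies between the two ends of a cell, and
  \<open>{\<sigma> < b}\<close> is decided by the right end \<open>b\<close>, which is the grid time
  unless clipping intervenes. Clipping is harmless: a grid time below \<open>t\<close> makes the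
  event empty because \<open>\<sigma>\<close> is at least \<open>t\<close>, and one clipped to
  \<open>T\<close> may use all of \<open>F T\<close>.\<close>

lemma stopping_grid_event:
  assumes t: "t \<in> {0..T}" and \<sigma>: "\<And>x. x \<in> space M \<Longrightarrow> \<sigma> x \<in> {t..T}"
    and st: "\<And>s. s \<in> {0..T} \<Longrightarrow> {x\<in>space M. \<sigma> x < s} \<in> sets (F s)"
    and A: "A \<in> sets (F t)"
  shows "{x\<in>A. \<lfloor>(real n + 1) * \<sigma> x\<rfloor> = i} \<in> sets (F (grid T n i))"
proof -
  define s where "s = grid T n i"
  have s: "s \<in> {0..T}" unfolding s_def by (rule grid_mem) (use T_pos in simp)
  have eq: "\<lfloor>(real n + 1) * y\<rfloor> = i \<longleftrightarrow> of_int i / (real n + 1) \<le> y \<and> y < (of_int i + 1) / (real n + 1)" for y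
    by (auto simp: floor_eq_iff divide_simps mult.commute add.commute)
  have A_sp: "A \<subseteq> space M" using A t sets_F_subset sets.sets_into_space by blast
  show ?thesis
  proof (cases "t \<le> s")
    case False
    then have "{x\<in>A. \<lfloor>(real n + 1) * \<sigma> x\<rfloor> = i} = {}"
      using \<sigma> A_sp t unfolding eq s_def grid_def by fastforce
    then show ?thesis by (simp only: sets.empty_sets)
  next
    case True
    have "sets (F t) \<subseteq> sets (F s)" using t s True by (intro sets_F_mono) auto
    then have As: "A \<in> sets (F s)" using A by blast
    have lt: "{x\<in>space M. \<sigma> x < r} \<in> sets (F s)" if "r \<le> s \<or> T \<le> s" for r
    proof -
      consider "r \<le> 0" | "0 \<le> r" "r \<le> s" | "T \<le> s" "T < r" using \<open>r \<le> s \<or> T \<le> s\<close> s by fastforce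
      then show ?thesis
      proof cases
        case 1
        then have "{x\<in>space M. \<sigma> x < r} = {}" using \<sigma> t by fastforce
        then show ?thesis by (simp only: sets.empty_sets)
      next
        case 2
        then have "sets (F r) \<subseteq> sets (F s)" using s by (intro sets_F_mono) auto
        then show ?thesis using st[of r] 2 s by auto
      next
        case 3
        then have "{x\<in>space M. \<sigma> x < r} = space (F s)" using \<sigma> space_F[OF s] by fastforce
        then show ?thesis by simp
      qed
    qed
    define a where "a = of_int i / (real n + 1)"
    define b where "b = (of_int i + 1) / (real n + 1)"
    have ab: "a \<le> b" by (simp add: a_def b_def divide_right_mono)
    have "a \<le> s \<or> T \<le> s" "b \<le> s \<or> T \<le> s" using ab unfolding s_def grid_def b_def[symmetric] by auto
    from lt[OF this(1)] lt[OF this(2)]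
    have "A \<inter> ({x\<in>space M. \<sigma> x < b} - {x\<in>space M. \<sigma> x < a}) \<in> sets (F s)" using As by auto
    also have "A \<inter> ({x\<in>space M. \<sigma> x < b} - {x\<in>space M. \<sigma> x < a}) = {x\<in>A. \<lfloor>(real n + 1) * \<sigma> x\<rfloor> = i}"
      unfolding eq a_def[symmetric] b_def[symmetric] using A_sp by auto
    finally show ?thesis by (simp add: s_def)
  qed
qed

lemma measurable_stopping:
  assumes t: "t \<in> {0..T}" and \<sigma>: "\<And>x. x \<in> space M \<Longrightarrow> \<sigma> x \<in> {t..T}"
    and st: "\<And>s. s \<in> {0..T} \<Longrightarrow> {x\<in>space M. \<sigma> x < s} \<in> sets (F s)"
  shows "\<sigma> \<in> borel_measurable (F T)"
proof (rule borel_measurableI_less)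
  fix r
  consider "r \<le> 0" | "0 \<le> r" "r \<le> T" | "T < r" by linarith
  then show "{x \<in> space (F T). \<sigma> x < r} \<in> sets (F T)"
  proof cases
    case 1
    then have "{x\<in>space (F T). \<sigma> x < r} = {}" using \<sigma> t space_F[of T] by fastforce
    then show ?thesis by (simp only: sets.empty_sets)
  next
    case 2
    then have "sets (F r) \<subseteq> sets (F T)" by (intro sets_F_mono) auto
    then show ?thesis using st[of r] 2 space_F[of T] by auto
  next
    case 3
    then have "{x\<in>space M. \<sigma> x < r} = space M" using \<sigma> by fastforce
    then show ?thesis using space_F[of T] T_pos sets.top[of "F T"] by simp
  qed
qed

text \<open>A grid time takes finitely many values, so the claim is a finite sum of identities at
  deterministic times. In each summand the event that the value is taken, times \<open>Y\<close> at
  that value, is a bounded weight known at that time.\<close>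

lemma optional_sampling_grid:
  assumes X: "martingale M T F X" and t: "t \<in> {0..T}"
    and \<sigma>: "\<And>x. x \<in> space M \<Longrightarrow> \<sigma> x \<in> {t..T}"
    and st: "\<And>s. s \<in> {0..T} \<Longrightarrow> {x\<in>space M. \<sigma> x < s} \<in> sets (F s)"
    and A: "A \<in> sets (F t)" and Y: "adapted T F Y"
    and bd: "\<And>s x. s \<in> {0..T} \<Longrightarrow> x \<in> space M \<Longrightarrow> \<bar>Y s x\<bar> \<le> K"
  defines "\<rho> \<equiv> \<lambda>n x. upper_grid T n (\<sigma> x)"
  shows "integrable M (\<lambda>x. indicator A x * Y (\<rho> n x) x * X (\<rho> n x) x)"
    "(\<integral>x. indicator A x * Y (\<rho> n x) x * X (\<rho> n x) x \<partial>M) = (\<integral>x. indicator A x * Y (\<rho> n x) x * X T x \<partial>M)"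
proof -
  define I where "I = {0..\<lfloor>(real n + 1) * T\<rfloor>}"
  define E where "E i = {x\<in>A. \<lfloor>(real n + 1) * \<sigma> x\<rfloor> = i}" for i
  have A_sp: "A \<subseteq> space M" using A t sets_F_subset sets.sets_into_space by blast
  \<comment> \<open>\<open>W\<close> is left arbitrary because the decomposition is used twice, once
    with \<open>X\<close> at the grid time and once with the terminal value \<open>X T\<close>,
    which does not depend on the time.\<close>
  have split: "indicator A x * Y (\<rho> n x) x * W (\<rho> n x) = (\<Sum>i\<in>I. (indicator (E i) x * Y (grid T n i) x) * W (grid T n i))"
    if "x \<in> space M" for W x
  proof (cases "x \<in> A")
    case True
    define j where "j = \<lfloor>(real n + 1) * \<sigma> x\<rfloor>"
    have "0 \<le> \<sigma> x" "\<sigma> x \<le> T" using \<sigma>[OF that] t by auto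
    then have "j \<in> I" unfolding I_def j_def by (auto intro!: floor_mono mult_left_mono)
    have "(\<Sum>i\<in>I. (indicator (E i) x * Y (grid T n i) x) * W (grid T n i)) =
        (\<Sum>i\<in>I. if i = j then Y (grid T n j) x * W (grid T n j) else 0)"
      using True by (intro sum.cong) (auto simp: E_def j_def indicator_def)
    also have "\<dots> = Y (grid T n j) x * W (grid T n j)" using \<open>j \<in> I\<close> by (simp add: I_def)
    finally show ?thesis using True by (simp add: \<rho>_def upper_grid_def j_def)
  qed (auto simp: E_def)
  have g: "grid T n i \<in> {0..T}" for i by (rule grid_mem) (use T_pos in simp)
  have E: "E i \<in> sets (F (grid T n i))" for i
    unfolding E_def by (rule stopping_grid_event[OF t \<sigma> st A])
  have Zm: "(\<lambda>x. indicator (E i) x * Y (grid T n i) x) \<in> borel_measurable (F (grid T n i))" for i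
    using E Y g[of i] by (intro borel_measurable_times borel_measurable_indicator) (auto simp: adapted_def)
  have Zb: "\<bar>indicator (E i) x * Y (grid T n i) x\<bar> \<le> K" if "x \<in> space M" for i x
    using bd[OF g[of i] that] by (auto simp: indicator_def)
  note m = martingale_integral_eq[OF X g Zm Zb]
  have "integrable M (\<lambda>x. \<Sum>i\<in>I. (indicator (E i) x * Y (grid T n i) x) * X (grid T n i) x)"
    by (intro Bochner_Integration.integrable_sum m(1))
  then show "integrable M (\<lambda>x. indicator A x * Y (\<rho> n x) x * X (\<rho> n x) x)"
    by (subst Bochner_Integration.integrable_cong[OF refl split[of _ "\<lambda>s. X s _"]])
  have "(\<integral>x. indicator A x * Y (\<rho> n x) x * X (\<rho> n x) x \<partial>M) =
     (\<integral>x. (\<Sum>i\<in>I. (indicator (E i) x * Y (grid T n i) x) * X (grid T n i) x) \<partial>M)"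
    by (intro Bochner_Integration.integral_cong refl split[of _ "\<lambda>s. X s _"])
  also have "\<dots> = (\<Sum>i\<in>I. \<integral>x. (indicator (E i) x * Y (grid T n i) x) * X (grid T n i) x \<partial>M)"
    by (intro Bochner_Integration.integral_sum m(1))
  also have "\<dots> = (\<Sum>i\<in>I. \<integral>x. (indicator (E i) x * Y (grid T n i) x) * X T x \<partial>M)"
    by (intro sum.cong refl m(3))
  also have "\<dots> = (\<integral>x. (\<Sum>i\<in>I. (indicator (E i) x * Y (grid T n i) x) * X T x) \<partial>M)"
    by (intro Bochner_Integration.integral_sum[symmetric] m(2))
  also have "\<dots> = (\<integral>x. indicator A x * Y (\<rho> n x) x * X T x \<partial>M)"
    by (intro Bochner_Integration.integral_cong refl split[of _ "\<lambda>s. X T _", symmetric])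
  finally show "(\<integral>x. indicator A x * Y (\<rho> n x) x * X (\<rho> n x) x \<partial>M) = (\<integral>x. indicator A x * Y (\<rho> n x) x * X T x \<partial>M)" .
qed


text \<open>Right-continuity gives pointwise convergence from grid times to \<open>\<sigma>\<close>,
  but \<open>X\<close> is unbounded, so the integrals need more. Below a level \<open>C\<close>
  bounded convergence applies; the excess above \<open>C\<close> is controlled uniformly in
  \<open>n\<close> by \<open>e C\<close>, the mean excess of \<open>X T\<close>, and
  \<open>e C\<close> vanishes as \<open>C\<close> grows.\<close>

lemma optional_sampling_bounded:
  assumes X: "martingale M T F X" and X_nn: "\<And>s x. s \<in> {0..T} \<Longrightarrow> x \<in> space M \<Longrightarrow> 0 \<le> X s x"
    and X_rc: "\<And>s x. x \<in> space M \<Longrightarrow> s \<in> {0..<T} \<Longrightarrow> continuous (at_right s) (\<lambda>s. X s x)"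
    and t: "t \<in> {0..T}"
    and \<sigma>: "\<And>x. x \<in> space M \<Longrightarrow> \<sigma> x \<in> {t..T}"
    and st: "\<And>s. s \<in> {0..T} \<Longrightarrow> {x\<in>space M. \<sigma> x < s} \<in> sets (F s)"
    and A: "A \<in> sets (F t)" and Y: "adapted T F Y"
    and bd: "\<And>s x. s \<in> {0..T} \<Longrightarrow> x \<in> space M \<Longrightarrow> 0 \<le> Y s x \<and> Y s x \<le> K"
    and Y_rc: "\<And>s x. x \<in> space M \<Longrightarrow> s \<in> {0..<T} \<Longrightarrow> continuous (at_right s) (\<lambda>s. Y s x)"
  shows "integrable M (\<lambda>x. X (\<sigma> x) x)"
    "(\<integral>x. indicator A x * Y (\<sigma> x) x * X (\<sigma> x) x \<partial>M) = (\<integral>x. indicator A x * Y (\<sigma> x) x * X T x \<partial>M)"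
proof -
  have T_mem: "T \<in> {0..T}" using T_pos by auto
  define \<rho> where "\<rho> n x = upper_grid T n (\<sigma> x)" for n x
  have \<rho>_mem: "\<rho> n x \<in> {0..T}" for n x unfolding \<rho>_def by (rule upper_grid_mem[OF T_nonneg])
  have \<sigma>_mem: "\<sigma> x \<in> {0..T}" if "x \<in> space M" for x using \<sigma>[OF that] t by auto
  have grid:
    "integrable M (\<lambda>x. indicator B x * Z (\<rho> n x) x * X (\<rho> n x) x)"
    "(\<integral>x. indicator B x * Z (\<rho> n x) x * X (\<rho> n x) x \<partial>M) = (\<integral>x. indicator B x * Z (\<rho> n x) x * X T x \<partial>M)"
    if "B \<in> sets (F t)" "adapted T F Z" "\<And>s x. s \<in> {0..T} \<Longrightarrow> x \<in> space M \<Longrightarrow> \<bar>Z s x\<bar> \<le> k" for B Z k n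
    using optional_sampling_grid[OF X t \<sigma> st that] unfolding \<rho>_def by blast+
  have Xm: "X s \<in> borel_measurable M" if "s \<in> {0..T}" for s
    using X that by (auto simp: martingale_def)
  have Ym: "Y s \<in> borel_measurable M" if "s \<in> {0..T}" for s
    using Y that by (intro measurable_F[OF that]) (auto simp: adapted_def)
  have \<sigma>m[measurable]: "\<sigma> \<in> borel_measurable M"
    by (rule measurable_F[OF T_mem measurable_stopping[OF t \<sigma> st]])
  have Am[measurable]: "A \<in> sets M" by (rule sets_F_subset[OF t A])
  have sp: "space M \<in> sets (F t)" using sets.top[of "F t"] space_F[OF t] by simp
  obtain x0 where "x0 \<in> space M" using not_empty by blast
  with bd[OF T_mem] have K: "0 \<le> K" by fastforce
  have intT: "integrable M (X T)" using X T_mem by (auto simp: martingale_def)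
  have [measurable]: "(\<lambda>x. X (\<rho> n x) x) \<in> borel_measurable M" "(\<lambda>x. Y (\<rho> n x) x) \<in> borel_measurable M" for n
    unfolding \<rho>_def by (intro measurable_upper_grid[where Y = X] measurable_upper_grid[where Y = Y] T_nonneg Xm Ym \<sigma>m; assumption)+
  have [measurable]: "(\<lambda>x. X (\<sigma> x) x) \<in> borel_measurable M" "(\<lambda>x. Y (\<sigma> x) x) \<in> borel_measurable M"
    using measurable_stopped[OF T_nonneg \<sigma>m \<sigma>_mem, of X] measurable_stopped[OF T_nonneg \<sigma>m \<sigma>_mem, of Y]
      Xm Ym X_rc Y_rc by blast+
  have [measurable]: "X T \<in> borel_measurable M" using intT by auto
  have X_lim: "(\<lambda>n. X (\<rho> n x) x) \<longlonglongrightarrow> X (\<sigma> x) x" if "x \<in> space M" for x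
    unfolding \<rho>_def using \<sigma>_mem[OF that] X_rc[OF that]
    by (intro tendsto_upper_grid[where f = "\<lambda>s. X s x"]) auto
  have Y_lim: "(\<lambda>n. Y (\<rho> n x) x) \<longlonglongrightarrow> Y (\<sigma> x) x" if "x \<in> space M" for x
    unfolding \<rho>_def using \<sigma>_mem[OF that] Y_rc[OF that]
    by (intro tendsto_upper_grid[where f = "\<lambda>s. Y s x"]) auto
  have one: "adapted T F (\<lambda>_ _. 1)" by (auto simp: adapted_def)
  \<comment> \<open>With weight 1 on the whole space, all sampled variables have the mean of
    \<open>X T\<close>; Fatou's lemma relies on this below.\<close>
  have int\<rho>: "integrable M (\<lambda>x. X (\<rho> n x) x)" and eq\<rho>: "(\<integral>x. X (\<rho> n x) x \<partial>M) = (\<integral>x. X T x \<partial>M)" for n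
    using grid[OF sp one, of 1 n]
    by (auto cong: Bochner_Integration.integrable_cong Bochner_Integration.integral_cong)
  define e where "e C = (\<integral>x. max (X T x - C) 0 \<partial>M)" for C
  have inte: "integrable M (\<lambda>x. max (X T x - C) 0)" for C
    by (intro integrable_max Bochner_Integration.integrable_diff intT) auto
  \<comment> \<open>The sampled variables are uniformly integrable: on the event \<open>X (\<rho> n x) x > C\<close>, which is known
    at time \<open>\<rho> n\<close>, the martingale may be replaced by its terminal value.\<close>
  have tail: "(\<integral>x. max (X (\<rho> n x) x - C) 0 \<partial>M) \<le> e C" for n C
  proof -
    define J where "J s x = (if X s x > C then 1 else 0 :: real)" for s x
    have J: "adapted T F J"
      unfolding adapted_def J_def using X by (auto simp: martingale_def adapted_def)
    have J1: "\<bar>J s x\<bar> \<le> 1" for s x by (simp add: J_def)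
    have [measurable]: "(\<lambda>x. J (\<rho> n x) x) \<in> borel_measurable M" unfolding J_def by measurable
    have g1: "integrable M (\<lambda>x. J (\<rho> n x) x * X (\<rho> n x) x)"
      and g2: "(\<integral>x. J (\<rho> n x) x * X (\<rho> n x) x \<partial>M) = (\<integral>x. J (\<rho> n x) x * X T x \<partial>M)"
      using grid[OF sp J J1, of n]
      by (auto cong: Bochner_Integration.integrable_cong Bochner_Integration.integral_cong)
    have J_int: "integrable M (\<lambda>x. C * J (\<rho> n x) x)"
      by (intro integrable_mult_right integrable_const_bound[where B = 1]) (auto simp: J1)
    have JT: "integrable M (\<lambda>x. J (\<rho> n x) x * X T x)"
      by (rule Bochner_Integration.integrable_bound[OF intT]) (auto simp: J_def)
    have "(\<integral>x. max (X (\<rho> n x) x - C) 0 \<partial>M) = (\<integral>x. J (\<rho> n x) x * X (\<rho> n x) x - C * J (\<rho> n x) x \<partial>M)"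
      by (intro Bochner_Integration.integral_cong) (auto simp: J_def)
    also have "\<dots> = (\<integral>x. J (\<rho> n x) x * X T x - C * J (\<rho> n x) x \<partial>M)"
      using g1 g2 J_int JT by simp
    also have "\<dots> \<le> e C"
      unfolding e_def by (intro integral_mono Bochner_Integration.integrable_diff JT J_int inte) (auto simp: J_def)
    finally show ?thesis .
  qed
  define W where "W n x = indicator A x * Y (\<rho> n x) x" for n x
  define V where "V x = indicator A x * Y (\<sigma> x) x" for x
  have [measurable]: "W n \<in> borel_measurable M" "V \<in> borel_measurable M" for n
    unfolding W_def V_def by measurable
  have Wb: "0 \<le> W n x" "W n x \<le> K" if "x \<in> space M" for n x
    using bd[OF \<rho>_mem that] K by (auto simp: W_def indicator_def)
  have Vb: "0 \<le> V x" "V x \<le> K" if "x \<in> space M" for x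
    using bd[OF \<sigma>_mem[OF that] that] K by (auto simp: V_def indicator_def)
  have W_lim: "(\<lambda>n. W n x) \<longlonglongrightarrow> V x" if "x \<in> space M" for x
    unfolding W_def V_def by (intro tendsto_mult tendsto_const Y_lim that)
  have YK: "\<bar>Y s x\<bar> \<le> K" if "s \<in> {0..T}" "x \<in> space M" for s x using bd[OF that] by auto
  have gW: "integrable M (\<lambda>x. W n x * X (\<rho> n x) x)"
    "(\<integral>x. W n x * X (\<rho> n x) x \<partial>M) = (\<integral>x. W n x * X T x \<partial>M)" for n
    using grid[OF A Y YK] unfolding W_def by blast+
  have limT: "(\<lambda>n. \<integral>x. W n x * X T x \<partial>M) \<longlonglongrightarrow> (\<integral>x. V x * X T x \<partial>M)"
  proof (rule integral_dominated_convergence[where w = "\<lambda>x. K * X T x"])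
    show "AE x in M. (\<lambda>n. W n x * X T x) \<longlonglongrightarrow> V x * X T x"
      by (intro AE_I2 tendsto_mult W_lim tendsto_const)
    show "AE x in M. norm (W n x * X T x) \<le> K * X T x" for n
      using Wb X_nn[OF T_mem] by (intro AE_I2) (auto simp: abs_mult intro!: mult_right_mono)
  qed (auto intro: intT)
  have limC: "(\<lambda>n. \<integral>x. W n x * min (X (\<rho> n x) x) C \<partial>M) \<longlonglongrightarrow> (\<integral>x. V x * min (X (\<sigma> x) x) C \<partial>M)"
    if C: "0 \<le> C" for C
  proof (rule integral_dominated_convergence[where w = "\<lambda>x. K * C"])
    show "AE x in M. (\<lambda>n. W n x * min (X (\<rho> n x) x) C) \<longlonglongrightarrow> V x * min (X (\<sigma> x) x) C"
      by (intro AE_I2 tendsto_mult tendsto_min W_lim X_lim tendsto_const)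
    show "AE x in M. norm (W n x * min (X (\<rho> n x) x) C) \<le> K * C" for n
      using Wb X_nn[OF \<rho>_mem] C K by (intro AE_I2) (auto simp: abs_mult intro!: mult_mono)
  qed auto
  \<comment> \<open>The sampled variable splits into its minimum with \<open>C\<close> and its
    excess over \<open>C\<close>. Since \<open>W n\<close> lies between 0 and \<open>K\<close>, the
    excess contributes between 0 and \<open>K * e C\<close>.\<close>
  have both: "(\<integral>x. W n x * min (X (\<rho> n x) x) C \<partial>M) \<le> (\<integral>x. W n x * X T x \<partial>M)"
    "(\<integral>x. W n x * X T x \<partial>M) \<le> (\<integral>x. W n x * min (X (\<rho> n x) x) C \<partial>M) + K * e C" if C: "0 \<le> C" for n C
  proof -
    have i1: "integrable M (\<lambda>x. W n x * min (X (\<rho> n x) x) C)"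
      by (rule Bochner_Integration.integrable_bound[OF gW(1)[of n]])
         (use Wb X_nn[OF \<rho>_mem] C in \<open>auto simp: abs_mult intro!: AE_I2 mult_left_mono\<close>)
    have i2: "integrable M (\<lambda>x. max (X (\<rho> n x) x - C) 0)"
      by (intro integrable_max Bochner_Integration.integrable_diff int\<rho>) auto
    have i3: "integrable M (\<lambda>x. W n x * max (X (\<rho> n x) x - C) 0)"
      by (rule Bochner_Integration.integrable_bound[OF integrable_mult_right[OF i2, of K]])
         (use Wb K in \<open>auto simp: abs_mult intro!: AE_I2 mult_right_mono\<close>)
    have "(\<integral>x. W n x * X T x \<partial>M) = (\<integral>x. W n x * X (\<rho> n x) x \<partial>M)" using gW(2)[of n] by simp
    also have "\<dots> = (\<integral>x. W n x * min (X (\<rho> n x) x) C + W n x * max (X (\<rho> n x) x - C) 0 \<partial>M)"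
      by (intro Bochner_Integration.integral_cong) (auto simp: min_def max_def algebra_simps)
    also have "\<dots> = (\<integral>x. W n x * min (X (\<rho> n x) x) C \<partial>M) + (\<integral>x. W n x * max (X (\<rho> n x) x - C) 0 \<partial>M)"
      by (rule Bochner_Integration.integral_add[OF i1 i3])
    finally have eq: "(\<integral>x. W n x * X T x \<partial>M) = (\<integral>x. W n x * min (X (\<rho> n x) x) C \<partial>M) + (\<integral>x. W n x * max (X (\<rho> n x) x - C) 0 \<partial>M)" .
    have "0 \<le> (\<integral>x. W n x * max (X (\<rho> n x) x - C) 0 \<partial>M)"
      using Wb by (intro integral_nonneg_AE AE_I2) auto
    then show "(\<integral>x. W n x * min (X (\<rho> n x) x) C \<partial>M) \<le> (\<integral>x. W n x * X T x \<partial>M)" using eq by simp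
    have "(\<integral>x. W n x * max (X (\<rho> n x) x - C) 0 \<partial>M) \<le> (\<integral>x. K * max (X (\<rho> n x) x - C) 0 \<partial>M)"
      using Wb by (intro integral_mono i3 integrable_mult_right i2 mult_right_mono) auto
    also have "\<dots> \<le> K * e C" using tail[of n C] K by (simp add: mult_left_mono)
    finally show "(\<integral>x. W n x * X T x \<partial>M) \<le> (\<integral>x. W n x * min (X (\<rho> n x) x) C \<partial>M) + K * e C" using eq by simp
  qed
  have lower: "(\<integral>x. V x * min (X (\<sigma> x) x) C \<partial>M) \<le> (\<integral>x. V x * X T x \<partial>M)" if "0 \<le> C" for C
    using both(1)[OF that] by (intro LIMSEQ_le[OF limC[OF that] limT]) auto
  have upper: "(\<integral>x. V x * X T x \<partial>M) \<le> (\<integral>x. V x * min (X (\<sigma> x) x) C \<partial>M) + K * e C" if "0 \<le> C" for C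
    using both(2)[OF that] by (intro LIMSEQ_le[OF limT tendsto_add[OF limC[OF that] tendsto_const]]) auto
  \<comment> \<open>Fatou gives only an inequality, but that is enough for integrability at
    \<open>\<sigma>\<close>, which is needed as a dominating function when the level
    \<open>C\<close> is sent to infinity.\<close>
  have "(\<integral>\<^sup>+x. ennreal (X (\<sigma> x) x) \<partial>M) = (\<integral>\<^sup>+x. liminf (\<lambda>n. ennreal (X (\<rho> n x) x)) \<partial>M)"
  proof (intro nn_integral_cong)
    fix x assume "x \<in> space M"
    then have "(\<lambda>n. ennreal (X (\<rho> n x) x)) \<longlonglongrightarrow> ennreal (X (\<sigma> x) x)" by (intro tendsto_ennrealI X_lim)
    then show "ennreal (X (\<sigma> x) x) = liminf (\<lambda>n. ennreal (X (\<rho> n x) x))"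
      by (simp add: lim_imp_Liminf)
  qed
  also have "\<dots> \<le> liminf (\<lambda>n. \<integral>\<^sup>+x. ennreal (X (\<rho> n x) x) \<partial>M)"
    by (rule nn_integral_liminf) measurable
  also have "(\<lambda>n. \<integral>\<^sup>+x. ennreal (X (\<rho> n x) x) \<partial>M) = (\<lambda>n. ennreal (\<integral>x. X T x \<partial>M))"
  proof
    fix n show "(\<integral>\<^sup>+x. ennreal (X (\<rho> n x) x) \<partial>M) = ennreal (\<integral>x. X T x \<partial>M)"
      using X_nn[OF \<rho>_mem] by (subst nn_integral_eq_integral[OF int\<rho>]) (auto simp: eq\<rho>)
  qed
  also have "liminf \<dots> < \<infinity>" by (simp add: Liminf_const)
  finally show int\<sigma>: "integrable M (\<lambda>x. X (\<sigma> x) x)"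
    using X_nn[OF \<sigma>_mem] by (intro integrableI_nonneg) auto
  have e0: "(\<lambda>m. e (real m)) \<longlonglongrightarrow> (\<integral>x. 0 \<partial>M)"
    unfolding e_def
  proof (rule integral_dominated_convergence[where w = "X T"])
    show "AE x in M. (\<lambda>m. max (X T x - real m) 0) \<longlonglongrightarrow> 0"
    proof (intro AE_I2 tendsto_eventually)
      fix x
      show "\<forall>\<^sub>F m in sequentially. max (X T x - real m) 0 = 0"
        using eventually_ge_at_top[of "nat \<lceil>X T x\<rceil>"] by eventually_elim (simp add: nat_le_iff ceiling_le_iff)
    qed
  qed (use X_nn[OF T_mem] intT in \<open>auto intro!: AE_I2\<close>)
  have limV: "(\<lambda>m. \<integral>x. V x * min (X (\<sigma> x) x) (real m) \<partial>M) \<longlonglongrightarrow> (\<integral>x. V x * X (\<sigma> x) x \<partial>M)"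
  proof (rule integral_dominated_convergence[where w = "\<lambda>x. K * X (\<sigma> x) x"])
    show "AE x in M. (\<lambda>m. V x * min (X (\<sigma> x) x) (real m)) \<longlonglongrightarrow> V x * X (\<sigma> x) x"
    proof (intro AE_I2 tendsto_eventually)
      fix x
      show "\<forall>\<^sub>F m in sequentially. V x * min (X (\<sigma> x) x) (real m) = V x * X (\<sigma> x) x"
        using eventually_ge_at_top[of "nat \<lceil>X (\<sigma> x) x\<rceil>"] by eventually_elim (simp add: nat_le_iff ceiling_le_iff min_def)
    qed
    show "AE x in M. norm (V x * min (X (\<sigma> x) x) (real m)) \<le> K * X (\<sigma> x) x" for m
      using Vb X_nn[OF \<sigma>_mem] K by (intro AE_I2) (auto simp: abs_mult intro!: mult_mono)
  qed (auto intro: int\<sigma>)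
  have "(\<integral>x. V x * X (\<sigma> x) x \<partial>M) \<le> (\<integral>x. V x * X T x \<partial>M)"
    using lower by (intro LIMSEQ_le_const2[OF limV]) auto
  moreover have "(\<lambda>m. (\<integral>x. V x * min (X (\<sigma> x) x) (real m) \<partial>M) + K * e (real m)) \<longlonglongrightarrow> (\<integral>x. V x * X (\<sigma> x) x \<partial>M) + K * 0"
    using e0 by (intro tendsto_intros limV) simp
  then have "(\<integral>x. V x * X T x \<partial>M) \<le> (\<integral>x. V x * X (\<sigma> x) x \<partial>M)"
    using upper by (intro LIMSEQ_le_const[of _ "_"]) auto
  ultimately show "(\<integral>x. indicator A x * Y (\<sigma> x) x * X (\<sigma> x) x \<partial>M) = (\<integral>x. indicator A x * Y (\<sigma> x) x * X T x \<partial>M)"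
    by (simp add: V_def)
qed

end

text \<open>\<open>Y\<close> is truncated at \<open>m\<close>, where the bounded case applies, and
  both sides increase to their limits. Neither limit has to be finite, so no integrability of the
  stopped product is presupposed.\<close>

lemma (in filtered_space) optional_sampling_nn:
  assumes X: "martingale M T F X" and X_nn: "\<And>s x. s \<in> {0..T} \<Longrightarrow> x \<in> space M \<Longrightarrow> 0 \<le> X s x"
    and X_rc: "\<And>s x. x \<in> space M \<Longrightarrow> s \<in> {0..<T} \<Longrightarrow> continuous (at_right s) (\<lambda>s. X s x)"
    and t: "t \<in> {0..T}"
    and \<sigma>: "\<And>x. x \<in> space M \<Longrightarrow> \<sigma> x \<in> {t..T}"
    and st: "\<And>s. s \<in> {0..T} \<Longrightarrow> {x\<in>space M. \<sigma> x < s} \<in> sets (F s)"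
    and A: "A \<in> sets (F t)" and Y: "adapted T F Y"
    and Y_nn: "\<And>s x. s \<in> {0..T} \<Longrightarrow> x \<in> space M \<Longrightarrow> 0 \<le> Y s x"
    and Y_rc: "\<And>s x. x \<in> space M \<Longrightarrow> s \<in> {0..<T} \<Longrightarrow> continuous (at_right s) (\<lambda>s. Y s x)"
  shows "(\<integral>\<^sup>+x. ennreal (indicator A x * Y (\<sigma> x) x * X (\<sigma> x) x) \<partial>M) =
    (\<integral>\<^sup>+x. ennreal (indicator A x * Y (\<sigma> x) x * X T x) \<partial>M)"
proof -
  have T_mem: "T \<in> {0..T}" using T_pos by auto
  define Z where "Z m s x = min (Y s x) (real m)" for m s x
  have \<sigma>_mem: "\<sigma> x \<in> {0..T}" if "x \<in> space M" for x using \<sigma>[OF that] t by auto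
  have \<sigma>m: "\<sigma> \<in> borel_measurable M"
    by (rule measurable_F[OF T_mem measurable_stopping[OF t \<sigma> st]])
  have [measurable]: "A \<in> sets M" by (rule sets_F_subset[OF t A])
  have Z: "adapted T F (Z m)" for m
    using Y by (auto simp: adapted_def Z_def[abs_def])
  have Z_bd: "0 \<le> Z m s x \<and> Z m s x \<le> real m" if "s \<in> {0..T}" "x \<in> space M" for m s x
    using Y_nn[OF that] by (auto simp: Z_def)
  have Z_rc: "continuous (at_right s) (\<lambda>s. Z m s x)" if "x \<in> space M" "s \<in> {0..<T}" for m s x
    using Y_rc[OF that] unfolding Z_def continuous_within by (intro tendsto_min tendsto_const)
  note os = optional_sampling_bounded[OF X X_nn X_rc t \<sigma> st A Z Z_bd Z_rc]
  have Zm: "Z m s \<in> borel_measurable M" if "s \<in> {0..T}" for m s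
    using Z that by (intro measurable_F[OF that]) (auto simp: adapted_def)
  have Z\<sigma>[measurable]: "(\<lambda>x. Z m (\<sigma> x) x) \<in> borel_measurable M" for m
    using measurable_stopped[OF T_nonneg \<sigma>m \<sigma>_mem, of "Z m"] Zm Z_rc by blast
  have int\<sigma>: "integrable M (\<lambda>x. X (\<sigma> x) x)"
    by (rule os(1)) auto
  have intT: "integrable M (X T)" using X T_mem by (auto simp: martingale_def)
  have int: "integrable M (\<lambda>x. indicator A x * Z m (\<sigma> x) x * g x)" if g: "integrable M g" for m g
  proof (rule Bochner_Integration.integrable_bound[OF integrable_mult_right[OF g, of "real m"]])
    show "AE x in M. norm (indicator A x * Z m (\<sigma> x) x * g x) \<le> norm (real m * g x)"
      using Z_bd[OF \<sigma>_mem] by (auto intro!: AE_I2 mult_right_mono simp: abs_mult indicator_def)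
  qed (use g in measurable)
  have eq: "(\<integral>\<^sup>+x. ennreal (indicator A x * Z m (\<sigma> x) x * X (\<sigma> x) x) \<partial>M) =
    (\<integral>\<^sup>+x. ennreal (indicator A x * Z m (\<sigma> x) x * X T x) \<partial>M)" for m
  proof -
    have "(\<integral>\<^sup>+x. ennreal (indicator A x * Z m (\<sigma> x) x * X (\<sigma> x) x) \<partial>M) = ennreal (\<integral>x. indicator A x * Z m (\<sigma> x) x * X (\<sigma> x) x \<partial>M)"
      using Z_bd[OF \<sigma>_mem] X_nn[OF \<sigma>_mem] by (intro nn_integral_eq_integral int int\<sigma> AE_I2) auto
    also have "(\<integral>x. indicator A x * Z m (\<sigma> x) x * X (\<sigma> x) x \<partial>M) = (\<integral>x. indicator A x * Z m (\<sigma> x) x * X T x \<partial>M)"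
      by (rule os(2)) auto
    also have "ennreal \<dots> = (\<integral>\<^sup>+x. ennreal (indicator A x * Z m (\<sigma> x) x * X T x) \<partial>M)"
      using Z_bd[OF \<sigma>_mem] X_nn[OF T_mem] by (intro nn_integral_eq_integral[symmetric] int intT AE_I2) auto
    finally show ?thesis .
  qed
  have lim: "(\<lambda>m. \<integral>\<^sup>+x. ennreal (indicator A x * Z m (\<sigma> x) x * g x) \<partial>M) \<longlonglongrightarrow>
      (\<integral>\<^sup>+x. ennreal (indicator A x * Y (\<sigma> x) x * g x) \<partial>M)"
    if g: "integrable M g" and g_nn: "\<And>x. x \<in> space M \<Longrightarrow> 0 \<le> g x" for g
  proof -
    \<comment> \<open>\<open>nn_integral_LIMSEQ\<close> asks for monotonicity at every point, also
      outside \<open>space M\<close>, where \<open>g\<close> may be negative; \<open>max 0\<close>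
      repairs this without changing the integral.\<close>
    have "(\<lambda>m. \<integral>\<^sup>+x. ennreal (indicator A x * Z m (\<sigma> x) x * max 0 (g x)) \<partial>M) \<longlonglongrightarrow>
      (\<integral>\<^sup>+x. ennreal (indicator A x * Y (\<sigma> x) x * max 0 (g x)) \<partial>M)"
    proof (rule nn_integral_LIMSEQ)
      show "incseq (\<lambda>m x. ennreal (indicator A x * Z m (\<sigma> x) x * max 0 (g x)))"
        unfolding incseq_def le_fun_def Z_def by (auto intro!: ennreal_leI mult_right_mono mult_left_mono)
      show "(\<lambda>m. ennreal (indicator A x * Z m (\<sigma> x) x * max 0 (g x))) \<longlonglongrightarrow> ennreal (indicator A x * Y (\<sigma> x) x * max 0 (g x))" for x
      proof (rule tendsto_eventually)
        show "\<forall>\<^sub>F m in sequentially. ennreal (indicator A x * Z m (\<sigma> x) x * max 0 (g x)) = ennreal (indicator A x * Y (\<sigma> x) x * max 0 (g x))"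
          using eventually_ge_at_top[of "nat \<lceil>Y (\<sigma> x) x\<rceil>"]
          by eventually_elim (simp add: Z_def nat_le_iff ceiling_le_iff min_def)
      qed
    qed (use g in measurable)
    moreover have "(\<integral>\<^sup>+x. ennreal (h x * max 0 (g x)) \<partial>M) = (\<integral>\<^sup>+x. ennreal (h x * g x) \<partial>M)" for h
      using g_nn by (intro nn_integral_cong) (simp add: max_def)
    ultimately show ?thesis by simp
  qed
  show ?thesis
  proof (rule LIMSEQ_unique)
    show "(\<lambda>m. \<integral>\<^sup>+x. ennreal (indicator A x * Z m (\<sigma> x) x * X (\<sigma> x) x) \<partial>M) \<longlonglongrightarrow>
      (\<integral>\<^sup>+x. ennreal (indicator A x * Y (\<sigma> x) x * X (\<sigma> x) x) \<partial>M)"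
      by (rule lim[OF int\<sigma>]) (use X_nn \<sigma>_mem in auto)
    show "(\<lambda>m. \<integral>\<^sup>+x. ennreal (indicator A x * Z m (\<sigma> x) x * X (\<sigma> x) x) \<partial>M) \<longlonglongrightarrow>
      (\<integral>\<^sup>+x. ennreal (indicator A x * Y (\<sigma> x) x * X T x) \<partial>M)"
      unfolding eq by (rule lim[OF intT]) (use X_nn T_mem in auto)
  qed
qed

section \<open>Stopping times of the enlarged and the product filtration\<close>

lemma (in filtered_space) sets_pair_mono:
  assumes "0 \<le> s" "s \<le> t" "t \<le> T"
  shows "sets (F s \<Otimes>\<^sub>M (borel :: real measure)) \<subseteq> sets (F t \<Otimes>\<^sub>M borel)"
proof -
  have "space (F s) = space (F t)" using space_F[of s] space_F[of t] assms by auto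
  then show ?thesis
    unfolding sets_pair_measure using sets_F_mono[OF assms] by (simp, intro sigma_sets_mono') blast
qed

lemma (in filtered_space) sets_pair_subset:
  assumes "t \<in> {0..T}"
  shows "sets (F t \<Otimes>\<^sub>M (borel :: real measure)) \<subseteq> sets (M \<Otimes>\<^sub>M borel)"
  unfolding sets_pair_measure space_F[OF assms]
  using sets_F_subset[OF assms] by (intro sigma_sets_mono') blast

locale enlargement = filtered_space M T F
  for M :: "'a measure" and T :: real and F :: "real \<Rightarrow> 'a measure" +
  fixes G :: "'a \<Rightarrow> real"
  assumes G_meas[measurable]: "G \<in> borel_measurable M"
begin

lemma prob_space_law: "prob_space (law M G)"
  unfolding law_def by (rule prob_space_distr) measurable

lemma sets_law[simp, measurable_cong]: "sets (law M G) = sets borel"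
  by (simp add: law_def)

lemma space_law[simp]: "space (law M G) = UNIV"
  by (simp add: law_def)

abbreviation prod_measure :: "('a \<times> real) measure" where
  "prod_measure \<equiv> M \<Otimes>\<^sub>M law M G"

abbreviation right_limit_sets :: "real \<Rightarrow> ('a \<times> real) set set" where
  "right_limit_sets t \<equiv> (\<Inter>s\<in>{t<..}. sets (index_ext T F s \<Otimes>\<^sub>M (borel :: real measure)))"

text \<open>The product filtration before null sets are adjoined. Its events belong to some
  \<open>F s \<Otimes>\<^sub>M borel\<close>, so their sections remain measurable, which fails after
  completion.\<close>

definition raw_filtration :: "real \<Rightarrow> ('a \<times> real) measure" where
  "raw_filtration t = sigma (space M \<times> UNIV) (right_limit_sets t)"

lemma space_prod: "space prod_measure = space M \<times> UNIV"
  by (simp add: space_pair_measure)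

lemma space_product_space: "space (product_space M G) = space M \<times> UNIV"
  by (simp add: product_space_def space_pair_measure)

lemma space_pair_index_ext: "space (index_ext T F s \<Otimes>\<^sub>M (borel :: real measure)) = space M \<times> UNIV"
  by (simp add: space_pair_measure space_index_ext)

lemma right_limit_sets_Pow: "right_limit_sets t \<subseteq> Pow (space M \<times> UNIV)"
proof
  fix A assume "A \<in> right_limit_sets t"
  then have "A \<in> sets (index_ext T F (t + 1) \<Otimes>\<^sub>M (borel :: real measure))" by auto
  from sets.sets_into_space[OF this] show "A \<in> Pow (space M \<times> UNIV)"
    by (simp add: space_pair_index_ext)
qed

lemma space_raw_filtration: "space (raw_filtration t) = space M \<times> UNIV"
  using right_limit_sets_Pow by (simp add: raw_filtration_def)

lemma sets_raw_filtration: "sets (raw_filtration t) = right_limit_sets t"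
proof -
  have "sigma_sets (space M \<times> UNIV) (right_limit_sets t) \<subseteq> sets (index_ext T F s \<Otimes>\<^sub>M (borel :: real measure))" if "t < s" for s
    using that sets.sigma_sets_subset[of "right_limit_sets t" "index_ext T F s \<Otimes>\<^sub>M (borel :: real measure)"]
    unfolding space_pair_index_ext by blast
  then have "sigma_sets (space M \<times> UNIV) (right_limit_sets t) \<subseteq> right_limit_sets t" by blast
  then show ?thesis using right_limit_sets_Pow unfolding raw_filtration_def by (auto intro: sigma_sets.Basic)
qed

text \<open>The case \<open>t = s = T\<close> rests on the constant extension of \<open>F\<close>
  beyond \<open>T\<close>: the right limit at \<open>T\<close> is
  \<open>F T \<Otimes>\<^sub>M borel\<close> itself.\<close>

lemma sets_raw_filtration_subset: "t \<in> {0..T} \<Longrightarrow> t < s \<or> s = T \<Longrightarrow> s \<le> T \<Longrightarrow> sets (raw_filtration t) \<subseteq> sets (F s \<Otimes>\<^sub>M borel)"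
proof (cases "t < s")
  case True
  assume "t \<in> {0..T}" "s \<le> T"
  then show ?thesis using True index_ext_eq[of s F] by (auto simp: sets_raw_filtration)
next
  case False
  assume "t < s \<or> s = T"
  assume "s \<le> T" "t \<in> {0..T}"
  then have "t = T" "s = T" using False \<open>t < s \<or> s = T\<close> by auto
  moreover have "sets (raw_filtration T) \<subseteq> sets (index_ext T F (T + 1) \<Otimes>\<^sub>M borel)"
    unfolding sets_raw_filtration by (rule INT_lower) simp
  ultimately show ?thesis using index_ext_ge[of "T + 1" F] by simp
qed

lemma subalgebra_raw_filtration_prod: "t \<in> {0..T} \<Longrightarrow> subalgebra prod_measure (raw_filtration t)"
  using sets_raw_filtration_subset[of t T] sets_pair_subset[of T] T_pos
  unfolding subalgebra_def space_raw_filtration space_prod by (auto cong: sets_pair_measure_cong)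

lemma sets_prod_eq: "sets prod_measure = sets (M \<Otimes>\<^sub>M borel)"
  by (intro sets_pair_measure_cong) auto

lemma subalgebra_raw_filtration: "t \<in> {0..T} \<Longrightarrow> subalgebra (product_space M G) (raw_filtration t)"
  using subalgebra_raw_filtration_prod[of t] by (auto simp: subalgebra_def product_space_def)

lemma sets_product_filtration:
  "sets (product_filtration M T F G t) = sigma_sets (space M \<times> UNIV) (sets (raw_filtration t) \<union> null_sets (product_space M G))"
  and space_product_filtration: "space (product_filtration M T F G t) = space M \<times> UNIV"
proof -
  have "right_limit_sets t \<union> null_sets (product_space M G) \<subseteq> Pow (space M \<times> UNIV)"
    using right_limit_sets_Pow sets.sets_into_space[of _ "product_space M G"] unfolding space_product_space by blast
  then show "sets (product_filtration M T F G t) = sigma_sets (space M \<times> UNIV) (sets (raw_filtration t) \<union> null_sets (product_space M G))"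
    "space (product_filtration M T F G t) = space M \<times> UNIV"
    by (simp_all add: product_filtration_def space_product_space sets_raw_filtration)
qed

lemma product_filtration_AE_eq:
  assumes "t \<in> {0..T}" "A \<in> sets (product_filtration M T F G t)"
  shows "A \<in> sets (product_space M G)" "\<exists>B\<in>sets (raw_filtration t). AE x in product_space M G. x \<in> A \<longleftrightarrow> x \<in> B"
  using sigma_sets_Un_null_sets_AE_eq[OF subalgebra_raw_filtration[OF assms(1)], of A] assms(2)
  by (simp_all add: sets_product_filtration space_product_space)

lemma subalgebra_product_filtration:
  "t \<in> {0..T} \<Longrightarrow> subalgebra (product_space M G) (product_filtration M T F G t)"
  using product_filtration_AE_eq(1) by (auto simp: subalgebra_def space_product_filtration space_product_space)

lemma sets_raw_filtration_product_filtration: "sets (raw_filtration t) \<subseteq> sets (product_filtration M T F G t)"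
  by (auto simp: sets_product_filtration)

lemma sets_raw_filtration_mono: "s \<le> t \<Longrightarrow> sets (raw_filtration s) \<subseteq> sets (raw_filtration t)"
  by (auto simp: sets_raw_filtration)

lemma sets_product_filtration_mono:
  "s \<le> t \<Longrightarrow> sets (product_filtration M T F G s) \<subseteq> sets (product_filtration M T F G t)"
  unfolding sets_product_filtration using sets_raw_filtration_mono by (intro sigma_sets_mono') auto

text \<open>
  A random time on the product space that is optional for the \<open>F s \<Otimes>\<^sub>M borel\<close> without adjoined
  null sets. The distinction matters: \<open>G\<close> need not be \<open>F T\<close>-measurable, so a null set of the
  product, for instance the graph of \<open>G\<close>, can have a preimage of full measure under
  \<open>\<omega> \<mapsto> (\<omega>, G \<omega>)\<close>. Only strict times may therefore be composed with this map.
\<close>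

definition strict_stopping :: "real \<Rightarrow> ('a \<times> real \<Rightarrow> real) \<Rightarrow> bool" where
  "strict_stopping t \<sigma> \<longleftrightarrow> (\<forall>x\<in>space M \<times> UNIV. \<sigma> x \<in> {t..T}) \<and>
     (\<forall>s\<in>{0..T}. {x\<in>space M \<times> UNIV. \<sigma> x < s} \<in> sets (F s \<Otimes>\<^sub>M borel))"

lemma strict_stopping_mem: "strict_stopping t \<sigma> \<Longrightarrow> x \<in> space M \<times> UNIV \<Longrightarrow> \<sigma> x \<in> {t..T}"
  unfolding strict_stopping_def by blast

lemma strict_stopping_section:
  assumes "strict_stopping t \<sigma>" "s \<in> {0..T}"
  shows "{\<omega>\<in>space M. \<sigma> (\<omega>, u) < s} \<in> sets (F s)"
proof -
  have "{x\<in>space M \<times> UNIV. \<sigma> x < s} \<in> sets (F s \<Otimes>\<^sub>M borel)"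
    using assms by (auto simp: strict_stopping_def)
  from sets_Pair2[OF this, of u] show ?thesis
    by (rule back_subst[of "\<lambda>A. A \<in> sets (F s)"]) auto
qed

text \<open>Turning \<open><\<close> into \<open>\<le>\<close> means looking at times just after
  \<open>s\<close>. The sequence \<open>d\<close> decreases to \<open>s\<close> but stays within
  \<open>r\<close>, so every later time knows the event, that is, the right limit at
  \<open>s\<close> does.\<close>

lemma strict_stopping_le:
  assumes \<sigma>: "strict_stopping t \<sigma>" and s: "0 \<le> s" "s < r" "r \<le> T"
  shows "{x\<in>space M \<times> UNIV. \<sigma> x \<le> s} \<in> sets (F r \<Otimes>\<^sub>M borel)"
proof -
  define d where "d n = s + (r - s) / (real n + 1)" for n
  have d: "s < d n" "d n \<le> r" for n
    using s mult_right_mono[of s r "real n"] by (auto simp: d_def field_simps)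
  have lim: "d \<longlonglongrightarrow> s + 0"
    unfolding d_def
    using tendsto_mult[OF tendsto_const[of "r - s"] LIMSEQ_inverse_real_of_nat]
    by (intro tendsto_add tendsto_const) (simp add: inverse_eq_divide add.commute)
  have "{x\<in>space M \<times> UNIV. \<sigma> x < d n} \<in> sets (F r \<Otimes>\<^sub>M borel)" for n
    using \<sigma> sets_pair_mono[of "d n" r] d[of n] s by (auto simp: strict_stopping_def)
  then have "(\<Inter>n. {x\<in>space M \<times> UNIV. \<sigma> x < d n}) \<in> sets (F r \<Otimes>\<^sub>M borel)" by auto
  also have "(\<Inter>n. {x\<in>space M \<times> UNIV. \<sigma> x < d n}) = {x\<in>space M \<times> UNIV. \<sigma> x \<le> s}"
  proof -
    have "y \<le> s" if "\<And>n. y < d n" for y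
      using LIMSEQ_le_const[OF lim, of y] that by (auto intro: less_imp_le)
    then show ?thesis using d(1) by (auto intro: le_less_trans)
  qed
  finally show ?thesis .
qed

lemma strict_stopping_measurable:
  assumes \<sigma>: "strict_stopping t \<sigma>" and t: "t \<in> {0..T}"
  shows "\<sigma> \<in> borel_measurable (F T \<Otimes>\<^sub>M borel)"
proof (rule borel_measurableI_less)
  have sp: "space (F T \<Otimes>\<^sub>M (borel :: real measure)) = space M \<times> UNIV"
    using space_F[of T] T_pos by (simp add: space_pair_measure)
  have \<sigma>_mem: "\<sigma> x \<in> {t..T}" if "x \<in> space M \<times> UNIV" for x using \<sigma> that by (auto simp: strict_stopping_def)
  fix r
  consider "r \<le> 0" | "0 \<le> r" "r \<le> T" | "T < r" by linarith
  then show "{x \<in> space (F T \<Otimes>\<^sub>M borel). \<sigma> x < r} \<in> sets (F T \<Otimes>\<^sub>M borel)"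
  proof cases
    case 1
    have "\<not> \<sigma> x < r" if "x \<in> space M \<times> UNIV" for x
      using \<sigma>_mem[OF that] t 1 by auto
    then have "{x\<in>space (F T \<Otimes>\<^sub>M borel). \<sigma> x < r} = {}" unfolding sp by blast
    then show ?thesis by (simp only: sets.empty_sets)
  next
    case 2
    then show ?thesis using \<sigma> sets_pair_mono[of r T] unfolding sp by (auto simp: strict_stopping_def)
  next
    case 3
    have "\<sigma> x < r" if "x \<in> space M \<times> UNIV" for x
      using \<sigma>_mem[OF that] t 3 by auto
    then have "{x\<in>space (F T \<Otimes>\<^sub>M borel). \<sigma> x < r} = space (F T \<Otimes>\<^sub>M borel)" unfolding sp by blast
    then show ?thesis by (simp only: sets.top)
  qed
qed

text \<open>The infimum is below \<open>s\<close> exactly when some \<open>C q\<close> with rational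
  \<open>q < s\<close> occurs, a countable union; each \<open>C q\<close> is known immediately after
  \<open>q\<close>, hence by time \<open>s\<close>. The sets need not increase with
  \<open>q\<close>, which matters because they are going to be chosen separately for each
  \<open>q\<close>. Inserting \<open>T\<close> keeps the infimum defined and equal to
  \<open>T\<close> when nothing occurs.\<close>

lemma strict_stopping_Inf:
  assumes t: "t \<in> {0..T}" and C: "\<And>q. q \<in> \<rat> \<Longrightarrow> t \<le> q \<Longrightarrow> q < T \<Longrightarrow> C q \<in> sets (raw_filtration q)"
  shows "strict_stopping t (\<lambda>x. Inf (insert T {q\<in>\<rat>. t \<le> q \<and> q < T \<and> x \<in> C q}))"
  unfolding strict_stopping_def
proof (intro conjI ballI)
  fix x :: "'a \<times> real"
  let ?S = "insert T {q\<in>\<rat>. t \<le> q \<and> q < T \<and> x \<in> C q}"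
  have "bdd_below ?S" using t by (intro bdd_belowI[of _ t]) auto
  then show "Inf ?S \<in> {t..T}" using t by (auto intro!: cInf_lower cInf_greatest)
next
  fix s assume s: "s \<in> {0..T}"
  let ?S = "\<lambda>x. insert T {q\<in>\<rat>. t \<le> q \<and> q < T \<and> x \<in> C q}"
  have "Inf (?S x) < s \<longleftrightarrow> (\<exists>q\<in>\<rat> \<inter> {t..<T} \<inter> {..<s}. x \<in> C q)" for x
  proof -
    have "bdd_below (?S x)" using t by (intro bdd_belowI[of _ t]) auto
    then show ?thesis using s by (subst cInf_less_iff) auto
  qed
  then have "{x\<in>space M \<times> UNIV. Inf (?S x) < s} = (\<Union>q\<in>\<rat> \<inter> {t..<T} \<inter> {..<s}. C q \<inter> space M \<times> UNIV)"
    by auto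
  also have "(\<Union>q\<in>\<rat> \<inter> {t..<T} \<inter> {..<s}. C q \<inter> space M \<times> UNIV) = (\<Union>q\<in>\<rat> \<inter> {t..<T} \<inter> {..<s}. C q)"
    using C sets.sets_into_space[of _ "raw_filtration _"] unfolding space_raw_filtration by fastforce
  also have "\<dots> \<in> sets (F s \<Otimes>\<^sub>M borel)"
  proof (rule sets.countable_UN'')
    fix q assume q: "q \<in> \<rat> \<inter> {t..<T} \<inter> {..<s}"
    then have "C q \<in> sets (raw_filtration q)" using C by auto
    then show "C q \<in> sets (F s \<Otimes>\<^sub>M borel)" using sets_raw_filtration_subset[of q s] q t s by auto
  qed (simp add: countable_rat)
  finally show "{x\<in>space M \<times> UNIV. Inf (?S x) < s} \<in> sets (F s \<Otimes>\<^sub>M borel)" .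
qed

section \<open>Transfer of stopping times between the two filtrations\<close>

lemma space_enlarged: "space (enlarged_filtration M F G t) = space M"
  by (simp add: enlarged_filtration_def space_measure_of_conv)

lemma sets_enlarged:
  assumes "t \<in> {0..T}"
  shows "sets (enlarged_filtration M F G t) = sigma_sets (space M) (sets (F t) \<union> sets (vimage_algebra (space M) G borel))"
proof -
  have "sets (F t) \<union> sets (vimage_algebra (space M) G borel) \<subseteq> Pow (space M)"
    using sets.sets_into_space[of _ "F t"] sets.sets_into_space[of _ "vimage_algebra (space M) G borel"] space_F[OF assms]
    by auto
  then show ?thesis by (simp add: enlarged_filtration_def)
qed

lemma measurable_graph_enlarged:
  assumes t: "t \<in> {0..T}"
  shows "(\<lambda>\<omega>. (\<omega>, G \<omega>)) \<in> enlarged_filtration M F G t \<rightarrow>\<^sub>M F t \<Otimes>\<^sub>M borel"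
proof (rule measurable_Pair)
  show "(\<lambda>\<omega>. \<omega>) \<in> enlarged_filtration M F G t \<rightarrow>\<^sub>M F t"
  proof (rule measurableI)
    fix A assume A: "A \<in> sets (F t)"
    then have "(\<lambda>\<omega>. \<omega>) -` A \<inter> space M = A" using sets.sets_into_space[OF A] space_F[OF t] by auto
    then show "(\<lambda>\<omega>. \<omega>) -` A \<inter> space (enlarged_filtration M F G t) \<in> sets (enlarged_filtration M F G t)"
      using A by (auto simp: space_enlarged sets_enlarged[OF t])
  qed (simp add: space_enlarged space_F[OF t])
  show "G \<in> enlarged_filtration M F G t \<rightarrow>\<^sub>M borel"
    by (rule measurableI) (auto simp: space_enlarged sets_enlarged[OF t] intro!: sigma_sets.Basic in_vimage_algebra)
qed

text \<open>Preimages under the graph map form a sigma-algebra, and it contains both generators: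
  cylinders \<open>B \<times> UNIV\<close> give back the events of \<open>F t\<close>, and
  \<open>space (F t) \<times> C\<close> gives those of \<open>G\<close>.\<close>

lemma enlarged_eq_graph_vimage:
  assumes t: "t \<in> {0..T}" and A: "A \<in> sets (enlarged_filtration M F G t)"
  shows "\<exists>B\<in>sets (F t \<Otimes>\<^sub>M borel). A = {\<omega>\<in>space M. (\<omega>, G \<omega>) \<in> B}"
proof -
  let ?V = "vimage_algebra (space M) (\<lambda>\<omega>. (\<omega>, G \<omega>)) (F t \<Otimes>\<^sub>M borel)"
  have g: "(\<lambda>\<omega>. (\<omega>, G \<omega>)) \<in> space M \<rightarrow> space (F t \<Otimes>\<^sub>M borel)"
    using space_F[OF t] by (auto simp: space_pair_measure)
  have V: "sets ?V = {(\<lambda>\<omega>. (\<omega>, G \<omega>)) -` B \<inter> space M |B. B \<in> sets (F t \<Otimes>\<^sub>M borel)}"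
    by (rule sets_vimage_algebra2[OF g])
  have "sets (F t) \<subseteq> sets ?V"
  proof
    fix B assume B: "B \<in> sets (F t)"
    then have "B = (\<lambda>\<omega>. (\<omega>, G \<omega>)) -` (B \<times> UNIV) \<inter> space M"
      using sets.sets_into_space[OF B] space_F[OF t] by auto
    moreover have "B \<times> UNIV \<in> sets (F t \<Otimes>\<^sub>M (borel :: real measure))" using B by auto
    ultimately show "B \<in> sets ?V" unfolding V by blast
  qed
  moreover have "sets (vimage_algebra (space M) G borel) \<subseteq> sets ?V"
  proof
    fix B assume "B \<in> sets (vimage_algebra (space M) G borel)"
    then obtain C where C: "C \<in> sets borel" "B = G -` C \<inter> space M"
      by (auto simp: sets_vimage_algebra2)
    then have "B = (\<lambda>\<omega>. (\<omega>, G \<omega>)) -` (space (F t) \<times> C) \<inter> space M"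
      using space_F[OF t] by auto
    moreover have "space (F t) \<times> C \<in> sets (F t \<Otimes>\<^sub>M borel)" using C by auto
    ultimately show "B \<in> sets ?V" unfolding V by blast
  qed
  ultimately have "sigma_sets (space M) (sets (F t) \<union> sets (vimage_algebra (space M) G borel)) \<subseteq> sets ?V"
    using sets.sigma_sets_subset[of _ ?V] by (simp add: space_vimage_algebra)
  then show ?thesis using A unfolding sets_enlarged[OF t] V by blast
qed

text \<open>Each event \<open>{\<tau> \<le> q}\<close> lifts to some \<open>B q\<close>, but lifts
  for different \<open>q\<close> may be inconsistent off the graph. The infimum over rationals is a
  strict time regardless, and on the graph the events are exact, so \<open>\<tau>\<close> is
  recovered at every point and not just almost surely.\<close>

lemma enlarged_stopping_lift:
  assumes t: "t \<in> {0..T}" and \<tau>: "\<tau> \<in> stopping_times T (enlarged_filtration M F G) t"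
  obtains \<sigma> where "strict_stopping t \<sigma>" "\<And>\<omega>. \<omega> \<in> space M \<Longrightarrow> \<sigma> (\<omega>, G \<omega>) = \<tau> \<omega>"
proof -
  have "\<exists>B\<in>sets (F q \<Otimes>\<^sub>M borel). {\<omega>\<in>space M. \<tau> \<omega> \<le> q} = {\<omega>\<in>space M. (\<omega>, G \<omega>) \<in> B}" if "q \<in> {0..T}" for q
    using \<tau> stopping_timeD[of "index_ext T (enlarged_filtration M F G)" \<tau> q] index_ext_eq[OF that, of "enlarged_filtration M F G"]
    by (intro enlarged_eq_graph_vimage[OF that]) (simp add: stopping_times_def pred_def space_enlarged)
  then have "\<forall>q\<in>{0..T}. \<exists>B. B \<in> sets (F q \<Otimes>\<^sub>M borel) \<and> {\<omega>\<in>space M. \<tau> \<omega> \<le> q} = {\<omega>\<in>space M. (\<omega>, G \<omega>) \<in> B}"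
    by blast
  from bchoice[OF this] obtain B where B: "\<And>q. q \<in> {0..T} \<Longrightarrow> B q \<in> sets (F q \<Otimes>\<^sub>M borel)"
    "\<And>q. q \<in> {0..T} \<Longrightarrow> {\<omega>\<in>space M. \<tau> \<omega> \<le> q} = {\<omega>\<in>space M. (\<omega>, G \<omega>) \<in> B q}" by blast
  let ?\<sigma> = "\<lambda>x. Inf (insert T {q\<in>\<rat>. t \<le> q \<and> q < T \<and> x \<in> B q})"
  show ?thesis
  proof
    show "strict_stopping t ?\<sigma>"
    proof (rule strict_stopping_Inf[OF t])
      fix q assume q: "t \<le> q" "q < T"
      have "B q \<in> sets (index_ext T F s \<Otimes>\<^sub>M borel)" if "q < s" for s
      proof -
        have "sets (F q \<Otimes>\<^sub>M (borel :: real measure)) \<subseteq> sets (F (max 0 (min T s)) \<Otimes>\<^sub>M borel)"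
          using q t that by (intro sets_pair_mono) auto
        then show ?thesis using B(1)[of q] q t by (auto simp: index_ext_def)
      qed
      then show "B q \<in> sets (raw_filtration q)" by (auto simp: sets_raw_filtration)
    qed
    fix \<omega> assume \<omega>: "\<omega> \<in> space M"
    have "\<tau> \<omega> \<in> {t..T}" using \<tau> \<omega> by (auto simp: stopping_times_def space_enlarged)
    moreover have "(\<omega>, G \<omega>) \<in> B q \<longleftrightarrow> \<tau> \<omega> \<le> q" if "q \<in> {0..T}" for q
      using B(2)[OF that] \<omega> by blast
    then have "{q\<in>\<rat>. t \<le> q \<and> q < T \<and> (\<omega>, G \<omega>) \<in> B q} = {q\<in>\<rat>. t \<le> q \<and> q < T \<and> \<tau> \<omega> \<le> q}"
      using t by auto
    ultimately show "?\<sigma> (\<omega>, G \<omega>) = \<tau> \<omega>"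
      using Inf_rational_upper_bounds[of t "\<tau> \<omega>" T] by simp
  qed
qed

text \<open>\<open>stopping_time\<close> is phrased with \<open>\<le>\<close>; the arbitrarily small
  delay that this costs is absorbed by the right limits in the product filtration.\<close>

lemma strict_stopping_product:
  assumes t: "t \<in> {0..T}" and \<sigma>: "strict_stopping t \<sigma>"
  shows "\<sigma> \<in> stopping_times T (product_filtration M T F G) t"
proof -
  have \<sigma>_mem: "\<sigma> x \<in> {t..T}" if "x \<in> space M \<times> UNIV" for x using \<sigma> that by (auto simp: strict_stopping_def)
  have "Measurable.pred (index_ext T (product_filtration M T F G) s) (\<lambda>x. \<sigma> x \<le> s)" for s
  proof -
    have sp: "space (index_ext T (product_filtration M T F G) s) = space M \<times> UNIV"
      by (simp add: index_ext_def space_product_filtration)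
    have "{x\<in>space M \<times> UNIV. \<sigma> x \<le> s} \<in> sets (index_ext T (product_filtration M T F G) s)"
    proof -
      consider "s < t" | "t \<le> s" "s < T" | "T \<le> s" by linarith
      then show ?thesis
      proof cases
        case 1
        then have "{x\<in>space M \<times> UNIV. \<sigma> x \<le> s} = {}" using \<sigma>_mem by fastforce
        then show ?thesis by (simp only: sets.empty_sets)
      next
        case 2
        have "{x\<in>space M \<times> UNIV. \<sigma> x \<le> s} \<in> sets (index_ext T F r \<Otimes>\<^sub>M borel)" if "s < r" for r
          using strict_stopping_le[OF \<sigma>, of s "min T r"] 2 t that by (simp add: index_ext_def)
        then have "{x\<in>space M \<times> UNIV. \<sigma> x \<le> s} \<in> sets (raw_filtration s)" by (auto simp: sets_raw_filtration)
        then show ?thesis using index_ext_eq[of s "product_filtration M T F G"] sets_raw_filtration_product_filtration[of s] 2 t by auto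
      next
        case 3
        then have "{x\<in>space M \<times> UNIV. \<sigma> x \<le> s} = space (index_ext T (product_filtration M T F G) s)"
          using \<sigma>_mem unfolding sp by fastforce
        then show ?thesis by (simp only: sets.top)
      qed
    qed
    then show ?thesis by (simp add: pred_def sp)
  qed
  then show ?thesis using \<sigma>_mem by (auto simp: stopping_times_def stopping_time_def space_product_filtration)
qed

text \<open>Each event \<open>{\<tau> \<le> q}\<close> agrees up to a null set with one from
  \<open>raw_filtration q\<close>. Rational \<open>q\<close> suffice to rebuild the time, so the
  exceptional sets together form a single null set.\<close>

lemma product_stopping_strict:
  assumes t: "t \<in> {0..T}" and \<tau>: "\<tau> \<in> stopping_times T (product_filtration M T F G) t"
  obtains \<sigma> where "strict_stopping t \<sigma>" "AE x in product_space M G. \<sigma> x = \<tau> x"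
proof -
  have "\<exists>B\<in>sets (raw_filtration q). AE x in product_space M G. x \<in> {x\<in>space M \<times> UNIV. \<tau> x \<le> q} \<longleftrightarrow> x \<in> B" if "q \<in> {0..T}" for q
    using \<tau> stopping_timeD[of "index_ext T (product_filtration M T F G)" \<tau> q] index_ext_eq[OF that, of "product_filtration M T F G"]
    by (intro product_filtration_AE_eq(2)[OF that]) (simp add: stopping_times_def pred_def space_product_filtration)
  then have "\<forall>q\<in>{0..T}. \<exists>B. B \<in> sets (raw_filtration q) \<and> (AE x in product_space M G. x \<in> {x\<in>space M \<times> UNIV. \<tau> x \<le> q} \<longleftrightarrow> x \<in> B)"
    by blast
  from bchoice[OF this] obtain B where B: "\<And>q. q \<in> {0..T} \<Longrightarrow> B q \<in> sets (raw_filtration q)"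
    "\<And>q. q \<in> {0..T} \<Longrightarrow> AE x in product_space M G. x \<in> {x\<in>space M \<times> UNIV. \<tau> x \<le> q} \<longleftrightarrow> x \<in> B q" by blast
  let ?\<sigma> = "\<lambda>x. Inf (insert T {q\<in>\<rat>. t \<le> q \<and> q < T \<and> x \<in> B q})"
  show ?thesis
  proof
    show "strict_stopping t ?\<sigma>"
      by (rule strict_stopping_Inf[OF t]) (use B(1) t in auto)
    have "AE x in product_space M G. \<forall>q\<in>\<rat> \<inter> {0..T}. x \<in> {x\<in>space M \<times> UNIV. \<tau> x \<le> q} \<longleftrightarrow> x \<in> B q"
      using B(2) by (subst AE_ball_countable) (auto simp: countable_rat)
    then show "AE x in product_space M G. ?\<sigma> x = \<tau> x"
      using AE_space
    proof eventually_elim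
      case (elim x)
      then have x: "x \<in> space M \<times> UNIV" by (simp add: space_product_space)
      have "\<tau> x \<in> {t..T}" using \<tau> x by (auto simp: stopping_times_def space_product_filtration)
      moreover have "{q\<in>\<rat>. t \<le> q \<and> q < T \<and> x \<in> B q} = {q\<in>\<rat>. t \<le> q \<and> q < T \<and> \<tau> x \<le> q}"
        using elim(1) x t by auto
      ultimately show ?case
        using Inf_rational_upper_bounds[of t "\<tau> x" T] by simp
    qed
  qed
qed

text \<open>
  Delaying by \<open>1 / (n + 1)\<close> makes right-continuity of the enlarged filtration unnecessary.
\<close>

lemma strict_stopping_enlarged:
  assumes t: "t \<in> {0..T}" and \<sigma>: "strict_stopping t \<sigma>"
  shows "(\<lambda>\<omega>. min T (\<sigma> (\<omega>, G \<omega>) + 1 / (real n + 1))) \<in> stopping_times T (enlarged_filtration M F G) t"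
proof -
  define \<epsilon> where "\<epsilon> = 1 / (real n + 1)"
  have \<epsilon>: "0 < \<epsilon>" by (simp add: \<epsilon>_def)
  have \<sigma>_mem: "\<sigma> (\<omega>, u) \<in> {t..T}" if "\<omega> \<in> space M" for \<omega> u using \<sigma> that by (auto simp: strict_stopping_def)
  let ?\<tau> = "\<lambda>\<omega>. min T (\<sigma> (\<omega>, G \<omega>) + \<epsilon>)"
  have "Measurable.pred (index_ext T (enlarged_filtration M F G) s) (\<lambda>\<omega>. ?\<tau> \<omega> \<le> s)" for s
  proof -
    have sp: "space (index_ext T (enlarged_filtration M F G) s) = space M"
      by (simp add: index_ext_def space_enlarged)
    have "{\<omega>\<in>space M. ?\<tau> \<omega> \<le> s} \<in> sets (index_ext T (enlarged_filtration M F G) s)"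
    proof -
      consider "s - \<epsilon> < t" "s < T" | "t \<le> s - \<epsilon>" "s < T" | "T \<le> s" by linarith
      then show ?thesis
      proof cases
        case 1
        then have "\<not> ?\<tau> \<omega> \<le> s" if "\<omega> \<in> space M" for \<omega>
          using \<sigma>_mem[OF that, of "G \<omega>"] by auto
        then have "{\<omega>\<in>space M. ?\<tau> \<omega> \<le> s} = {}" by blast
        then show ?thesis by (simp only: sets.empty_sets)
      next
        case 2
        then have s: "s \<in> {0..T}" using t \<epsilon> by auto
        have "{x\<in>space M \<times> UNIV. \<sigma> x \<le> s - \<epsilon>} \<in> sets (F s \<Otimes>\<^sub>M borel)"
          using 2 t \<epsilon> by (intro strict_stopping_le[OF \<sigma>]) auto
        from measurable_sets[OF measurable_graph_enlarged[OF s] this]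
        have "{\<omega>\<in>space M. \<sigma> (\<omega>, G \<omega>) \<le> s - \<epsilon>} \<in> sets (enlarged_filtration M F G s)"
          by (rule back_subst[of "\<lambda>A. A \<in> _"]) (auto simp: space_enlarged)
        also have "{\<omega>\<in>space M. \<sigma> (\<omega>, G \<omega>) \<le> s - \<epsilon>} = {\<omega>\<in>space M. ?\<tau> \<omega> \<le> s}"
          using 2 by auto
        finally show ?thesis by (simp add: index_ext_eq[OF s])
      next
        case 3
        then have "{\<omega>\<in>space M. ?\<tau> \<omega> \<le> s} = space (index_ext T (enlarged_filtration M F G) s)"
          unfolding sp by auto
        then show ?thesis by (simp only: sets.top)
      qed
    qed
    then show ?thesis by (simp add: pred_def sp)
  qed
  moreover have "?\<tau> \<omega> \<in> {t..T}" if "\<omega> \<in> space M" for \<omega>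
    using \<sigma>_mem[OF that, of "G \<omega>"] \<epsilon> t by auto
  ultimately show ?thesis
    unfolding \<epsilon>_def[symmetric] by (simp add: stopping_times_def stopping_time_def space_enlarged)
qed

end

section \<open>Change of measure along the graph\<close>

locale stopping_problem = enlargement M T F G
  for M :: "'a measure" and T :: real and F :: "real \<Rightarrow> 'a measure" and G :: "'a \<Rightarrow> real" +
  fixes P :: "'a \<Rightarrow> real measure" and \<alpha> :: "real \<Rightarrow> real \<Rightarrow> 'a \<Rightarrow> real"
    and L :: "real \<Rightarrow> 'a \<Rightarrow> real" and \<xi> :: "'a \<Rightarrow> real"
  assumes cond_law: "regular_cond_law M (F T) G P"
    and density: "AE \<omega> in M. P \<omega> = density (law M G) (\<lambda>u. ennreal (\<alpha> T u \<omega>))"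
    and density_measurable: "\<And>t. t \<in> {0..T} \<Longrightarrow> (\<lambda>(\<omega>, u). \<alpha> t u \<omega>) \<in> borel_measurable (M \<Otimes>\<^sub>M borel)"
    and density_nonneg: "\<And>t u \<omega>. t \<in> {0..T} \<Longrightarrow> \<omega> \<in> space M \<Longrightarrow> 0 \<le> \<alpha> t u \<omega>"
    and density_martingale: "\<And>u. martingale M T F (\<lambda>t. \<alpha> t u)"
    and density_cadlag: "\<And>u. cadlag M T (\<lambda>t. \<alpha> t u)"
    and L_adapted: "adapted T F L" and L_cadlag: "cadlag M T L"
    and \<xi>_meas: "\<xi> \<in> borel_measurable (F T)"
    and integrability: "(\<integral>\<^sup>+ \<omega>. ((SUP t\<in>{0..T}. ennreal \<bar>L t \<omega>\<bar>) + ennreal \<bar>\<xi> \<omega>\<bar>) \<partial>M) < \<infinity>"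
begin

sublocale law: prob_space "law M G" by (rule prob_space_law)
sublocale pair: pair_prob_space M "law M G" ..

lemma T_mem: "T \<in> {0..T}" using T_pos by auto

lemma prod_measurable_F: "t \<in> {0..T} \<Longrightarrow> f \<in> F t \<Otimes>\<^sub>M borel \<rightarrow>\<^sub>M N \<Longrightarrow> f \<in> prod_measure \<rightarrow>\<^sub>M N"
  by (rule measurable_from_subalg)
     (use sets_pair_subset[of t] sets_prod_eq in \<open>simp_all add: subalgebra_def space_pair_measure space_F\<close>)

lemma measurable_id_prod_F: "t \<in> {0..T} \<Longrightarrow> (\<lambda>x. x) \<in> prod_measure \<rightarrow>\<^sub>M F t \<Otimes>\<^sub>M borel"
  by (rule prod_measurable_F) auto

lemma measurable_density: "t \<in> {0..T} \<Longrightarrow> (\<lambda>x. \<alpha> t (snd x) (fst x)) \<in> borel_measurable prod_measure"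
  using density_measurable[of t] measurable_cong_sets[OF sets_prod_eq refl]
  by (simp add: case_prod_beta)

text \<open>Integrating over \<open>u\<close> first leaves \<open>P \<omega>\<close> of
  \<open>B\<close>, a version of the conditional probability of \<open>G \<omega> \<in> B\<close>
  given \<open>F T\<close>; integrating that over \<open>A\<close>, which lies in
  \<open>F T\<close>, removes the conditioning.\<close>

lemma emeasure_graph_rectangle:
  assumes A: "A \<in> sets (F T)" and B: "B \<in> sets borel"
  shows "emeasure M {\<omega>\<in>A. G \<omega> \<in> B} = (\<integral>\<^sup>+x. ennreal (\<alpha> T (snd x) (fst x)) * indicator (A \<times> B) x \<partial>prod_measure)"
proof -
  interpret s: sigma_finite_subalgebra M "F T" by (rule sigma_finite_F[OF T_mem])
  note [measurable] = sets_F_subset[OF T_mem A] B measurable_density[OF T_mem]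
  have A_sp: "A \<subseteq> space M" using sets_F_subset[OF T_mem A] sets.sets_into_space by blast
  define g where "g \<omega> = (indicator B (G \<omega>) :: real)" for \<omega>
  have gm[measurable]: "g \<in> borel_measurable M" unfolding g_def by measurable
  have gi: "integrable M g" by (rule integrable_const_bound[where B = 1]) (auto simp: g_def)
  have rce_int: "integrable M (\<lambda>x. indicator A x * real_cond_exp M (F T) g x)"
    by (rule s.real_cond_exp_intg(1)) (use A integrable_mult_indicator[OF sets_F_subset[OF T_mem A] gi] in auto)
  have ae: "AE \<omega> in M. measure (P \<omega>) B = real_cond_exp M (F T) g \<omega>"
    using cond_law B unfolding regular_cond_law_def g_def by auto
  have "(\<integral>\<^sup>+x. ennreal (\<alpha> T (snd x) (fst x)) * indicator (A \<times> B) x \<partial>prod_measure) =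
     (\<integral>\<^sup>+\<omega>. (\<integral>\<^sup>+u. ennreal (\<alpha> T u \<omega>) * indicator (A \<times> B) (\<omega>, u) \<partial>law M G) \<partial>M)"
    by (subst law.nn_integral_fst[symmetric]) auto
  also have "\<dots> = (\<integral>\<^sup>+\<omega>. ennreal (indicator A \<omega> * real_cond_exp M (F T) g \<omega>) \<partial>M)"
  proof (rule nn_integral_cong_AE)
    show "AE \<omega> in M. (\<integral>\<^sup>+u. ennreal (\<alpha> T u \<omega>) * indicator (A \<times> B) (\<omega>, u) \<partial>law M G) =
       ennreal (indicator A \<omega> * real_cond_exp M (F T) g \<omega>)"
      using ae density AE_space
    proof eventually_elim
      case (elim \<omega>)
      have "P \<in> F T \<rightarrow>\<^sub>M prob_algebra borel" using cond_law unfolding regular_cond_law_def by blast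
      from measurable_space[OF this, of \<omega>] have "P \<omega> \<in> space (prob_algebra borel)"
        using elim(3) space_F[OF T_mem] by simp
      then interpret P: prob_space "P \<omega>" by (simp add: space_prob_algebra)
      have m: "(\<lambda>u. ennreal (\<alpha> T u \<omega>)) \<in> borel_measurable (law M G)"
        using measurable_compose[OF measurable_Pair1'[OF elim(3)] measurable_density[OF T_mem]] by simp
      have "(\<integral>\<^sup>+u. ennreal (\<alpha> T u \<omega>) * indicator B u \<partial>law M G) = emeasure (P \<omega>) B"
        unfolding elim(2) using m by (subst emeasure_density) auto
      also have "\<dots> = ennreal (real_cond_exp M (F T) g \<omega>)"
        using elim(1) by (simp add: P.emeasure_eq_measure)
      finally show ?case
        by (cases "\<omega> \<in> A") (auto simp: indicator_times)
    qed
  qed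
  also have "\<dots> = ennreal (\<integral>\<omega>. indicator A \<omega> * real_cond_exp M (F T) g \<omega> \<partial>M)"
  proof (rule nn_integral_eq_integral[OF rce_int])
    show "AE x in M. 0 \<le> indicator A x * real_cond_exp M (F T) g x"
      using ae
    proof eventually_elim
      case (elim \<omega>)
      have "0 \<le> real_cond_exp M (F T) g \<omega>" unfolding elim[symmetric] by (rule measure_nonneg)
      then show ?case by simp
    qed
  qed
  also have "(\<integral>\<omega>. indicator A \<omega> * real_cond_exp M (F T) g \<omega> \<partial>M) = (\<integral>\<omega>. indicator A \<omega> * g \<omega> \<partial>M)"
    by (rule s.real_cond_exp_intg(2)) (use A integrable_mult_indicator[OF sets_F_subset[OF T_mem A] gi] in auto)
  also have "\<dots> = (\<integral>\<omega>. indicator {\<omega>\<in>A. G \<omega> \<in> B} \<omega> \<partial>M)"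
    by (intro Bochner_Integration.integral_cong) (auto simp: g_def indicator_def)
  finally have "(\<integral>\<^sup>+x. ennreal (\<alpha> T (snd x) (fst x)) * indicator (A \<times> B) x \<partial>prod_measure) =
    ennreal (\<integral>\<omega>. indicator {\<omega>\<in>A. G \<omega> \<in> B} \<omega> \<partial>M)" .
  moreover have "{\<omega>\<in>A. G \<omega> \<in> B} = A \<inter> {\<omega>\<in>space M. G \<omega> \<in> B}" using A_sp by auto
  then have "{\<omega>\<in>A. G \<omega> \<in> B} \<in> sets M" by simp
  ultimately show ?thesis by (simp add: emeasure_eq_measure)
qed

text \<open>Rectangles are stable under intersection and generate
  \<open>F T \<Otimes>\<^sub>M borel\<close>, so the rectangle formula determines the image measure.
  The identity is tied to this sigma-algebra and can fail on
  \<open>M \<Otimes>\<^sub>M borel\<close>.\<close>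

lemma nn_integral_graph:
  assumes h: "h \<in> borel_measurable (F T \<Otimes>\<^sub>M borel)"
  shows "(\<integral>\<^sup>+\<omega>. h (\<omega>, G \<omega>) \<partial>M) = (\<integral>\<^sup>+x. h x * ennreal (\<alpha> T (snd x) (fst x)) \<partial>prod_measure)"
proof -
  let ?a = "\<lambda>x. ennreal (\<alpha> T (snd x) (fst x))"
  let ?Q = "F T \<Otimes>\<^sub>M (borel :: real measure)"
  let ?E = "{A \<times> B |A B. A \<in> sets (F T) \<and> B \<in> sets (borel :: real measure)}"
  have [measurable]: "?a \<in> borel_measurable prod_measure" using measurable_density[OF T_mem] by measurable
  have gm: "(\<lambda>\<omega>. (\<omega>, G \<omega>)) \<in> M \<rightarrow>\<^sub>M ?Q"
    by (rule measurable_Pair[OF measurable_F[OF T_mem] G_meas]) auto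
  note idm = measurable_id_prod_F[OF T_mem]
  have idm': "(\<lambda>x. x) \<in> density prod_measure ?a \<rightarrow>\<^sub>M ?Q" using idm by simp
  \<comment> \<open>Taking the distribution under the identity map restricts the density measure to
    the smaller sigma-algebra \<open>?Q\<close>, so that both sides are measures on the same
    sets.\<close>
  have "distr M ?Q (\<lambda>\<omega>. (\<omega>, G \<omega>)) = distr (density prod_measure ?a) ?Q (\<lambda>x. x)"
  proof (rule measure_eqI_generator_eq[where E = ?E and A = "\<lambda>_. space (F T) \<times> UNIV" and \<Omega> = "space (F T) \<times> UNIV"])
    show "Int_stable ?E" by (rule Int_stable_pair_measure_generator)
    show "?E \<subseteq> Pow (space (F T) \<times> UNIV)" using pair_measure_closed[of "F T" borel] by simp
    fix X assume "X \<in> ?E"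
    then obtain A B where X: "X = A \<times> B" and A: "A \<in> sets (F T)" and B: "B \<in> sets (borel :: real measure)" by auto
    have XQ: "X \<in> sets ?Q" using A B X by auto
    have "emeasure (distr M ?Q (\<lambda>\<omega>. (\<omega>, G \<omega>))) X = emeasure M {\<omega>\<in>A. G \<omega> \<in> B}"
      using sets.sets_into_space[OF A] space_F[OF T_mem]
      by (subst emeasure_distr[OF gm XQ]) (auto simp: X intro!: arg_cong[where f = "emeasure M"])
    also have "\<dots> = emeasure (distr (density prod_measure ?a) ?Q (\<lambda>x. x)) X"
    proof -
      have "(\<lambda>x. x) -` X \<inter> space (density prod_measure ?a) = X"
        using sets.sets_into_space[OF XQ] space_F[OF T_mem] by (auto simp: space_pair_measure)
      moreover have "X \<in> sets prod_measure"
        using XQ sets_pair_subset[OF T_mem] sets_prod_eq by auto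
      ultimately show ?thesis
        by (subst emeasure_distr[OF idm' XQ]) (simp add: emeasure_density emeasure_graph_rectangle[OF A B] X)
    qed
    finally show "emeasure (distr M ?Q (\<lambda>\<omega>. (\<omega>, G \<omega>))) X = emeasure (distr (density prod_measure ?a) ?Q (\<lambda>x. x)) X" .
  next
    interpret d: prob_space "distr M ?Q (\<lambda>\<omega>. (\<omega>, G \<omega>))" by (rule prob_space_distr[OF gm])
    show "emeasure (distr M ?Q (\<lambda>\<omega>. (\<omega>, G \<omega>))) (space (F T) \<times> UNIV) \<noteq> \<infinity>" by simp
    have "space (F T) \<times> UNIV \<in> ?E" by (rule CollectI, intro exI conjI, rule refl) auto
    then show "range (\<lambda>_. space (F T) \<times> UNIV) \<subseteq> ?E" by blast
  qed (auto simp: sets_pair_measure)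
  then have "(\<integral>\<^sup>+x. h x \<partial>distr M ?Q (\<lambda>\<omega>. (\<omega>, G \<omega>))) = (\<integral>\<^sup>+x. h x \<partial>distr (density prod_measure ?a) ?Q (\<lambda>x. x))"
    by simp
  then have "(\<integral>\<^sup>+\<omega>. h (\<omega>, G \<omega>) \<partial>M) = (\<integral>\<^sup>+x. h x \<partial>density prod_measure ?a)"
    by (simp add: nn_integral_distr[OF gm] nn_integral_distr[OF idm'] h)
  also have "\<dots> = (\<integral>\<^sup>+x. ?a x * h x \<partial>prod_measure)"
    using measurable_compose[OF idm h] by (intro nn_integral_density) auto
  finally show ?thesis by (simp add: mult.commute)
qed

text \<open>With \<open>u\<close> as the outer variable, the inner integral concerns a single
  martingale \<open>\<alpha> _ u\<close> and the section of \<open>\<sigma>\<close> at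
  \<open>u\<close>, which is a random time on \<open>M\<close>. Nonnegativity allows the order of
  integration to be exchanged freely before anything is known to be finite.\<close>

lemma graph_stopped_identity:
  assumes t: "t \<in> {0..T}" and \<sigma>: "strict_stopping t \<sigma>" and A: "A \<in> sets (F t)"
    and Y: "adapted T F Y"
    and Y_nn: "\<And>s x. s \<in> {0..T} \<Longrightarrow> x \<in> space M \<Longrightarrow> 0 \<le> Y s x"
    and Y_rc: "\<And>s x. x \<in> space M \<Longrightarrow> s \<in> {0..<T} \<Longrightarrow> continuous (at_right s) (\<lambda>s. Y s x)"
  shows "(\<lambda>\<omega>. Y (\<sigma> (\<omega>, G \<omega>)) \<omega>) \<in> borel_measurable M" (is ?m1)
    "(\<lambda>x. Y (\<sigma> x) (fst x) * \<alpha> (\<sigma> x) (snd x) (fst x)) \<in> borel_measurable prod_measure" (is ?m2)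
    "(\<integral>\<^sup>+\<omega>. ennreal (indicator A \<omega> * Y (\<sigma> (\<omega>, G \<omega>)) \<omega>) \<partial>M) =
     (\<integral>\<^sup>+x. ennreal (indicator A (fst x) * (Y (\<sigma> x) (fst x) * \<alpha> (\<sigma> x) (snd x) (fst x))) \<partial>prod_measure)"
proof -
  have \<sigma>_mem: "\<sigma> x \<in> {0..T}" if "x \<in> space M \<times> UNIV" for x using strict_stopping_mem[OF \<sigma> that] t by auto
  have sp: "space (F T \<Otimes>\<^sub>M (borel :: real measure)) = space M \<times> UNIV"
    using space_F[OF T_mem] by (simp add: space_pair_measure)
  have \<sigma>T[measurable]: "\<sigma> \<in> borel_measurable (F T \<Otimes>\<^sub>M borel)" by (rule strict_stopping_measurable[OF \<sigma> t])
  have YT: "Y s \<in> borel_measurable (F T)" if "s \<in> {0..T}" for s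
    using Y that by (intro measurable_F_mono[of s T]) (auto simp: adapted_def)
  have Y\<sigma>[measurable]: "(\<lambda>x. Y (\<sigma> x) (fst x)) \<in> borel_measurable (F T \<Otimes>\<^sub>M borel)"
  proof (rule measurable_stopped[where Y = "\<lambda>s x. Y s (fst x)", OF T_nonneg \<sigma>T])
    show "(\<lambda>x. Y s (fst x)) \<in> borel_measurable (F T \<Otimes>\<^sub>M (borel :: real measure))" if "s \<in> {0..T}" for s
      using measurable_compose[OF measurable_fst YT[OF that]] .
  qed (use \<sigma>_mem Y_rc in \<open>auto simp: sp\<close>)
  have AT: "A \<in> sets (F T)" using sets_F_mono[of t T] A t by auto
  have [measurable]: "(\<lambda>x. indicator A (fst x) :: real) \<in> borel_measurable (F T \<Otimes>\<^sub>M (borel :: real measure))"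
    by (rule measurable_compose[OF measurable_fst borel_measurable_indicator[OF AT]])
  have gm: "(\<lambda>\<omega>. (\<omega>, G \<omega>)) \<in> M \<rightarrow>\<^sub>M F T \<Otimes>\<^sub>M borel"
    by (rule measurable_Pair[OF measurable_F[OF T_mem] G_meas]) auto
  show ?m1 using measurable_compose[OF gm Y\<sigma>] by simp
  note [measurable] = prod_measurable_F[OF T_mem Y\<sigma>] measurable_density[OF T_mem] sets_F_subset[OF t A]
  have [measurable]: "(\<lambda>x. \<alpha> (\<sigma> x) (snd x) (fst x)) \<in> borel_measurable prod_measure"
  proof (rule measurable_stopped[where Y = "\<lambda>s x. \<alpha> s (snd x) (fst x)", OF T_nonneg prod_measurable_F[OF T_mem \<sigma>T]])
    fix x s assume "x \<in> space prod_measure" "s \<in> {0..<T}"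
    then show "continuous (at_right s) (\<lambda>s. \<alpha> s (snd x) (fst x))"
      using density_cadlag by (auto simp: cadlag_def space_prod)
  qed (use \<sigma>_mem measurable_density in \<open>auto simp: space_prod\<close>)
  show ?m2 by measurable
  have "(\<integral>\<^sup>+\<omega>. ennreal (indicator A \<omega> * Y (\<sigma> (\<omega>, G \<omega>)) \<omega>) \<partial>M) =
      (\<integral>\<^sup>+x. ennreal (indicator A (fst x) * Y (\<sigma> x) (fst x)) * ennreal (\<alpha> T (snd x) (fst x)) \<partial>prod_measure)"
    by (subst nn_integral_graph[where h = "\<lambda>x. ennreal (indicator A (fst x) * Y (\<sigma> x) (fst x))", simplified]) auto
  also have "\<dots> = (\<integral>\<^sup>+x. ennreal (indicator A (fst x) * Y (\<sigma> x) (fst x) * \<alpha> T (snd x) (fst x)) \<partial>prod_measure)"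
    using Y_nn \<sigma>_mem density_nonneg[OF T_mem]
    by (intro nn_integral_cong) (auto simp: space_prod ennreal_mult)
  also have "\<dots> = (\<integral>\<^sup>+u. (\<integral>\<^sup>+\<omega>. ennreal (indicator A \<omega> * Y (\<sigma> (\<omega>, u)) \<omega> * \<alpha> T u \<omega>) \<partial>M) \<partial>law M G)"
    by (subst pair.nn_integral_snd[symmetric]) auto
  also have "\<dots> = (\<integral>\<^sup>+u. (\<integral>\<^sup>+\<omega>. ennreal (indicator A \<omega> * Y (\<sigma> (\<omega>, u)) \<omega> * \<alpha> (\<sigma> (\<omega>, u)) u \<omega>) \<partial>M) \<partial>law M G)"
  proof (rule nn_integral_cong)
    fix u
    have mem: "\<sigma> (\<omega>, u) \<in> {t..T}" if "\<omega> \<in> space M" for \<omega>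
      using strict_stopping_mem[OF \<sigma>, of "(\<omega>, u)"] that by auto
    have rc: "continuous (at_right s) (\<lambda>s. \<alpha> s u \<omega>)" if "\<omega> \<in> space M" "s \<in> {0..<T}" for \<omega> s
      using density_cadlag that by (auto simp: cadlag_def)
    show "(\<integral>\<^sup>+\<omega>. ennreal (indicator A \<omega> * Y (\<sigma> (\<omega>, u)) \<omega> * \<alpha> T u \<omega>) \<partial>M) =
        (\<integral>\<^sup>+\<omega>. ennreal (indicator A \<omega> * Y (\<sigma> (\<omega>, u)) \<omega> * \<alpha> (\<sigma> (\<omega>, u)) u \<omega>) \<partial>M)"
      using optional_sampling_nn[where X = "\<lambda>s. \<alpha> s u" and \<sigma> = "\<lambda>\<omega>. \<sigma> (\<omega>, u)", OF density_martingale
          density_nonneg rc t mem strict_stopping_section[OF \<sigma>] A Y Y_nn Y_rc]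
      by (rule sym)
  qed
  also have "\<dots> = (\<integral>\<^sup>+x. ennreal (indicator A (fst x) * Y (\<sigma> x) (fst x) * \<alpha> (\<sigma> x) (snd x) (fst x)) \<partial>prod_measure)"
    by (subst pair.nn_integral_snd[symmetric]) auto
  finally show "(\<integral>\<^sup>+\<omega>. ennreal (indicator A \<omega> * Y (\<sigma> (\<omega>, G \<omega>)) \<omega>) \<partial>M) =
     (\<integral>\<^sup>+x. ennreal (indicator A (fst x) * (Y (\<sigma> x) (fst x) * \<alpha> (\<sigma> x) (snd x) (fst x))) \<partial>prod_measure)"
    by (simp add: mult.assoc)
qed

section \<open>The payoff process and its integrable envelope\<close>

abbreviation R :: "real \<Rightarrow> 'a \<Rightarrow> real" where "R \<equiv> payoff T L \<xi>"

lemma R_adapted: "adapted T F R"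
  unfolding adapted_def
proof
  fix s assume s: "s \<in> {0..T}"
  have "R s = (if s = T then \<xi> else L s)" using s by (auto simp: payoff_def fun_eq_iff)
  then show "R s \<in> borel_measurable (F s)" using s \<xi>_meas L_adapted by (auto simp: adapted_def)
qed

lemma R_right_cont:
  assumes "\<omega> \<in> space M" "s \<in> {0..<T}"
  shows "continuous (at_right s) (\<lambda>s. R s \<omega>)"
proof -
  have "continuous (at_right s) (\<lambda>s. L s \<omega>)" using L_cadlag assms by (auto simp: cadlag_def)
  then have "((\<lambda>s. L s \<omega>) \<longlongrightarrow> R s \<omega>) (at_right s)" using assms by (simp add: continuous_within payoff_def)
  moreover have "\<forall>\<^sub>F r in at_right s. L r \<omega> = R r \<omega>"
    using assms by (auto simp: eventually_at_right_field payoff_def intro!: exI[of _ T])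
  ultimately show ?thesis unfolding continuous_within by (rule Lim_transform_eventually)
qed

lemma product_payoff_eq: "s \<in> {0..T} \<Longrightarrow> product_payoff T L \<xi> \<alpha> u s \<omega> = R s \<omega> * \<alpha> s u \<omega>"
  by (cases "s = T") (auto simp: product_payoff_def payoff_def)

text \<open>
  A countable supremum, hence measurable, that by right-continuity still dominates the payoff at
  every time.
\<close>

definition payoff_bound :: "'a \<Rightarrow> ennreal" where
  "payoff_bound \<omega> = (SUP p::nat \<times> int. ennreal \<bar>R (grid T (fst p) (snd p)) \<omega>\<bar>)"

lemma payoff_bound_measurable[measurable]: "payoff_bound \<in> borel_measurable M"
  unfolding payoff_bound_def
proof (rule borel_measurable_SUP)
  fix p :: "nat \<times> int"
  have g: "grid T (fst p) (snd p) \<in> {0..T}" by (rule grid_mem[OF T_nonneg])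
  then have [measurable]: "R (grid T (fst p) (snd p)) \<in> borel_measurable M"
    using R_adapted by (intro measurable_F[OF g]) (auto simp: adapted_def)
  show "(\<lambda>\<omega>. ennreal \<bar>R (grid T (fst p) (snd p)) \<omega>\<bar>) \<in> borel_measurable M" by measurable
qed simp

lemma R_le_payoff_bound:
  assumes "\<omega> \<in> space M" "s \<in> {0..T}"
  shows "ennreal \<bar>R s \<omega>\<bar> \<le> payoff_bound \<omega>"
proof (rule LIMSEQ_le_const2)
  show "(\<lambda>n. ennreal \<bar>R (upper_grid T n s) \<omega>\<bar>) \<longlonglongrightarrow> ennreal \<bar>R s \<omega>\<bar>"
    using assms R_right_cont
    by (intro tendsto_ennrealI tendsto_rabs tendsto_upper_grid[where f = "\<lambda>s. R s \<omega>"]) auto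
  show "\<exists>N. \<forall>n\<ge>N. ennreal \<bar>R (upper_grid T n s) \<omega>\<bar> \<le> payoff_bound \<omega>"
  proof (intro exI allI impI)
    fix n show "ennreal \<bar>R (upper_grid T n s) \<omega>\<bar> \<le> payoff_bound \<omega>"
      unfolding payoff_bound_def upper_grid_def
      by (rule SUP_upper2[of "(n, \<lfloor>(real n + 1) * s\<rfloor>)"]) auto
  qed
qed

text \<open>The supremum in \<open>integrability\<close> runs over uncountably many times and may
  fail to be measurable; \<open>nn_integral_mono\<close> compares the measurable envelope with it
  all the same.\<close>

lemma payoff_bound_finite: "(\<integral>\<^sup>+\<omega>. payoff_bound \<omega> \<partial>M) < \<infinity>"
proof (rule le_less_trans[OF nn_integral_mono integrability])
  fix \<omega>
  show "payoff_bound \<omega> \<le> (SUP t\<in>{0..T}. ennreal \<bar>L t \<omega>\<bar>) + ennreal \<bar>\<xi> \<omega>\<bar>"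
    unfolding payoff_bound_def
  proof (rule SUP_least)
    fix p :: "nat \<times> int"
    define s where "s = grid T (fst p) (snd p)"
    have s: "s \<in> {0..T}" unfolding s_def by (rule grid_mem[OF T_nonneg])
    have "\<bar>R s \<omega>\<bar> \<le> \<bar>L s \<omega>\<bar> + \<bar>\<xi> \<omega>\<bar>" using s by (auto simp: payoff_def indicator_def)
    then have "ennreal \<bar>R s \<omega>\<bar> \<le> ennreal \<bar>L s \<omega>\<bar> + ennreal \<bar>\<xi> \<omega>\<bar>"
      by (simp add: ennreal_plus[symmetric] ennreal_leI del: ennreal_plus)
    also have "\<dots> \<le> (SUP t\<in>{0..T}. ennreal \<bar>L t \<omega>\<bar>) + ennreal \<bar>\<xi> \<omega>\<bar>"
      using s by (intro add_right_mono SUP_upper)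
    finally show "ennreal \<bar>R s \<omega>\<bar> \<le> (SUP t\<in>{0..T}. ennreal \<bar>L t \<omega>\<bar>) + ennreal \<bar>\<xi> \<omega>\<bar>" .
  qed
qed

lemma integrable_payoff_bound: "integrable M (\<lambda>\<omega>. enn2real (payoff_bound \<omega>))" "AE \<omega> in M. ennreal (enn2real (payoff_bound \<omega>)) = payoff_bound \<omega>"
proof -
  have "AE \<omega> in M. payoff_bound \<omega> \<noteq> \<infinity>" using payoff_bound_finite by (intro nn_integral_noteq_infinite) auto
  then show *: "AE \<omega> in M. ennreal (enn2real (payoff_bound \<omega>)) = payoff_bound \<omega>"
    by eventually_elim (simp add: less_top)
  have "(\<integral>\<^sup>+\<omega>. ennreal (enn2real (payoff_bound \<omega>)) \<partial>M) = (\<integral>\<^sup>+\<omega>. payoff_bound \<omega> \<partial>M)"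
    using * by (intro nn_integral_cong_AE)
  then show "integrable M (\<lambda>\<omega>. enn2real (payoff_bound \<omega>))"
    using payoff_bound_finite by (intro integrableI_nonneg) auto
qed

text \<open>The exceptional set, where \<open>payoff_bound\<close> is infinite, is the same for all
  times. The estimate may therefore be evaluated at random times.\<close>

lemma R_bound: "AE \<omega> in M. \<forall>s\<in>{0..T}. \<bar>R s \<omega>\<bar> \<le> enn2real (payoff_bound \<omega>)"
  using integrable_payoff_bound(2) AE_space
proof eventually_elim
  case (elim \<omega>)
  then show ?case using R_le_payoff_bound[of \<omega>] by (metis enn2real_nonneg ennreal_le_iff)
qed

definition stopped_payoff :: "('a \<times> real \<Rightarrow> real) \<Rightarrow> 'a \<times> real \<Rightarrow> real" where
  "stopped_payoff \<sigma> x = R (\<sigma> x) (fst x) * \<alpha> (\<sigma> x) (snd x) (fst x)"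

text \<open>The nonnegative identity is applied to both parts of \<open>R\<close>. The envelope
  bounds them under \<open>M\<close>, and finiteness then crosses to the product through the
  identity itself.\<close>

lemma stopped_payoff_integral:
  assumes t: "t \<in> {0..T}" and \<sigma>: "strict_stopping t \<sigma>"
  shows "integrable prod_measure (stopped_payoff \<sigma>)"
    "integrable M (\<lambda>\<omega>. R (\<sigma> (\<omega>, G \<omega>)) \<omega>)"
    "\<And>A. A \<in> sets (F t) \<Longrightarrow> (\<integral>\<omega>. indicator A \<omega> * R (\<sigma> (\<omega>, G \<omega>)) \<omega> \<partial>M) =
       (\<integral>x. indicator A (fst x) * stopped_payoff \<sigma> x \<partial>prod_measure)"
proof -
  \<comment> \<open>The flag \<open>b\<close> selects the positive or the negative part, so that
    each fact about the two is proved once.\<close>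
  define Y where "Y b s \<omega> = max (if b then R s \<omega> else - R s \<omega>) 0" for b s \<omega>
  have Y: "adapted T F (Y b)" for b using R_adapted by (cases b) (auto simp: adapted_def Y_def[abs_def])
  have Y_nn: "0 \<le> Y b s \<omega>" for b s \<omega> by (simp add: Y_def)
  have Y_rc: "continuous (at_right s) (\<lambda>s. Y b s \<omega>)" if "\<omega> \<in> space M" "s \<in> {0..<T}" for b s \<omega>
    using R_right_cont[OF that] unfolding Y_def continuous_within
    by (cases b) (auto intro!: tendsto_max tendsto_minus)
  have R_eq: "R s \<omega> = Y True s \<omega> - Y False s \<omega>" for s \<omega> by (simp add: Y_def)
  note id = graph_stopped_identity[OF t \<sigma> _ Y Y_nn Y_rc]
  have \<sigma>_mem: "\<sigma> x \<in> {0..T}" if "x \<in> space M \<times> UNIV" for x using strict_stopping_mem[OF \<sigma> that] t by auto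
  have sp: "space M \<in> sets (F t)" using sets.top[of "F t"] space_F[OF t] by simp
  define a where "a b \<omega> = Y b (\<sigma> (\<omega>, G \<omega>)) \<omega>" for b \<omega>
  define c where "c b x = Y b (\<sigma> x) (fst x) * \<alpha> (\<sigma> x) (snd x) (fst x)" for b x
  have [measurable]: "a b \<in> borel_measurable M" "c b \<in> borel_measurable prod_measure" for b
    unfolding a_def c_def using id(1,2)[OF sp] by auto
  have a_nn: "0 \<le> a b \<omega>" for b \<omega> by (simp add: a_def Y_nn)
  have c_nn: "0 \<le> c b x" if "x \<in> space M \<times> UNIV" for b x
    using \<sigma>_mem[OF that] density_nonneg that by (auto simp: c_def Y_nn)
  have nn: "(\<integral>\<^sup>+\<omega>. ennreal (indicator A \<omega> * a b \<omega>) \<partial>M) = (\<integral>\<^sup>+x. ennreal (indicator A (fst x) * c b x) \<partial>prod_measure)"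
    if "A \<in> sets (F t)" for A b
    unfolding a_def c_def by (rule id(3)[OF that])
  have a_int: "integrable M (a b)" for b
  proof (rule Bochner_Integration.integrable_bound[OF integrable_payoff_bound(1)])
    show "AE \<omega> in M. norm (a b \<omega>) \<le> norm (enn2real (payoff_bound \<omega>))"
      using R_bound AE_space
    proof eventually_elim
      case (elim \<omega>)
      then have "\<bar>R (\<sigma> (\<omega>, G \<omega>)) \<omega>\<bar> \<le> enn2real (payoff_bound \<omega>)" using \<sigma>_mem[of "(\<omega>, G \<omega>)"] by auto
      then show ?case by (auto simp: a_def Y_def)
    qed
  qed measurable
  \<comment> \<open>The identity with \<open>A = space M\<close> equates this integral with that of
    \<open>a b\<close> under \<open>M\<close>, which is finite.\<close>
  have "(\<integral>\<^sup>+x. ennreal (c b x) \<partial>prod_measure) < \<infinity>" for b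
  proof -
    have "(\<integral>\<^sup>+x. ennreal (c b x) \<partial>prod_measure) = (\<integral>\<^sup>+x. ennreal (indicator (space M) (fst x) * c b x) \<partial>prod_measure)"
      by (intro nn_integral_cong) (auto simp: space_prod)
    also have "\<dots> = (\<integral>\<^sup>+\<omega>. ennreal (a b \<omega>) \<partial>M)"
      unfolding nn[OF sp, symmetric] by (intro nn_integral_cong) auto
    also have "\<dots> < \<infinity>" using a_int[of b] a_nn by (simp add: integrable_iff_bounded)
    finally show ?thesis .
  qed
  then have c_int: "integrable prod_measure (c b)" for b
    using c_nn by (intro integrableI_nonneg) (auto simp: space_prod)
  have f_eq: "stopped_payoff \<sigma> x = c True x - c False x" for x
    by (simp add: stopped_payoff_def c_def R_eq left_diff_distrib)
  have a_eq: "R (\<sigma> (\<omega>, G \<omega>)) \<omega> = a True \<omega> - a False \<omega>" for \<omega> by (simp add: a_def R_eq)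
  show "integrable prod_measure (stopped_payoff \<sigma>)" unfolding f_eq[abs_def] using c_int by auto
  show "integrable M (\<lambda>\<omega>. R (\<sigma> (\<omega>, G \<omega>)) \<omega>)" unfolding a_eq using a_int by auto
  fix A assume A: "A \<in> sets (F t)"
  have [measurable]: "A \<in> sets M" by (rule sets_F_subset[OF t A])
  have Aa: "integrable M (\<lambda>\<omega>. indicator A \<omega> * a b \<omega>)" for b
    using integrable_mult_indicator[OF \<open>A \<in> sets M\<close> a_int] by simp
  have Ac: "integrable prod_measure (\<lambda>x. indicator A (fst x) * c b x)" for b
    by (rule Bochner_Integration.integrable_bound[OF c_int[of b]]) (auto simp: indicator_def)
  have "(\<integral>\<omega>. indicator A \<omega> * a b \<omega> \<partial>M) = (\<integral>x. indicator A (fst x) * c b x \<partial>prod_measure)" for b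
  proof -
    have "ennreal (\<integral>\<omega>. indicator A \<omega> * a b \<omega> \<partial>M) = ennreal (\<integral>x. indicator A (fst x) * c b x \<partial>prod_measure)"
      using nn[OF A, of b] a_nn c_nn
      by (subst (1 2) nn_integral_eq_integral[symmetric]) (auto simp: space_prod Aa Ac intro!: AE_I2)
    moreover have "0 \<le> (\<integral>\<omega>. indicator A \<omega> * a b \<omega> \<partial>M)" using a_nn by (intro integral_nonneg_AE) auto
    moreover have "0 \<le> (\<integral>x. indicator A (fst x) * c b x \<partial>prod_measure)" using c_nn
      by (intro integral_nonneg_AE AE_I2) (auto simp: space_prod)
    ultimately show ?thesis by simp
  qed
  then show "(\<integral>\<omega>. indicator A \<omega> * R (\<sigma> (\<omega>, G \<omega>)) \<omega> \<partial>M) = (\<integral>x. indicator A (fst x) * stopped_payoff \<sigma> x \<partial>prod_measure)"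
    unfolding f_eq a_eq using Aa Ac by (simp add: right_diff_distrib)
qed

end

section \<open>Conditional expectations of stopped payoffs\<close>

lemma (in sigma_finite_subalgebra) real_cond_exp_L1_bound:
  assumes f: "integrable M f"
  shows "(\<integral>x. \<bar>real_cond_exp M F f x\<bar> \<partial>M) \<le> (\<integral>x. \<bar>f x\<bar> \<partial>M)"
proof -
  have fa: "integrable M (\<lambda>x. \<bar>f x\<bar>)" using f by (rule integrable_abs)
  have "AE x in M. real_cond_exp M F f x \<le> real_cond_exp M F (\<lambda>x. \<bar>f x\<bar>) x"
    by (rule real_cond_exp_mono) (use f fa in auto)
  moreover have "AE x in M. real_cond_exp M F (\<lambda>x. - 1 * f x) x \<le> real_cond_exp M F (\<lambda>x. \<bar>f x\<bar>) x"
    by (rule real_cond_exp_mono) (use f fa in auto)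
  moreover have "AE x in M. real_cond_exp M F (\<lambda>x. - 1 * f x) x = - 1 * real_cond_exp M F f x"
    by (rule real_cond_exp_cmult[OF f])
  ultimately have "AE x in M. \<bar>real_cond_exp M F f x\<bar> \<le> real_cond_exp M F (\<lambda>x. \<bar>f x\<bar>) x"
    by eventually_elim auto
  then have "(\<integral>x. \<bar>real_cond_exp M F f x\<bar> \<partial>M) \<le> (\<integral>x. real_cond_exp M F (\<lambda>x. \<bar>f x\<bar>) x \<partial>M)"
    by (intro integral_mono_AE integrable_abs real_cond_exp_int f fa)
  also have "\<dots> = (\<integral>x. \<bar>f x\<bar> \<partial>M)" by (rule real_cond_exp_int(2)[OF fa])
  finally show ?thesis .
qed

text \<open>Conditional expectation contracts the L1 norm, and L1 convergence yields almost
  everywhere convergence along a subsequence. A subsequence is enough for passing a common upper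
  bound to the limit.\<close>

lemma (in sigma_finite_subalgebra) real_cond_exp_AE_subseq:
  assumes f: "\<And>n. integrable M (f n)" and g: "integrable M g"
    and lim: "(\<lambda>n. \<integral>x. \<bar>f n x - g x\<bar> \<partial>M) \<longlonglongrightarrow> 0"
  obtains r :: "nat \<Rightarrow> nat" where "strict_mono r"
    "AE x in M. (\<lambda>n. real_cond_exp M F (f (r n)) x) \<longlonglongrightarrow> real_cond_exp M F g x"
proof -
  define u where "u n x = real_cond_exp M F (f n) x - real_cond_exp M F g x" for n x
  have u: "integrable M (u n)" for n unfolding u_def by (intro Bochner_Integration.integrable_diff real_cond_exp_int f g)
  have "(\<integral>x. norm (u n x) \<partial>M) \<le> (\<integral>x. \<bar>f n x - g x\<bar> \<partial>M)" for n
  proof -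
    have fg: "integrable M (\<lambda>x. f n x - g x)" by (intro Bochner_Integration.integrable_diff f g)
    have "(\<integral>x. norm (u n x) \<partial>M) = (\<integral>x. \<bar>real_cond_exp M F (\<lambda>x. f n x - g x) x\<bar> \<partial>M)"
    proof (rule integral_cong_AE)
      show "AE x in M. norm (u n x) = \<bar>real_cond_exp M F (\<lambda>x. f n x - g x) x\<bar>"
        using real_cond_exp_diff[OF f g, of n] by eventually_elim (simp add: u_def)
    qed (use u in \<open>auto simp: borel_measurable_integrable\<close>)
    also have "\<dots> \<le> (\<integral>x. \<bar>f n x - g x\<bar> \<partial>M)" by (rule real_cond_exp_L1_bound[OF fg])
    finally show ?thesis .
  qed
  then have "(\<lambda>n. \<integral>x. norm (u n x) \<partial>M) \<longlonglongrightarrow> 0"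
    by (intro tendsto_sandwich[OF _ _ tendsto_const lim]) auto
  from tendsto_L1_AE_subseq[OF u this] obtain r where r: "strict_mono r" "AE x in M. (\<lambda>n. u (r n) x) \<longlonglongrightarrow> 0"
    by blast
  have "AE x in M. (\<lambda>n. real_cond_exp M F (f (r n)) x) \<longlonglongrightarrow> real_cond_exp M F g x"
    using r(2) by eventually_elim (simp add: u_def LIM_zero_iff)
  with r(1) show ?thesis by (rule that)
qed

section \<open>Conditional payoffs with and without the completion\<close>

context stopping_problem
begin

sublocale product: prob_space "product_space M G"
proof
  have "emeasure (product_space M G) (space (product_space M G)) = emeasure prod_measure (space prod_measure)"
    using sets.top[of "completion prod_measure"] main_part[OF sets.top[of prod_measure]]
    by (simp add: product_space_def)
  then show "emeasure (product_space M G) (space (product_space M G)) = 1"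
    using pair.emeasure_space_1 by simp
qed

lemma sigma_finite_raw_filtration: "t \<in> {0..T} \<Longrightarrow> sigma_finite_subalgebra prod_measure (raw_filtration t)"
  by (intro finite_measure_subalgebra_is_sigma_finite)
     (simp add: finite_measure_subalgebra_def finite_measure_subalgebra_axioms_def subalgebra_raw_filtration_prod pair.finite_measure_axioms)

lemma sigma_finite_product_filtration:
  "t \<in> {0..T} \<Longrightarrow> sigma_finite_subalgebra (product_space M G) (product_filtration M T F G t)"
  by (intro finite_measure_subalgebra_is_sigma_finite)
     (simp add: finite_measure_subalgebra_def finite_measure_subalgebra_axioms_def subalgebra_product_filtration product.finite_measure_axioms)

lemma AE_product_space: "(AE x in product_space M G. Q x) \<longleftrightarrow> (AE x in prod_measure. Q x)"
  unfolding product_space_def by (rule AE_completion_iff)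

lemma measurable_product_space: "f \<in> prod_measure \<rightarrow>\<^sub>M N \<Longrightarrow> f \<in> product_space M G \<rightarrow>\<^sub>M N"
  by (simp add: product_space_def measurable_completion)

lemma integral_product_space:
  fixes f :: "'a \<times> real \<Rightarrow> real"
  assumes "f \<in> borel_measurable prod_measure"
  shows "integrable (product_space M G) f \<longleftrightarrow> integrable prod_measure f"
    "integral\<^sup>L (product_space M G) f = integral\<^sup>L prod_measure f"
  using assms by (simp_all add: product_space_def integrable_completion integral_completion)

text \<open>Formed on the uncompleted product and the filtration without adjoined null sets, so that
  Fubini applies and sections in \<open>u\<close> are Borel.\<close>

definition cond_payoff :: "real \<Rightarrow> ('a \<times> real \<Rightarrow> real) \<Rightarrow> 'a \<times> real \<Rightarrow> real" where
  "cond_payoff t \<sigma> = real_cond_exp prod_measure (raw_filtration t) (stopped_payoff \<sigma>)"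

lemma cond_payoff_measurable:
  "cond_payoff t \<sigma> \<in> borel_measurable (raw_filtration t)" "cond_payoff t \<sigma> \<in> borel_measurable prod_measure"
  unfolding cond_payoff_def by auto

lemma cond_payoff_integrable:
  "t \<in> {0..T} \<Longrightarrow> strict_stopping t \<sigma> \<Longrightarrow> integrable prod_measure (cond_payoff t \<sigma>)"
  unfolding cond_payoff_def
  using sigma_finite_subalgebra.real_cond_exp_int(1)[OF sigma_finite_raw_filtration] stopped_payoff_integral(1) by blast

text \<open>An event of the product filtration differs from one of \<open>raw_filtration t\<close>
  by a null set, so integrals over the two agree. The defining property of the uncompleted
  conditional expectation thus carries over to the completed filtration.\<close>

lemma cond_payoff_version:
  assumes t: "t \<in> {0..T}" and \<sigma>: "strict_stopping t \<sigma>"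
  shows "AE x in product_space M G.
    real_cond_exp (product_space M G) (product_filtration M T F G t) (stopped_payoff \<sigma>) x = cond_payoff t \<sigma> x"
proof -
  interpret K: sigma_finite_subalgebra prod_measure "raw_filtration t" by (rule sigma_finite_raw_filtration[OF t])
  interpret s: sigma_finite_subalgebra "product_space M G" "product_filtration M T F G t"
    by (rule sigma_finite_product_filtration[OF t])
  have f: "integrable prod_measure (stopped_payoff \<sigma>)" by (rule stopped_payoff_integral(1)[OF t \<sigma>])
  have fm: "stopped_payoff \<sigma> \<in> borel_measurable prod_measure" using f by auto
  have eq: "(\<integral>x\<in>A. h x \<partial>product_space M G) = (\<integral>x\<in>B. h x \<partial>prod_measure)"
    if h: "h \<in> borel_measurable prod_measure" and A: "A \<in> sets (product_space M G)" and B: "B \<in> sets (raw_filtration t)"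
      and AB: "AE x in product_space M G. x \<in> A \<longleftrightarrow> x \<in> B" for h :: "_ \<Rightarrow> real" and A B
  proof -
    have B': "B \<in> sets prod_measure" using B K.subalg by (auto simp: subalgebra_def)
    have [measurable]: "A \<in> sets (product_space M G)" "B \<in> sets (product_space M G)" "h \<in> borel_measurable (product_space M G)"
      using A B subalgebra_raw_filtration[OF t] measurable_product_space[OF h] by (auto simp: subalgebra_def)
    have "(\<integral>x\<in>A. h x \<partial>product_space M G) = (\<integral>x\<in>B. h x \<partial>product_space M G)"
      unfolding set_lebesgue_integral_def
    proof (rule integral_cong_AE)
      show "AE x in product_space M G. indicator A x *\<^sub>R h x = indicator B x *\<^sub>R h x"
        using AB by eventually_elim (simp add: indicator_def)
    qed measurable
    also have "\<dots> = (\<integral>x\<in>B. h x \<partial>prod_measure)"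
      unfolding set_lebesgue_integral_def using B' h
      by (intro integral_product_space(2) borel_measurable_scaleR borel_measurable_indicator)
    finally show ?thesis .
  qed
  show ?thesis
  proof (rule s.real_cond_exp_charact)
    fix A assume A: "A \<in> sets (product_filtration M T F G t)"
    from product_filtration_AE_eq[OF t A] obtain B where
      AP: "A \<in> sets (product_space M G)" and B: "B \<in> sets (raw_filtration t)" "AE x in product_space M G. x \<in> A \<longleftrightarrow> x \<in> B" by blast
    have "(\<integral>x\<in>A. stopped_payoff \<sigma> x \<partial>product_space M G) = (\<integral>x\<in>B. stopped_payoff \<sigma> x \<partial>prod_measure)"
      by (rule eq[OF fm AP B])
    also have "\<dots> = (\<integral>x\<in>B. cond_payoff t \<sigma> x \<partial>prod_measure)"
      unfolding cond_payoff_def by (rule K.real_cond_exp_intA[OF f B(1)])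
    also have "\<dots> = (\<integral>x\<in>A. cond_payoff t \<sigma> x \<partial>product_space M G)"
      by (rule eq[OF cond_payoff_measurable(2) AP B, symmetric])
    finally show "(\<integral>x\<in>A. stopped_payoff \<sigma> x \<partial>product_space M G) = (\<integral>x\<in>A. cond_payoff t \<sigma> x \<partial>product_space M G)" .
  next
    show "cond_payoff t \<sigma> \<in> borel_measurable (product_filtration M T F G t)"
    proof (rule measurable_from_subalg[OF _ cond_payoff_measurable(1)])
      show "subalgebra (product_filtration M T F G t) (raw_filtration t)"
        using sets_raw_filtration_product_filtration by (auto simp: subalgebra_def space_product_filtration space_raw_filtration)
    qed
  qed (use f fm cond_payoff_measurable cond_payoff_integrable[OF t \<sigma>] in \<open>auto simp: integral_product_space(1)\<close>)
qed

lemma cylinder_in_raw_filtration: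
  assumes t: "t \<in> {0..T}" and A: "A \<in> sets (F t)"
  shows "A \<times> UNIV \<in> sets (raw_filtration t)"
proof -
  have "A \<times> UNIV \<in> sets (index_ext T F s \<Otimes>\<^sub>M (borel :: real measure))" if "t < s" for s
  proof -
    have "A \<in> sets (index_ext T F s)"
      using sets_F_mono[of t "max 0 (min T s)"] A t that by (auto simp: index_ext_def)
    then show ?thesis by auto
  qed
  then show ?thesis by (auto simp: sets_raw_filtration)
qed

text \<open>Integrating out \<open>u\<close> gives measurability for \<open>F s\<close> at every
  \<open>s > t\<close>, since \<open>W\<close> belongs to the right limit at \<open>t\<close>;
  right-continuity of \<open>F\<close> brings this back to \<open>F t\<close>.\<close>

lemma section_integral_measurable:
  fixes W :: "'a \<times> real \<Rightarrow> real"
  assumes t: "t \<in> {0..T}" and W: "W \<in> borel_measurable (raw_filtration t)"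
  shows "(\<lambda>\<omega>. \<integral>u. W (\<omega>, u) \<partial>law M G) \<in> borel_measurable (F t)"
proof -
  have *: "(\<lambda>\<omega>. \<integral>u. W (\<omega>, u) \<partial>law M G) \<in> borel_measurable (F s)" if s: "t < s \<or> s = T" "s \<le> T" for s
  proof -
    have s': "s \<in> {0..T}" using s t by auto
    have "subalgebra (F s \<Otimes>\<^sub>M borel) (raw_filtration t)"
      using sets_raw_filtration_subset[OF t s] space_F[OF s'] by (simp add: subalgebra_def space_raw_filtration space_pair_measure)
    from measurable_from_subalg[OF this W] have W': "W \<in> borel_measurable (F s \<Otimes>\<^sub>M law M G)"
      by (simp cong: measurable_cong_sets sets_pair_measure_cong)
    show ?thesis
      using law.borel_measurable_lebesgue_integral[of "\<lambda>\<omega> u. W (\<omega>, u)" "F s"] W' by simp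
  qed
  show ?thesis
  proof (rule measurableI)
    fix B :: "real set" assume B: "B \<in> sets borel"
    show "(\<lambda>\<omega>. \<integral>u. W (\<omega>, u) \<partial>law M G) -` B \<inter> space (F t) \<in> sets (F t)"
    proof (rule sets_F_Inter[OF t])
      fix s assume s: "s \<in> {t<..T}"
      have "space (F t) = space (F s)" using space_F[OF t] space_F[of s] s t by auto
      then show "(\<lambda>\<omega>. \<integral>u. W (\<omega>, u) \<partial>law M G) -` B \<inter> space (F t) \<in> sets (F s)"
        using measurable_sets[OF *[of s] B] s by auto
    next
      assume "t = T"
      then show "(\<lambda>\<omega>. \<integral>u. W (\<omega>, u) \<partial>law M G) -` B \<inter> space (F t) \<in> sets (F T)"
        using measurable_sets[OF *[of T] B] by auto
    qed
  qed simp
qed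

text \<open>For \<open>A\<close> in \<open>F t\<close> the cylinder \<open>A \<times> UNIV\<close>
  is known to the product filtration at \<open>t\<close>, so over it the stopped payoff may be
  replaced by its conditional expectation; Fubini then integrates out \<open>u\<close>.\<close>

lemma cond_exp_graph_stopped:
  assumes t: "t \<in> {0..T}" and \<sigma>: "strict_stopping t \<sigma>"
  shows "AE \<omega> in M. real_cond_exp M (F t) (\<lambda>\<omega>. R (\<sigma> (\<omega>, G \<omega>)) \<omega>) \<omega> = (\<integral>u. cond_payoff t \<sigma> (\<omega>, u) \<partial>law M G)"
proof -
  interpret K: sigma_finite_subalgebra prod_measure "raw_filtration t" by (rule sigma_finite_raw_filtration[OF t])
  interpret s: sigma_finite_subalgebra M "F t" by (rule sigma_finite_F[OF t])
  have f: "integrable prod_measure (stopped_payoff \<sigma>)" by (rule stopped_payoff_integral(1)[OF t \<sigma>])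
  have W: "integrable prod_measure (cond_payoff t \<sigma>)" by (rule cond_payoff_integrable[OF t \<sigma>])
  show ?thesis
  proof (rule s.real_cond_exp_charact)
    fix A assume A: "A \<in> sets (F t)"
    note AK = cylinder_in_raw_filtration[OF t A]
    have AP: "A \<times> UNIV \<in> sets prod_measure" using AK K.subalg by (auto simp: subalgebra_def)
    have "(\<integral>\<omega>\<in>A. R (\<sigma> (\<omega>, G \<omega>)) \<omega> \<partial>M) = (\<integral>x. indicator A (fst x) * stopped_payoff \<sigma> x \<partial>prod_measure)"
      using stopped_payoff_integral(3)[OF t \<sigma> A] by (simp add: set_lebesgue_integral_def)
    also have "\<dots> = (\<integral>x\<in>A \<times> UNIV. stopped_payoff \<sigma> x \<partial>prod_measure)"
      by (auto simp: set_lebesgue_integral_def indicator_times intro!: Bochner_Integration.integral_cong)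
    also have "\<dots> = (\<integral>x\<in>A \<times> UNIV. cond_payoff t \<sigma> x \<partial>prod_measure)"
      unfolding cond_payoff_def by (rule K.real_cond_exp_intA[OF f AK])
    also have "\<dots> = (\<integral>\<omega>. (\<integral>u. indicator (A \<times> UNIV) (\<omega>, u) *\<^sub>R cond_payoff t \<sigma> (\<omega>, u) \<partial>law M G) \<partial>M)"
      unfolding set_lebesgue_integral_def by (rule pair.integral_fst'[symmetric]) (rule integrable_mult_indicator[OF AP W])
    also have "\<dots> = (\<integral>\<omega>\<in>A. (\<integral>u. cond_payoff t \<sigma> (\<omega>, u) \<partial>law M G) \<partial>M)"
      by (simp add: set_lebesgue_integral_def indicator_times)
    finally show "(\<integral>\<omega>\<in>A. R (\<sigma> (\<omega>, G \<omega>)) \<omega> \<partial>M) = (\<integral>\<omega>\<in>A. (\<integral>u. cond_payoff t \<sigma> (\<omega>, u) \<partial>law M G) \<partial>M)" .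
  qed (use stopped_payoff_integral(2)[OF t \<sigma>] pair.integrable_fst'[OF W]
        section_integral_measurable[OF t cond_payoff_measurable(1)] in auto)
qed

definition product_value :: "real \<Rightarrow> ('a \<times> real \<Rightarrow> real) \<Rightarrow> 'a \<times> real \<Rightarrow> real" where
  "product_value t \<tau> = real_cond_exp (product_space M G) (product_filtration M T F G t)
     (\<lambda>(\<omega>, u). product_payoff T L \<xi> \<alpha> u (\<tau> (\<omega>, u)) \<omega>)"

text \<open>The time \<open>\<tau>\<close> is tied to the strict time \<open>\<sigma>\<close> only
  up to a null set, and its payoff is measurable because the product space is complete. The second
  claim moves means to \<open>M\<close>, where the envelope bounds them.\<close>

lemma product_value_representation:
  assumes t: "t \<in> {0..T}" and \<sigma>: "strict_stopping t \<sigma>" "AE x in product_space M G. \<sigma> x = \<tau> x"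
  shows "integrable (product_space M G) (\<lambda>(\<omega>, u). product_payoff T L \<xi> \<alpha> u (\<tau> (\<omega>, u)) \<omega>)" (is ?int)
    "(\<integral>(\<omega>, u). product_payoff T L \<xi> \<alpha> u (\<tau> (\<omega>, u)) \<omega> \<partial>product_space M G) = (\<integral>\<omega>. R (\<sigma> (\<omega>, G \<omega>)) \<omega> \<partial>M)" (is ?eq)
    "AE x in product_space M G. product_value t \<tau> x = cond_payoff t \<sigma> x" (is ?ae)
proof -
  interpret s: sigma_finite_subalgebra "product_space M G" "product_filtration M T F G t"
    by (rule sigma_finite_product_filtration[OF t])
  interpret c: complete_measure "product_space M G"
    unfolding product_space_def by (rule completion.complete_measure_axioms)
  let ?H = "\<lambda>(\<omega>, u). product_payoff T L \<xi> \<alpha> u (\<tau> (\<omega>, u)) \<omega>"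
  have f: "integrable prod_measure (stopped_payoff \<sigma>)" by (rule stopped_payoff_integral(1)[OF t \<sigma>(1)])
  then have fm: "stopped_payoff \<sigma> \<in> borel_measurable prod_measure" by auto
  have eq: "AE x in product_space M G. stopped_payoff \<sigma> x = ?H x"
    using \<sigma>(2) AE_space
  proof eventually_elim
    case (elim x)
    then have "\<sigma> x \<in> {0..T}" using strict_stopping_mem[OF \<sigma>(1), of x] t by (auto simp: space_product_space)
    then show ?case using elim(1) by (simp add: stopped_payoff_def product_payoff_eq case_prod_beta)
  qed
  have Hm: "?H \<in> borel_measurable (product_space M G)"
    by (rule c.measurable_AE_eq[OF measurable_product_space[OF fm] eq]) simp
  have fP: "integrable (product_space M G) (stopped_payoff \<sigma>)" using f fm by (simp add: integral_product_space)
  show ?int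
    by (rule integrable_cong_AE_imp[OF fP Hm]) (use eq in \<open>eventually_elim, simp\<close>)
  have "integral\<^sup>L (product_space M G) ?H = integral\<^sup>L (product_space M G) (stopped_payoff \<sigma>)"
    by (rule integral_cong_AE[OF Hm measurable_product_space[OF fm]]) (use eq in \<open>eventually_elim, simp\<close>)
  also have "\<dots> = integral\<^sup>L prod_measure (stopped_payoff \<sigma>)" by (rule integral_product_space(2)[OF fm])
  also have "\<dots> = (\<integral>x. indicator (space M) (fst x) * stopped_payoff \<sigma> x \<partial>prod_measure)"
    by (intro Bochner_Integration.integral_cong) (auto simp: space_prod)
  also have "\<dots> = (\<integral>\<omega>. indicator (space M) \<omega> * R (\<sigma> (\<omega>, G \<omega>)) \<omega> \<partial>M)"
    using sets.top[of "F t"] space_F[OF t] by (intro stopped_payoff_integral(3)[OF t \<sigma>(1), symmetric]) simp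
  also have "\<dots> = (\<integral>\<omega>. R (\<sigma> (\<omega>, G \<omega>)) \<omega> \<partial>M)"
    by (intro Bochner_Integration.integral_cong) auto
  finally show ?eq .
  have "AE x in product_space M G. product_value t \<tau> x =
      real_cond_exp (product_space M G) (product_filtration M T F G t) (stopped_payoff \<sigma>) x"
    unfolding product_value_def
    by (rule s.real_cond_exp_cong[OF _ Hm measurable_product_space[OF fm]]) (use eq in \<open>eventually_elim, simp\<close>)
  then show ?ae
    using cond_payoff_version[OF t \<sigma>(1)] by eventually_elim simp
qed

text \<open>Stop at \<open>\<tau>1\<close> where its conditional value is the larger one and at
  \<open>\<tau>2\<close> elsewhere. The choice is made at time \<open>t\<close>, before either time
  occurs, so the result is a stopping time; the indicator of the choice leaves the conditional
  expectation, and the new value is the maximum of the two.\<close>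

lemma product_value_directed:
  assumes t: "t \<in> {0..T}"
    and \<tau>1: "\<tau>1 \<in> stopping_times T (product_filtration M T F G) t"
    and \<tau>2: "\<tau>2 \<in> stopping_times T (product_filtration M T F G) t"
  shows "\<exists>\<tau>\<in>stopping_times T (product_filtration M T F G) t. AE x in product_space M G.
    product_value t \<tau>1 x \<le> product_value t \<tau> x \<and> product_value t \<tau>2 x \<le> product_value t \<tau> x"
proof -
  interpret s: sigma_finite_subalgebra "product_space M G" "product_filtration M T F G t"
    by (rule sigma_finite_product_filtration[OF t])
  let ?\<Omega> = "space M \<times> (UNIV :: real set)"
  let ?H = "\<lambda>\<tau> (\<omega>, u). product_payoff T L \<xi> \<alpha> u (\<tau> (\<omega>, u)) \<omega>"
  have Xm: "product_value t \<tau> \<in> borel_measurable (product_filtration M T F G t)" for \<tau>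
    unfolding product_value_def by auto
  define B where "B = {x\<in>space (product_filtration M T F G t). product_value t \<tau>2 x \<le> product_value t \<tau>1 x}"
  have B: "B \<in> sets (product_filtration M T F G t)"
    unfolding B_def using Xm[of \<tau>1] Xm[of \<tau>2] by measurable
  define \<tau> where "\<tau> x = (if x \<in> B then \<tau>1 x else \<tau>2 x)" for x
  have pf_mem: "space (product_filtration M T F G s) = ?\<Omega>" for s by (rule space_product_filtration)
  have mem: "\<tau>1 x \<in> {t..T}" "\<tau>2 x \<in> {t..T}" if "x \<in> ?\<Omega>" for x
    using \<tau>1 \<tau>2 that by (auto simp: stopping_times_def pf_mem)
  have \<tau>: "\<tau> \<in> stopping_times T (product_filtration M T F G) t"
  proof -
    have "Measurable.pred (index_ext T (product_filtration M T F G) s) (\<lambda>x. \<tau> x \<le> s)" for s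
    proof -
      let ?P = "index_ext T (product_filtration M T F G) s"
      have sp: "space ?P = ?\<Omega>" by (simp add: index_ext_def pf_mem)
      have "{x\<in>?\<Omega>. \<tau> x \<le> s} \<in> sets ?P"
      proof (cases "s < t")
        case True
        have "\<not> \<tau> x \<le> s" if "x \<in> ?\<Omega>" for x using mem[OF that] True by (auto simp: \<tau>_def)
        then have "{x\<in>?\<Omega>. \<tau> x \<le> s} = {}" by blast
        then show ?thesis by (simp only: sets.empty_sets)
      next
        case False
        then have "B \<in> sets ?P"
          using B sets_product_filtration_mono[of t "max 0 (min T s)"] t by (auto simp: index_ext_def)
        moreover have "{x\<in>?\<Omega>. \<tau>1 x \<le> s} \<in> sets ?P" "{x\<in>?\<Omega>. \<tau>2 x \<le> s} \<in> sets ?P"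
          using \<tau>1 \<tau>2 stopping_timeD[of "index_ext T (product_filtration M T F G)" _ s]
          by (auto simp: stopping_times_def pred_def sp)
        ultimately have "(B \<inter> {x\<in>?\<Omega>. \<tau>1 x \<le> s}) \<union> ({x\<in>?\<Omega>. \<tau>2 x \<le> s} - B) \<in> sets ?P" by auto
        also have "(B \<inter> {x\<in>?\<Omega>. \<tau>1 x \<le> s}) \<union> ({x\<in>?\<Omega>. \<tau>2 x \<le> s} - B) = {x\<in>?\<Omega>. \<tau> x \<le> s}"
          by (auto simp: \<tau>_def)
        finally show ?thesis .
      qed
      then show ?thesis by (simp add: pred_def sp)
    qed
    moreover have "\<tau> x \<in> {t..T}" if "x \<in> ?\<Omega>" for x using mem[OF that] by (simp add: \<tau>_def)
    ultimately show ?thesis by (auto simp: stopping_times_def stopping_time_def pf_mem)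
  qed
  have Hint: "integrable (product_space M G) (?H \<rho>)" if \<rho>: "\<rho> \<in> stopping_times T (product_filtration M T F G) t" for \<rho>
  proof -
    obtain \<sigma> where \<sigma>: "strict_stopping t \<sigma>" "AE x in product_space M G. \<sigma> x = \<rho> x"
      by (rule product_stopping_strict[OF t \<rho>])
    show ?thesis by (rule product_value_representation(1)[OF t \<sigma>])
  qed
  have BP: "B \<in> sets (product_space M G)" by (rule product_filtration_AE_eq(1)[OF t B])
  have i1: "integrable (product_space M G) (\<lambda>x. indicator B x * ?H \<tau>1 x)"
    using integrable_mult_indicator[OF BP Hint[OF \<tau>1]] by simp
  have i2: "integrable (product_space M G) (\<lambda>x. (1 - indicator B x) * ?H \<tau>2 x)"
    using Bochner_Integration.integrable_diff[OF Hint[OF \<tau>2] integrable_mult_indicator[OF BP Hint[OF \<tau>2]]]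
    by (simp add: left_diff_distrib)
  have H_eq: "?H \<tau> = (\<lambda>x. indicator B x * ?H \<tau>1 x + (1 - indicator B x) * ?H \<tau>2 x)"
    by (auto simp: fun_eq_iff \<tau>_def indicator_def)
  have "AE x in product_space M G. product_value t \<tau> x =
     real_cond_exp (product_space M G) (product_filtration M T F G t) (\<lambda>x. indicator B x * ?H \<tau>1 x) x +
     real_cond_exp (product_space M G) (product_filtration M T F G t) (\<lambda>x. (1 - indicator B x) * ?H \<tau>2 x) x"
    unfolding product_value_def H_eq by (rule s.real_cond_exp_add[OF i1 i2])
  moreover have "AE x in product_space M G.
     real_cond_exp (product_space M G) (product_filtration M T F G t) (\<lambda>x. indicator B x * ?H \<tau>1 x) x = indicator B x * product_value t \<tau>1 x"
    unfolding product_value_def using B i1 Hint[OF \<tau>1] by (intro s.real_cond_exp_mult) auto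
  moreover have "AE x in product_space M G.
     real_cond_exp (product_space M G) (product_filtration M T F G t) (\<lambda>x. (1 - indicator B x) * ?H \<tau>2 x) x = (1 - indicator B x) * product_value t \<tau>2 x"
    unfolding product_value_def using B i2 Hint[OF \<tau>2] by (intro s.real_cond_exp_mult) auto
  ultimately have "AE x in product_space M G. product_value t \<tau>1 x \<le> product_value t \<tau> x \<and> product_value t \<tau>2 x \<le> product_value t \<tau> x"
    using AE_space
  proof eventually_elim
    case (elim x)
    then show ?case
      by (cases "x \<in> B") (auto simp: B_def pf_mem space_product_space)
  qed
  with \<tau> show ?thesis by blast
qed

end

section \<open>Exchanging essential supremum and integral\<close>

context stopping_problem
begin

lemma stopped_payoff_bound:
  assumes t: "t \<in> {0..T}" and \<sigma>: "strict_stopping t \<sigma>"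
  shows "(\<integral>\<omega>. R (\<sigma> (\<omega>, G \<omega>)) \<omega> \<partial>M) \<le> (\<integral>\<omega>. enn2real (payoff_bound \<omega>) \<partial>M)"
proof (rule integral_mono_AE[OF stopped_payoff_integral(2)[OF t \<sigma>] integrable_payoff_bound(1)])
  show "AE \<omega> in M. R (\<sigma> (\<omega>, G \<omega>)) \<omega> \<le> enn2real (payoff_bound \<omega>)"
    using R_bound AE_space
  proof eventually_elim
    case (elim \<omega>)
    then have "\<bar>R (\<sigma> (\<omega>, G \<omega>)) \<omega>\<bar> \<le> enn2real (payoff_bound \<omega>)"
      using strict_stopping_mem[OF \<sigma>, of "(\<omega>, G \<omega>)"] t by auto
    then show ?case by linarith
  qed
qed

text \<open>The essential supremum is taken on the completed space but used by sections. The
  maximising times are therefore exchanged for strict ones and the limit for a version measurable on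
  the uncompleted product.\<close>

lemma product_ess_sup:
  assumes t: "t \<in> {0..T}"
  obtains \<sigma> :: "nat \<Rightarrow> 'a \<times> real \<Rightarrow> real" and Y where
    "\<And>n. strict_stopping t (\<sigma> n)" "integrable prod_measure Y"
    "AE x in prod_measure. incseq (\<lambda>n. cond_payoff t (\<sigma> n) x)"
    "AE x in prod_measure. (\<lambda>n. cond_payoff t (\<sigma> n) x) \<longlonglongrightarrow> Y x"
    "AE x in prod_measure. value_product M T F G \<alpha> L \<xi> t x = ereal (Y x)"
    "\<And>\<sigma>. strict_stopping t \<sigma> \<Longrightarrow> AE x in prod_measure. cond_payoff t \<sigma> x \<le> Y x"
proof -
  let ?I = "stopping_times T (product_filtration M T F G) t"
  let ?N = "product_space M G"
  interpret s: sigma_finite_subalgebra ?N "product_filtration M T F G t"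
    by (rule sigma_finite_product_filtration[OF t])
  have rep: "integrable ?N (product_value t \<tau>) \<and> integral\<^sup>L ?N (product_value t \<tau>) \<le> (\<integral>\<omega>. enn2real (payoff_bound \<omega>) \<partial>M)"
    if \<tau>: "\<tau> \<in> ?I" for \<tau>
  proof -
    obtain \<sigma> where \<sigma>: "strict_stopping t \<sigma>" "AE x in ?N. \<sigma> x = \<tau> x"
      by (rule product_stopping_strict[OF t \<tau>])
    note r = product_value_representation[OF t \<sigma>]
    show ?thesis
      using s.real_cond_exp_int[OF r(1)] r(2) stopped_payoff_bound[OF t \<sigma>(1)] by (simp add: product_value_def)
  qed
  \<comment> \<open>The constant time makes the family nonempty: \<open>t < s\<close> describes
    either everything or nothing.\<close>
  have "strict_stopping t (\<lambda>_. t)"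
    unfolding strict_stopping_def
  proof (intro conjI ballI)
    fix s assume s: "s \<in> {0..T}"
    show "{x \<in> space M \<times> UNIV. t < s} \<in> sets (F s \<Otimes>\<^sub>M (borel :: real measure))"
      using sets.top[of "F s \<Otimes>\<^sub>M (borel :: real measure)"] space_F[OF s] by (cases "t < s") (simp_all add: space_pair_measure)
  qed (use t in auto)
  from strict_stopping_product[OF t this] have "?I \<noteq> {}" by blast
  from directed_ess_sup[of ?I ?N "product_value t" "\<integral>\<omega>. enn2real (payoff_bound \<omega>) \<partial>M", OF this _ _ product_value_directed[OF t]] rep
  obtain j Y where j: "\<And>n. j n \<in> ?I" and Y: "integrable ?N Y"
    and inc: "AE x in ?N. incseq (\<lambda>n. product_value t (j n) x)"
    and lim: "AE x in ?N. (\<lambda>n. product_value t (j n) x) \<longlonglongrightarrow> Y x"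
    and es: "is_ess_sup ?N ?I (\<lambda>i x. ereal (product_value t i x)) (\<lambda>x. ereal (Y x))" by blast
  have V_eq: "value_product M T F G \<alpha> L \<xi> t = ess_sup ?N ?I (\<lambda>i x. ereal (product_value t i x))"
    by (simp add: value_product_def product_value_def)
  have V: "AE x in ?N. value_product M T F G \<alpha> L \<xi> t x = ereal (Y x)"
    unfolding V_eq by (rule ess_sup_AE_eq[OF es])
  have "\<exists>\<sigma>. strict_stopping t \<sigma> \<and> (AE x in ?N. product_value t (j n) x = cond_payoff t \<sigma> x)" for n
  proof -
    obtain \<sigma> where \<sigma>: "strict_stopping t \<sigma>" "AE x in ?N. \<sigma> x = j n x"
      by (rule product_stopping_strict[OF t j])
    show ?thesis using \<sigma>(1) product_value_representation(3)[OF t \<sigma>] by blast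
  qed
  then obtain \<sigma> where \<sigma>: "\<And>n. strict_stopping t (\<sigma> n)"
    "\<And>n. AE x in ?N. product_value t (j n) x = cond_payoff t (\<sigma> n) x" by metis
  have all: "AE x in ?N. \<forall>n. product_value t (j n) x = cond_payoff t (\<sigma> n) x"
    using \<sigma>(2) by (simp add: AE_all_countable)
  have "Y \<in> borel_measurable (completion prod_measure)" using Y by (auto simp: product_space_def)
  from completion_ex_borel_measurable_real[OF this]
  obtain Y' where Y'm: "Y' \<in> borel_measurable prod_measure" and "AE x in prod_measure. Y x = Y' x" by blast
  then have YY': "AE x in ?N. Y x = Y' x" by (simp add: AE_product_space)
  have "integrable ?N Y'"
    by (rule integrable_cong_AE_imp[OF Y measurable_product_space[OF Y'm] YY'])
  then have Y'i: "integrable prod_measure Y'" by (simp add: integral_product_space(1)[OF Y'm])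
  show ?thesis
  proof (rule that[OF \<sigma>(1) Y'i])
    show "AE x in prod_measure. incseq (\<lambda>n. cond_payoff t (\<sigma> n) x)"
      unfolding AE_product_space[symmetric] using all inc by eventually_elim simp
    show "AE x in prod_measure. (\<lambda>n. cond_payoff t (\<sigma> n) x) \<longlonglongrightarrow> Y' x"
      unfolding AE_product_space[symmetric] using all lim YY' by eventually_elim simp
    show "AE x in prod_measure. value_product M T F G \<alpha> L \<xi> t x = ereal (Y' x)"
      unfolding AE_product_space[symmetric] using V YY' by eventually_elim simp
    fix \<rho> assume \<rho>: "strict_stopping t \<rho>"
    have "AE x in ?N. ereal (product_value t \<rho> x) \<le> ereal (Y x)"
      using es strict_stopping_product[OF t \<rho>] by (auto simp: is_ess_sup_def)
    moreover have "AE x in ?N. product_value t \<rho> x = cond_payoff t \<rho> x"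
      by (rule product_value_representation(3)[OF t \<rho>]) simp
    ultimately show "AE x in prod_measure. cond_payoff t \<rho> x \<le> Y' x"
      unfolding AE_product_space[symmetric] using YY' by eventually_elim simp
  qed
qed

abbreviation enlarged_value :: "real \<Rightarrow> ('a \<Rightarrow> real) \<Rightarrow> 'a \<Rightarrow> real" where
  "enlarged_value t \<tau> \<equiv> real_cond_exp M (F t) (\<lambda>\<omega>. R (\<tau> \<omega>) \<omega>)"

text \<open>The minimality half of the essential supremum: \<open>Z\<close> is any candidate upper
  bound for the enlarged problem. Payoffs at the delayed times converge in L1, dominated by the
  envelope, so their conditional expectations converge along a subsequence and the bound by
  \<open>Z\<close> survives.\<close>

lemma graph_value_dominated:
  assumes t: "t \<in> {0..T}" and \<sigma>: "strict_stopping t \<sigma>"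
    and Z: "\<And>\<tau>. \<tau> \<in> stopping_times T (enlarged_filtration M F G) t \<Longrightarrow> AE \<omega> in M. ereal (enlarged_value t \<tau> \<omega>) \<le> Z \<omega>"
  shows "AE \<omega> in M. ereal (\<integral>u. cond_payoff t \<sigma> (\<omega>, u) \<partial>law M G) \<le> Z \<omega>"
proof -
  interpret s: sigma_finite_subalgebra M "F t" by (rule sigma_finite_F[OF t])
  define \<tau> where "\<tau> n \<omega> = min T (\<sigma> (\<omega>, G \<omega>) + 1 / (real n + 1))" for n \<omega>
  have \<tau>: "\<tau> n \<in> stopping_times T (enlarged_filtration M F G) t" for n
    unfolding \<tau>_def[abs_def] by (rule strict_stopping_enlarged[OF t \<sigma>])
  have \<sigma>_mem: "\<sigma> (\<omega>, G \<omega>) \<in> {0..T}" if "\<omega> \<in> space M" for \<omega>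
    using strict_stopping_mem[OF \<sigma>, of "(\<omega>, G \<omega>)"] t that by auto
  have \<tau>_mem: "\<tau> n \<omega> \<in> {0..T}" if "\<omega> \<in> space M" for n \<omega>
    using \<sigma>_mem[OF that] by (auto simp: \<tau>_def)
  have \<tau>m: "\<tau> n \<in> borel_measurable M" for n
  proof -
    have "(\<lambda>\<omega>. (\<omega>, G \<omega>)) \<in> M \<rightarrow>\<^sub>M F T \<Otimes>\<^sub>M borel"
      by (rule measurable_Pair[OF measurable_F[OF T_mem] G_meas]) auto
    from measurable_compose[OF this strict_stopping_measurable[OF \<sigma> t]]
    have [measurable]: "(\<lambda>\<omega>. \<sigma> (\<omega>, G \<omega>)) \<in> borel_measurable M" .
    show ?thesis unfolding \<tau>_def[abs_def] by measurable
  qed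
  have Rm: "R s \<in> borel_measurable M" if "s \<in> {0..T}" for s
    using R_adapted that by (intro measurable_F[OF that]) (auto simp: adapted_def)
  have fm: "(\<lambda>\<omega>. R (\<tau> n \<omega>) \<omega>) \<in> borel_measurable M" for n
    by (rule measurable_stopped[OF T_nonneg \<tau>m \<tau>_mem Rm R_right_cont])
  have bd: "AE \<omega> in M. norm (R (\<tau> n \<omega>) \<omega>) \<le> norm (enn2real (payoff_bound \<omega>))" for n
    using R_bound AE_space by eventually_elim (use \<tau>_mem in auto)
  have f: "integrable M (\<lambda>\<omega>. R (\<tau> n \<omega>) \<omega>)" for n
    by (rule Bochner_Integration.integrable_bound[OF integrable_payoff_bound(1) fm bd])
  have g: "integrable M (\<lambda>\<omega>. R (\<sigma> (\<omega>, G \<omega>)) \<omega>)" by (rule stopped_payoff_integral(2)[OF t \<sigma>])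
  have lim: "(\<lambda>n. R (\<tau> n \<omega>) \<omega>) \<longlonglongrightarrow> R (\<sigma> (\<omega>, G \<omega>)) \<omega>" if \<omega>: "\<omega> \<in> space M" for \<omega>
  proof (cases "\<sigma> (\<omega>, G \<omega>) = T")
    case True
    then show ?thesis by (simp add: \<tau>_def min_def)
  next
    case False
    let ?y = "\<sigma> (\<omega>, G \<omega>)"
    have y: "?y \<in> {0..<T}" using \<sigma>_mem[OF \<omega>] False by auto
    have gt: "?y < \<tau> n \<omega>" for n using y by (simp add: \<tau>_def)
    have "(\<lambda>n. min T (?y + 1 / (real n + 1))) \<longlonglongrightarrow> min T (?y + 0)"
      using LIMSEQ_inverse_real_of_nat
      by (intro tendsto_min tendsto_add tendsto_const) (simp add: inverse_eq_divide add.commute)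
    then have "(\<lambda>n. \<tau> n \<omega>) \<longlonglongrightarrow> ?y" using y by (simp add: \<tau>_def)
    then have "filterlim (\<lambda>n. \<tau> n \<omega>) (at_right ?y) sequentially"
      by (auto simp: filterlim_at gt less_imp_neq[OF gt, symmetric])
    moreover have "((\<lambda>s. R s \<omega>) \<longlongrightarrow> R ?y \<omega>) (at_right ?y)"
      using R_right_cont[OF \<omega> y] by (simp add: continuous_within)
    ultimately show ?thesis by (rule filterlim_compose[rotated])
  qed
  have "(\<lambda>n. \<integral>\<omega>. \<bar>R (\<tau> n \<omega>) \<omega> - R (\<sigma> (\<omega>, G \<omega>)) \<omega>\<bar> \<partial>M) \<longlonglongrightarrow> (\<integral>\<omega>. 0 \<partial>M)"
  proof (rule integral_dominated_convergence[where w = "\<lambda>\<omega>. enn2real (payoff_bound \<omega>) + \<bar>R (\<sigma> (\<omega>, G \<omega>)) \<omega>\<bar>"])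
    show "AE \<omega> in M. (\<lambda>n. \<bar>R (\<tau> n \<omega>) \<omega> - R (\<sigma> (\<omega>, G \<omega>)) \<omega>\<bar>) \<longlonglongrightarrow> 0"
      using lim by (intro AE_I2 tendsto_rabs_zero) (simp add: LIM_zero_iff)
    show "AE \<omega> in M. norm \<bar>R (\<tau> n \<omega>) \<omega> - R (\<sigma> (\<omega>, G \<omega>)) \<omega>\<bar> \<le> enn2real (payoff_bound \<omega>) + \<bar>R (\<sigma> (\<omega>, G \<omega>)) \<omega>\<bar>" for n
      using bd[of n] by eventually_elim auto
  qed (use g fm integrable_payoff_bound(1) in auto)
  then have "(\<lambda>n. \<integral>\<omega>. \<bar>R (\<tau> n \<omega>) \<omega> - R (\<sigma> (\<omega>, G \<omega>)) \<omega>\<bar> \<partial>M) \<longlonglongrightarrow> 0" by simp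
  from s.real_cond_exp_AE_subseq[OF f g this] obtain r :: "nat \<Rightarrow> nat" where
    r: "AE \<omega> in M. (\<lambda>n. enlarged_value t (\<tau> (r n)) \<omega>) \<longlonglongrightarrow> enlarged_value t (\<lambda>\<omega>. \<sigma> (\<omega>, G \<omega>)) \<omega>"
    by blast
  have "AE \<omega> in M. \<forall>n. ereal (enlarged_value t (\<tau> n) \<omega>) \<le> Z \<omega>"
    using Z[OF \<tau>] by (simp add: AE_all_countable)
  with r cond_exp_graph_stopped[OF t \<sigma>] show ?thesis
  proof eventually_elim
    case (elim \<omega>)
    have "ereal (enlarged_value t (\<lambda>\<omega>. \<sigma> (\<omega>, G \<omega>)) \<omega>) \<le> Z \<omega>"
      using elim(1,3) by (intro LIMSEQ_le_const2[of "\<lambda>n. ereal (enlarged_value t (\<tau> (r n)) \<omega>)"]) auto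
    then show ?case using elim(2) by simp
  qed
qed

text \<open>The first two claims guard against default values: \<open>real_of_ereal\<close> sends
  infinities to 0, and the Bochner integral of a non-integrable function is 0. They ensure that the
  integral in the third claim is a genuine one.\<close>

theorem value_enlarged_eq_integral:
  assumes t: "t \<in> {0..T}"
  shows "AE x in product_space M G. \<bar>value_product M T F G \<alpha> L \<xi> t x\<bar> \<noteq> \<infinity>"
    "AE \<omega> in M. integrable (completion (law M G)) (\<lambda>u. real_of_ereal (value_product M T F G \<alpha> L \<xi> t (\<omega>, u)))"
    "AE \<omega> in M. value_enlarged M T F G L \<xi> t \<omega> =
       ereal (\<integral>u. real_of_ereal (value_product M T F G \<alpha> L \<xi> t (\<omega>, u)) \<partial>completion (law M G))"
proof -
  let ?V = "value_product M T F G \<alpha> L \<xi> t"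
  obtain \<sigma> Y where \<sigma>: "\<And>n :: nat. strict_stopping t (\<sigma> n)" and Y: "integrable prod_measure Y"
    and inc: "AE x in prod_measure. incseq (\<lambda>n. cond_payoff t (\<sigma> n) x)"
    and lim: "AE x in prod_measure. (\<lambda>n. cond_payoff t (\<sigma> n) x) \<longlonglongrightarrow> Y x"
    and V: "AE x in prod_measure. ?V x = ereal (Y x)"
    and dom: "\<And>\<sigma>. strict_stopping t \<sigma> \<Longrightarrow> AE x in prod_measure. cond_payoff t \<sigma> x \<le> Y x"
    by (rule product_ess_sup[OF t]) blast
  show "AE x in product_space M G. \<bar>?V x\<bar> \<noteq> \<infinity>"
    unfolding AE_product_space using V by eventually_elim simp
  have secY: "AE \<omega> in M. integrable (law M G) (\<lambda>u. Y (\<omega>, u))" by (rule pair.AE_integrable_fst'[OF Y])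
  have secW: "AE \<omega> in M. integrable (law M G) (\<lambda>u. cond_payoff t \<rho> (\<omega>, u))" if "strict_stopping t \<rho>" for \<rho>
    by (rule pair.AE_integrable_fst'[OF cond_payoff_integrable[OF t that]])
  \<comment> \<open>Sections of the essential supremum agree with Borel sections of \<open>Y\<close>
    only up to a \<open>law M G\<close>-null set, so their measurability is that of the completion;
    the value of the integral is unaffected.\<close>
  have secV: "AE \<omega> in M. integrable (completion (law M G)) (\<lambda>u. real_of_ereal (?V (\<omega>, u))) \<and>
     (\<integral>u. real_of_ereal (?V (\<omega>, u)) \<partial>completion (law M G)) = (\<integral>u. Y (\<omega>, u) \<partial>law M G)"
    using pair.AE_pair[OF V] secY
  proof eventually_elim
    case (elim \<omega>)
    have Ym: "(\<lambda>u. Y (\<omega>, u)) \<in> borel_measurable (law M G)" using elim(2) by auto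
    have eq: "AE u in completion (law M G). Y (\<omega>, u) = real_of_ereal (?V (\<omega>, u))"
      unfolding AE_completion_iff using elim(1) by eventually_elim simp
    have Vm: "(\<lambda>u. real_of_ereal (?V (\<omega>, u))) \<in> borel_measurable (completion (law M G))"
      by (rule completion.measurable_AE_eq[OF measurable_completion[OF Ym] eq]) simp
    have Yi: "integrable (completion (law M G)) (\<lambda>u. Y (\<omega>, u))"
      using elim(2) by (simp add: integrable_completion[OF Ym])
    have "integrable (completion (law M G)) (\<lambda>u. real_of_ereal (?V (\<omega>, u)))"
      by (rule integrable_cong_AE_imp[OF Yi Vm]) (use eq in \<open>eventually_elim, simp\<close>)
    moreover have "(\<integral>u. real_of_ereal (?V (\<omega>, u)) \<partial>completion (law M G)) = (\<integral>u. Y (\<omega>, u) \<partial>completion (law M G))"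
      by (rule integral_cong_AE[OF Vm measurable_completion[OF Ym]]) (use eq in \<open>eventually_elim, simp\<close>)
    ultimately show ?case by (simp add: integral_completion[OF Ym])
  qed
  then show "AE \<omega> in M. integrable (completion (law M G)) (\<lambda>u. real_of_ereal (?V (\<omega>, u)))"
    by eventually_elim simp
  define v where "v \<omega> = (\<integral>u. Y (\<omega>, u) \<partial>law M G)" for \<omega>
  have vm: "v \<in> borel_measurable M"
    using pair.integrable_fst'[OF Y] unfolding v_def[abs_def] by auto
  let ?J = "stopping_times T (enlarged_filtration M F G) t"
  have "is_ess_sup M ?J (\<lambda>\<tau> \<omega>. ereal (enlarged_value t \<tau> \<omega>)) (\<lambda>\<omega>. ereal (v \<omega>))"
    unfolding is_ess_sup_def
  proof (intro conjI ballI impI)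
    show "(\<lambda>\<omega>. ereal (v \<omega>)) \<in> borel_measurable M" using vm by simp
  next
    interpret s: sigma_finite_subalgebra M "F t" by (rule sigma_finite_F[OF t])
    \<comment> \<open>Upper bound: the lifted time has its conditional payoff below \<open>Y\<close>
      almost everywhere on the product, hence below it on almost every section.\<close>
    fix \<tau> assume "\<tau> \<in> ?J"
    from enlarged_stopping_lift[OF t this] obtain \<rho> where
      \<rho>: "strict_stopping t \<rho>" "\<And>\<omega>. \<omega> \<in> space M \<Longrightarrow> \<rho> (\<omega>, G \<omega>) = \<tau> \<omega>" by blast
    have gm: "(\<lambda>\<omega>. R (\<rho> (\<omega>, G \<omega>)) \<omega>) \<in> borel_measurable M" using stopped_payoff_integral(2)[OF t \<rho>(1)] by auto
    have eq: "R (\<rho> (\<omega>, G \<omega>)) \<omega> = R (\<tau> \<omega>) \<omega>" if "\<omega> \<in> space M" for \<omega> using \<rho>(2)[OF that] by simp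
    have fm: "(\<lambda>\<omega>. R (\<tau> \<omega>) \<omega>) \<in> borel_measurable M"
      using gm measurable_cong[of M "\<lambda>\<omega>. R (\<rho> (\<omega>, G \<omega>)) \<omega>" "\<lambda>\<omega>. R (\<tau> \<omega>) \<omega>", OF eq] by blast
    have "AE \<omega> in M. enlarged_value t (\<lambda>\<omega>. \<rho> (\<omega>, G \<omega>)) \<omega> = enlarged_value t \<tau> \<omega>"
      by (rule s.real_cond_exp_cong[OF AE_I2[OF eq] gm fm])
    then show "AE \<omega> in M. ereal (enlarged_value t \<tau> \<omega>) \<le> ereal (v \<omega>)"
      using cond_exp_graph_stopped[OF t \<rho>(1)] pair.AE_pair[OF dom[OF \<rho>(1)]] secY secW[OF \<rho>(1)]
    proof eventually_elim
      case (elim \<omega>)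
      have "(\<integral>u. cond_payoff t \<rho> (\<omega>, u) \<partial>law M G) \<le> v \<omega>"
        unfolding v_def by (rule integral_mono_AE[OF elim(5,4,3)])
      then show ?case using elim(1,2) by simp
    qed
  next
    fix Z assume Z: "Z \<in> borel_measurable M" "\<forall>\<tau>\<in>?J. AE \<omega> in M. ereal (enlarged_value t \<tau> \<omega>) \<le> Z \<omega>"
    have "AE \<omega> in M. \<forall>n. ereal (\<integral>u. cond_payoff t (\<sigma> n) (\<omega>, u) \<partial>law M G) \<le> Z \<omega>"
      using graph_value_dominated[OF t \<sigma>] Z(2) by (simp add: AE_all_countable)
    moreover have "AE \<omega> in M. \<forall>n. integrable (law M G) (\<lambda>u. cond_payoff t (\<sigma> n) (\<omega>, u))"
      using secW[OF \<sigma>] by (simp add: AE_all_countable)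
    ultimately show "AE \<omega> in M. ereal (v \<omega>) \<le> Z \<omega>"
      using pair.AE_pair[OF inc] pair.AE_pair[OF lim] secY
    proof eventually_elim
      case (elim \<omega>)
      \<comment> \<open>An increasing sequence lies between its first member and its limit, and both
        have integrable sections; this provides the dominating function.\<close>
      have "(\<lambda>n. \<integral>u. cond_payoff t (\<sigma> n) (\<omega>, u) \<partial>law M G) \<longlonglongrightarrow> v \<omega>"
        unfolding v_def
      proof (rule integral_dominated_convergence[where w = "\<lambda>u. \<bar>cond_payoff t (\<sigma> 0) (\<omega>, u)\<bar> + \<bar>Y (\<omega>, u)\<bar>"])
        show "AE u in law M G. norm (cond_payoff t (\<sigma> n) (\<omega>, u)) \<le> \<bar>cond_payoff t (\<sigma> 0) (\<omega>, u)\<bar> + \<bar>Y (\<omega>, u)\<bar>" for n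
          using elim(3,4)
        proof eventually_elim
          case (elim u)
          have "cond_payoff t (\<sigma> 0) (\<omega>, u) \<le> cond_payoff t (\<sigma> n) (\<omega>, u)" using elim(1) by (auto simp: incseq_def)
          moreover have "cond_payoff t (\<sigma> n) (\<omega>, u) \<le> Y (\<omega>, u)" by (rule incseq_le[OF elim])
          ultimately show ?case by auto
        qed
      qed (use elim in auto)
      then show ?case
        using elim(1) by (intro LIMSEQ_le_const2[of "\<lambda>n. ereal (\<integral>u. cond_payoff t (\<sigma> n) (\<omega>, u) \<partial>law M G)"]) auto
    qed
  qed
  from ess_sup_AE_eq[OF this]
  have "AE \<omega> in M. value_enlarged M T F G L \<xi> t \<omega> = ereal (v \<omega>)" by (simp add: value_enlarged_def)
  then show "AE \<omega> in M. value_enlarged M T F G L \<xi> t \<omega> =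
       ereal (\<integral>u. real_of_ereal (?V (\<omega>, u)) \<partial>completion (law M G))"
    using secV by eventually_elim (simp add: v_def)
qed

end

text \<open>Stopping \<open>\<alpha>\<close> at a random time involves whole paths, so a choice of
  each density up to null sets would not determine the stopped payoff; \<open>density_cadlag\<close>
  fixes the paths.\<close>

theorem theorem3p13:
  fixes M :: "'a measure" and T :: real and F :: "real \<Rightarrow> 'a measure"
    and G :: "'a \<Rightarrow> real" and P :: "real \<Rightarrow> 'a \<Rightarrow> real measure"
    and \<alpha> :: "real \<Rightarrow> real \<Rightarrow> 'a \<Rightarrow> real"
    and L :: "real \<Rightarrow> 'a \<Rightarrow> real" and \<xi> :: "'a \<Rightarrow> real"
  assumes "T > 0"
    and "filtered_prob_space M T F"
    and "right_continuous_filtration T F"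
    and "complete_filtration M F"
    and "trivial_sigma_algebra M (F 0)"
    and "G \<in> borel_measurable M"
    and regular_conditional_law: "\<And>t. t \<in> {0..T} \<Longrightarrow> regular_cond_law M (F t) G (P t)"
    and density_hypothesis:
      "\<And>t. t \<in> {0..T} \<Longrightarrow> AE \<omega> in M. equivalent_measures (P t \<omega>) (law M G)"
    and density_measurable:
      "\<And>t. t \<in> {0..T} \<Longrightarrow> (\<lambda>(\<omega>, u). \<alpha> t u \<omega>) \<in> borel_measurable (M \<Otimes>\<^sub>M borel)"
    and density_pos: "\<And>t u \<omega>. t \<in> {0..T} \<Longrightarrow> \<omega> \<in> space M \<Longrightarrow> \<alpha> t u \<omega> > 0"
    and density:
      "\<And>t. t \<in> {0..T} \<Longrightarrow> AE \<omega> in M. P t \<omega> = density (law M G) (\<lambda>u. ennreal (\<alpha> t u \<omega>))"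
    and density_martingale: "\<And>u. martingale M T F (\<lambda>t. \<alpha> t u)"
    and density_cadlag: "\<And>u. cadlag M T (\<lambda>t. \<alpha> t u)"
    and "adapted T F L"
    and "cadlag M T L"
    and "\<xi> \<in> borel_measurable (F T)"
    and "AE \<omega> in M. 0 \<le> L T \<omega> \<and> L T \<omega> \<le> \<xi> \<omega>"
    and integrability:
      "(\<integral>\<^sup>+ \<omega>. ((SUP t\<in>{0..T}. ennreal \<bar>L t \<omega>\<bar>) + ennreal \<bar>\<xi> \<omega>\<bar>) \<partial>M) < \<infinity>"
  shows "\<forall>t\<in>{0..T}.
    (AE x in product_space M G. \<bar>value_product M T F G \<alpha> L \<xi> t x\<bar> \<noteq> \<infinity>) \<and>
    (AE \<omega> in M. integrable (completion (law M G)) (\<lambda>u. real_of_ereal (value_product M T F G \<alpha> L \<xi> t (\<omega>, u)))) \<and>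
    (AE \<omega> in M. value_enlarged M T F G L \<xi> t \<omega> =
       ereal (\<integral>u. real_of_ereal (value_product M T F G \<alpha> L \<xi> t (\<omega>, u)) \<partial>completion (law M G)))"
proof
  fix t assume t: "t \<in> {0..T}"
  have T: "T \<in> {0..T}" using \<open>T > 0\<close> by auto
  have nonneg: "0 \<le> \<alpha> s u \<omega>" if "s \<in> {0..T}" "\<omega> \<in> space M" for s u \<omega>
    using density_pos[OF that] by (rule less_imp_le)
  interpret stopping_problem M T F G "P T" \<alpha> L \<xi>
    by (intro stopping_problem.intro enlargement.intro filtered_space.intro enlargement_axioms.intro
        stopping_problem_axioms.intro; fact assms regular_conditional_law[OF T] density[OF T] nonneg)
  show "(AE x in product_space M G. \<bar>value_product M T F G \<alpha> L \<xi> t x\<bar> \<noteq> \<infinity>) \<and>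
    (AE \<omega> in M. integrable (completion (law M G)) (\<lambda>u. real_of_ereal (value_product M T F G \<alpha> L \<xi> t (\<omega>, u)))) \<and>
    (AE \<omega> in M. value_enlarged M T F G L \<xi> t \<omega> =
       ereal (\<integral>u. real_of_ereal (value_product M T F G \<alpha> L \<xi> t (\<omega>, u)) \<partial>completion (law M G)))"
    using value_enlarged_eq_integral[OF t] by blast
qed

end
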